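(* Let $\mathcal{A}$ be a Frobenius abelian category and let $\mathcal{P}$ be its subcategory of projective (= injective) objects. Suppose that $\underline{\mathcal{A}}=\mathcal{A}/\mathcal{P}$ has split idempotents. For a subcategory $\mathcal{X}\subseteq\mathcal{A}$, the following assertions hold: (1) $\mathcal{X}$ is a preenveloping resolving subcategory of $\mathcal{A}$ closed under direct summands if, and only if, there is a complete cotorsion pair $(\mathcal{Z},\mathcal{X})$ in $\mathcal{A}$ such that $\Omega(\underline{\mathcal{X}})\subseteq\underline{\mathcal{X}}$. (2) $\mathcal{X}$ is a precovering coresolving subcategory of $\mathcal{A}$ closed under direct summands if, and only if, there is a complete cotorsion pair $(\mathcal{X},\mathcal{Y})$ in $\mathcal{A}$ such that $\Omega^{-1}(\underline{\mathcal{X}})\subseteq\underline{\mathcal{X}}$. In particular, there are bijections between: (a) precovering coresolving subcategories of $\mathcal{A}$ closed under direct summands; (b) t-structures $(\mathcal{U},\Sigma(\mathcal{V}))$ in $\underline{\mathcal{A}}$; (c) preenveloping resolving subcategories of $\mathcal{A}$ closed under direct summands; (d) complete cotorsion pairs $(\mathcal{Z},\mathcal{W})$ in $\mathcal{A}$ such that $\Omega^{-1}(\underline{\mathcal{Z}})\subseteq\underline{\mathcal{Z}}$ (or, equivalently, such that $\Omega(\underline{\mathcal{W}})\subseteq\underline{\mathcal{W}}$).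
   Context: All subcategories are full and closed under isomorphisms. An abelian category is Frobenius if it has enough projectives and enough injectives and projective and injective objects coincide. $\underline{\mathcal{A}}=\mathcal{A}/\mathcal{P}$ has the objects of $\mathcal{A}$ and morphism groups $\mathcal{A}(A,B)$ modulo the morphisms factoring through an object of $\mathcal{P}$; it is a triangulated category with suspension $\Sigma=\Omega^{-1}$, where $\Omega(A)$ is the kernel of an epimorphism $P\to A$ with $P$ projective and $\Omega^{-1}(A)$ is the cokernel of a monomorphism $A\to I$ with $I$ injective; $\Omega$ and $\Omega^{-1}$ are mutually quasi-inverse self-equivalences of $\underline{\mathcal{A}}$. For a class $\mathcal{X}$ of objects, $\underline{\mathcal{X}}$ is the full subcategory of $\underline{\mathcal{A}}$ on the objects of $\mathcal{X}$. A full additive subcategory $\mathcal{X}$ of $\mathcal{A}$ is resolving if it contains $\mathcal{P}$, is closed under kernels of epimorphisms (between objects of $\mathcal{X}$), and is closed under extensions. It is coresolving if it contains $\mathcal{P}$ (the injectives), is closed under cokernels of monomorphisms (between objects of $\mathcal{X}$), and is closed under extensions. An $\mathcal{X}$-precover of $A$ is $f:X\to A$ with $X\in\mathcal{X}$ and $\mathcal{A}(X',f)$ surjective for all $X'\in\mathcal{X}$; $\mathcal{X}$ is precovering if every object has an $\mathcal{X}$-precover. $\mathcal{X}$-preenvelopes and preenveloping are dual. A cotorsion pair in $\mathcal{A}$ is a pair $(\mathcal{X},\mathcal{Y})$ of classes of objects with $\mathcal{Y}=\{Y:\operatorname{Ext}^1(X,Y)=0\ \forall X\in\mathcal{X}\}$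 and $\mathcal{X}=\{X:\operatorname{Ext}^1(X,Y)=0\ \forall Y\in\mathcal{Y}\}$; it is complete if for every object $A$ there are short exact sequences $0\to Y\to X\to A\to 0$ and $0\to A\to Y'\to X'\to 0$ with $X,X'\in\mathcal{X}$ and $Y,Y'\in\mathcal{Y}$. A t-structure in a triangulated category $\mathcal{D}$ is a pair $(\mathcal{D}^{\leq 0},\mathcal{D}^{\geq 0})$ of full subcategories such that, with $\mathcal{D}^{\leq n}=\Sigma^{-n}(\mathcal{D}^{\leq 0})$ and $\mathcal{D}^{\geq n}=\Sigma^{-n}(\mathcal{D}^{\geq 0})$: $\mathcal{D}(D,D')=0$ for $D\in\mathcal{D}^{\leq 0}$, $D'\in\mathcal{D}^{\geq 1}$; $\mathcal{D}^{\leq 0}\subseteq\mathcal{D}^{\leq 1}$ and $\mathcal{D}^{\geq 1}\subseteq\mathcal{D}^{\geq 0}$; and every $D\in\mathcal{D}$ fits in a triangle $D^{\leq 0}\to D\to D^{\geq 1}\to\Sigma(D^{\leq 0})$ with $D^{\leq 0}\in\mathcal{D}^{\leq 0}$, $D^{\geq 1}\in\mathcal{D}^{\geq 1}$. In the notation $(\mathcal{U},\Sigma(\mathcal{V}))$, $\mathcal{U}=\mathcal{D}^{\leq 0}$ and $\mathcal{V}=\mathcal{D}^{\geq 1}$. Split idempotents: each idempotent $e:A\to A$ factors as $e=ip$ with $pi=1$. *)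

theory Defs
  imports "HOL-Algebra.Group"
begin

section \<open>Preadditive and abelian categories\<close>

record ('o, 'm) cat =
  Ob :: "'o set"
  Arr :: "'m set"
  Dom :: "'m \<Rightarrow> 'o"
  Cod :: "'m \<Rightarrow> 'o"
  Id :: "'o \<Rightarrow> 'm"
  Comp :: "'m \<Rightarrow> 'm \<Rightarrow> 'm"  (infixl \<open>\<cdot>\<index>\<close> 70)

record ('o, 'm) add_cat = "('o, 'm) cat" +
  Add :: "'m \<Rightarrow> 'm \<Rightarrow> 'm"  (infixl \<open>\<boxplus>\<index>\<close> 65)
  Zero :: "'o \<Rightarrow> 'o \<Rightarrow> 'm"

definition Hom :: "('o, 'm, 'e) cat_scheme \<Rightarrow> 'o \<Rightarrow> 'o \<Rightarrow> 'm set" where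
  "Hom C A B = {f \<in> Arr C. Dom C f = A \<and> Cod C f = B}"

locale category =
  fixes C :: "('o, 'm, 'e) cat_scheme" (structure)
  assumes Dom_in: "f \<in> Arr C \<Longrightarrow> Dom C f \<in> Ob C"
    and Cod_in: "f \<in> Arr C \<Longrightarrow> Cod C f \<in> Ob C"
    and Id_hom: "A \<in> Ob C \<Longrightarrow> Id C A \<in> Hom C A A"
    and Comp_hom: "\<lbrakk>f \<in> Hom C A B; g \<in> Hom C B D\<rbrakk> \<Longrightarrow> g \<cdot> f \<in> Hom C A D"
    and Comp_assoc:
      "\<lbrakk>f \<in> Hom C A B; g \<in> Hom C B D; h \<in> Hom C D E\<rbrakk> \<Longrightarrow> h \<cdot> (g \<cdot> f) = (h \<cdot> g) \<cdot> f"
    and Id_left: "f \<in> Hom C A B \<Longrightarrow> Id C B \<cdot> f = f"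
    and Id_right: "f \<in> Hom C A B \<Longrightarrow> f \<cdot> Id C A = f"

text \<open>The abelian group of morphisms from \<open>A\<close> to \<open>B\<close>; the (multiplicatively written) group
  operation of HOL-Algebra is addition of morphisms.\<close>

definition hom_group :: "('o, 'm, 'e) add_cat_scheme \<Rightarrow> 'o \<Rightarrow> 'o \<Rightarrow> 'm monoid" where
  "hom_group C A B = \<lparr>carrier = Hom C A B, mult = Add C, one = Zero C A B\<rparr>"

locale preadditive_category = category C
  for C :: "('o, 'm, 'e) add_cat_scheme" (structure) +
  assumes hom_comm_group: "\<lbrakk>A \<in> Ob C; B \<in> Ob C\<rbrakk> \<Longrightarrow> comm_group (hom_group C A B)"
    and Comp_Add_left: "\<lbrakk>f \<in> Hom C A B; g \<in> Hom C B D; g' \<in> Hom C B D\<rbrakk>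
      \<Longrightarrow> (g \<boxplus> g') \<cdot> f = (g \<cdot> f) \<boxplus> (g' \<cdot> f)"
    and Comp_Add_right: "\<lbrakk>f \<in> Hom C A B; f' \<in> Hom C A B; g \<in> Hom C B D\<rbrakk>
      \<Longrightarrow> g \<cdot> (f \<boxplus> f') = (g \<cdot> f) \<boxplus> (g \<cdot> f')"

definition is_iso :: "('o, 'm, 'e) cat_scheme \<Rightarrow> 'm \<Rightarrow> bool" where
  "is_iso C f \<longleftrightarrow> f \<in> Arr C \<and> (\<exists>g \<in> Hom C (Cod C f) (Dom C f).
     g \<cdot>\<^bsub>C\<^esub> f = Id C (Dom C f) \<and> f \<cdot>\<^bsub>C\<^esub> g = Id C (Cod C f))"

definition isomorphic :: "('o, 'm, 'e) cat_scheme \<Rightarrow> 'o \<Rightarrow> 'o \<Rightarrow> bool" where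
  "isomorphic C A B \<longleftrightarrow> (\<exists>f \<in> Hom C A B. is_iso C f)"

definition is_mono :: "('o, 'm, 'e) cat_scheme \<Rightarrow> 'm \<Rightarrow> bool" where
  "is_mono C f \<longleftrightarrow> f \<in> Arr C \<and> (\<forall>A. \<forall>g \<in> Hom C A (Dom C f). \<forall>h \<in> Hom C A (Dom C f).
     f \<cdot>\<^bsub>C\<^esub> g = f \<cdot>\<^bsub>C\<^esub> h \<longrightarrow> g = h)"

definition is_epi :: "('o, 'm, 'e) cat_scheme \<Rightarrow> 'm \<Rightarrow> bool" where
  "is_epi C f \<longleftrightarrow> f \<in> Arr C \<and> (\<forall>A. \<forall>g \<in> Hom C (Cod C f) A. \<forall>h \<in> Hom C (Cod C f) A.
     g \<cdot>\<^bsub>C\<^esub> f = h \<cdot>\<^bsub>C\<^esub> f \<longrightarrow> g = h)"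

definition split_idempotents :: "('o, 'm, 'e) cat_scheme \<Rightarrow> bool" where
  "split_idempotents C \<longleftrightarrow> (\<forall>A \<in> Ob C. \<forall>e \<in> Hom C A A. e \<cdot>\<^bsub>C\<^esub> e = e \<longrightarrow>
     (\<exists>B \<in> Ob C. \<exists>p \<in> Hom C A B. \<exists>i \<in> Hom C B A. e = i \<cdot>\<^bsub>C\<^esub> p \<and> p \<cdot>\<^bsub>C\<^esub> i = Id C B))"

definition is_zero_object :: "('o, 'm, 'e) cat_scheme \<Rightarrow> 'o \<Rightarrow> bool" where
  "is_zero_object C Z \<longleftrightarrow> Z \<in> Ob C \<and>
     (\<forall>A \<in> Ob C. (\<exists>!f. f \<in> Hom C A Z) \<and> (\<exists>!f. f \<in> Hom C Z A))"

text \<open>\<open>S\<close> is a biproduct (direct sum) of \<open>A\<close> and \<open>B\<close>.\<close>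

definition is_biproduct :: "('o, 'm, 'e) add_cat_scheme \<Rightarrow> 'o \<Rightarrow> 'o \<Rightarrow> 'o \<Rightarrow> bool" where
  "is_biproduct C A B S \<longleftrightarrow> A \<in> Ob C \<and> B \<in> Ob C \<and> S \<in> Ob C \<and>
     (\<exists>i \<in> Hom C A S. \<exists>j \<in> Hom C B S. \<exists>p \<in> Hom C S A. \<exists>q \<in> Hom C S B.
        p \<cdot>\<^bsub>C\<^esub> i = Id C A \<and> q \<cdot>\<^bsub>C\<^esub> j = Id C B \<and>
        p \<cdot>\<^bsub>C\<^esub> j = Zero C B A \<and> q \<cdot>\<^bsub>C\<^esub> i = Zero C A B \<and>
        (i \<cdot>\<^bsub>C\<^esub> p) \<boxplus>\<^bsub>C\<^esub> (j \<cdot>\<^bsub>C\<^esub> q) = Id C S)"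

definition is_kernel :: "('o, 'm, 'e) add_cat_scheme \<Rightarrow> 'm \<Rightarrow> 'm \<Rightarrow> bool" where
  "is_kernel C k f \<longleftrightarrow> f \<in> Arr C \<and> k \<in> Arr C \<and> Cod C k = Dom C f \<and>
     f \<cdot>\<^bsub>C\<^esub> k = Zero C (Dom C k) (Cod C f) \<and>
     (\<forall>h \<in> Arr C. Cod C h = Dom C f \<and> f \<cdot>\<^bsub>C\<^esub> h = Zero C (Dom C h) (Cod C f) \<longrightarrow>
        (\<exists>!u. u \<in> Hom C (Dom C h) (Dom C k) \<and> k \<cdot>\<^bsub>C\<^esub> u = h))"

definition is_cokernel :: "('o, 'm, 'e) add_cat_scheme \<Rightarrow> 'm \<Rightarrow> 'm \<Rightarrow> bool" where
  "is_cokernel C c f \<longleftrightarrow> f \<in> Arr C \<and> c \<in> Arr C \<and> Dom C c = Cod C f \<and>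
     c \<cdot>\<^bsub>C\<^esub> f = Zero C (Dom C f) (Cod C c) \<and>
     (\<forall>h \<in> Arr C. Dom C h = Cod C f \<and> h \<cdot>\<^bsub>C\<^esub> f = Zero C (Dom C f) (Cod C h) \<longrightarrow>
        (\<exists>!u. u \<in> Hom C (Cod C c) (Cod C h) \<and> u \<cdot>\<^bsub>C\<^esub> c = h))"

locale abelian_category = preadditive_category C
  for C :: "('o, 'm, 'e) add_cat_scheme" (structure) +
  assumes zero_object: "\<exists>Z. is_zero_object C Z"
    and biproducts: "\<lbrakk>A \<in> Ob C; B \<in> Ob C\<rbrakk> \<Longrightarrow> \<exists>S. is_biproduct C A B S"
    and kernels: "f \<in> Arr C \<Longrightarrow> \<exists>k. is_kernel C k f"
    and cokernels: "f \<in> Arr C \<Longrightarrow> \<exists>c. is_cokernel C c f"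
    and mono_normal: "is_mono C f \<Longrightarrow> \<exists>g. is_kernel C f g"
    and epi_normal: "is_epi C f \<Longrightarrow> \<exists>g. is_cokernel C f g"

text \<open>The sequence $0 \to \mathrm{Dom}\,i \to \mathrm{Cod}\,i = \mathrm{Dom}\,p \to \mathrm{Cod}\,p
  \to 0$ with maps \<open>i\<close> and \<open>p\<close> is short exact.\<close>

definition short_exact :: "('o, 'm, 'e) add_cat_scheme \<Rightarrow> 'm \<Rightarrow> 'm \<Rightarrow> bool" where
  "short_exact C i p \<longleftrightarrow> is_kernel C i p \<and> is_cokernel C p i"

definition Proj :: "('o, 'm, 'e) cat_scheme \<Rightarrow> 'o set" where
  "Proj C = {P \<in> Ob C. \<forall>e. is_epi C e \<longrightarrow> (\<forall>f \<in> Hom C P (Cod C e).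
     \<exists>g \<in> Hom C P (Dom C e). e \<cdot>\<^bsub>C\<^esub> g = f)}"

definition Inj :: "('o, 'm, 'e) cat_scheme \<Rightarrow> 'o set" where
  "Inj C = {I \<in> Ob C. \<forall>m. is_mono C m \<longrightarrow> (\<forall>f \<in> Hom C (Dom C m) I.
     \<exists>g \<in> Hom C (Cod C m) I. g \<cdot>\<^bsub>C\<^esub> m = f)}"

locale frobenius_abelian_category = abelian_category C
  for C :: "('o, 'm, 'e) add_cat_scheme" (structure) +
  assumes enough_proj: "A \<in> Ob C \<Longrightarrow> \<exists>e. is_epi C e \<and> Cod C e = A \<and> Dom C e \<in> Proj C"
    and enough_inj: "A \<in> Ob C \<Longrightarrow> \<exists>m. is_mono C m \<and> Dom C m = A \<and> Cod C m \<in> Inj C"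
    and Proj_eq_Inj: "Proj C = Inj C"

section \<open>Subcategories\<close>

text \<open>All subcategories are full and closed under isomorphisms, so they are represented by
  their sets of objects.\<close>

definition subcategory :: "('o, 'm, 'e) cat_scheme \<Rightarrow> 'o set \<Rightarrow> bool" where
  "subcategory C X \<longleftrightarrow> X \<subseteq> Ob C \<and> (\<forall>A \<in> X. \<forall>B \<in> Ob C. isomorphic C A B \<longrightarrow> B \<in> X)"

definition additive_subcategory :: "('o, 'm, 'e) add_cat_scheme \<Rightarrow> 'o set \<Rightarrow> bool" where
  "additive_subcategory C X \<longleftrightarrow> subcategory C X \<and> (\<exists>Z \<in> X. is_zero_object C Z) \<and>
     (\<forall>A \<in> X. \<forall>B \<in> X. \<forall>S. is_biproduct C A B S \<longrightarrow> S \<in> X)"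

definition summand_closed :: "('o, 'm, 'e) add_cat_scheme \<Rightarrow> 'o set \<Rightarrow> bool" where
  "summand_closed C X \<longleftrightarrow> (\<forall>A B S. is_biproduct C A B S \<and> S \<in> X \<longrightarrow> A \<in> X)"

definition extension_closed :: "('o, 'm, 'e) add_cat_scheme \<Rightarrow> 'o set \<Rightarrow> bool" where
  "extension_closed C X \<longleftrightarrow>
     (\<forall>i p. short_exact C i p \<and> Dom C i \<in> X \<and> Cod C p \<in> X \<longrightarrow> Cod C i \<in> X)"

definition resolving :: "('o, 'm, 'e) add_cat_scheme \<Rightarrow> 'o set \<Rightarrow> bool" where
  "resolving C X \<longleftrightarrow> additive_subcategory C X \<and> Proj C \<subseteq> X \<and> extension_closed C X \<and>
     (\<forall>k f. is_epi C f \<and> is_kernel C k f \<and> Dom C f \<in> X \<and> Cod C f \<in> X \<longrightarrow> Dom C k \<in> X)"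

definition coresolving :: "('o, 'm, 'e) add_cat_scheme \<Rightarrow> 'o set \<Rightarrow> bool" where
  "coresolving C X \<longleftrightarrow> additive_subcategory C X \<and> Inj C \<subseteq> X \<and> extension_closed C X \<and>
     (\<forall>c f. is_mono C f \<and> is_cokernel C c f \<and> Dom C f \<in> X \<and> Cod C f \<in> X \<longrightarrow> Cod C c \<in> X)"

definition is_precover :: "('o, 'm, 'e) cat_scheme \<Rightarrow> 'o set \<Rightarrow> 'o \<Rightarrow> 'm \<Rightarrow> bool" where
  "is_precover C X A f \<longleftrightarrow> f \<in> Arr C \<and> Cod C f = A \<and> Dom C f \<in> X \<and>
     (\<forall>X' \<in> X. \<forall>g \<in> Hom C X' A. \<exists>h \<in> Hom C X' (Dom C f). f \<cdot>\<^bsub>C\<^esub> h = g)"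

definition precovering :: "('o, 'm, 'e) cat_scheme \<Rightarrow> 'o set \<Rightarrow> bool" where
  "precovering C X \<longleftrightarrow> (\<forall>A \<in> Ob C. \<exists>f. is_precover C X A f)"

definition is_preenvelope :: "('o, 'm, 'e) cat_scheme \<Rightarrow> 'o set \<Rightarrow> 'o \<Rightarrow> 'm \<Rightarrow> bool" where
  "is_preenvelope C X A f \<longleftrightarrow> f \<in> Arr C \<and> Dom C f = A \<and> Cod C f \<in> X \<and>
     (\<forall>X' \<in> X. \<forall>g \<in> Hom C A X'. \<exists>h \<in> Hom C (Cod C f) X'. h \<cdot>\<^bsub>C\<^esub> f = g)"

definition preenveloping :: "('o, 'm, 'e) cat_scheme \<Rightarrow> 'o set \<Rightarrow> bool" where
  "preenveloping C X \<longleftrightarrow> (\<forall>A \<in> Ob C. \<exists>f. is_preenvelope C X A f)"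

section \<open>Yoneda Ext and cotorsion pairs\<close>

definition extensions :: "('o, 'm, 'e) add_cat_scheme \<Rightarrow> 'o \<Rightarrow> 'o \<Rightarrow> ('m \<times> 'm) set" where
  "extensions C X Y = {(i, p). short_exact C i p \<and> Dom C i = Y \<and> Cod C p = X}"

definition ext_equiv ::
  "('o, 'm, 'e) add_cat_scheme \<Rightarrow> 'o \<Rightarrow> 'o \<Rightarrow> (('m \<times> 'm) \<times> ('m \<times> 'm)) set" where
  "ext_equiv C X Y = {((i, p), (i', p')).
     (i, p) \<in> extensions C X Y \<and> (i', p') \<in> extensions C X Y \<and>
     (\<exists>h \<in> Hom C (Cod C i) (Cod C i'). is_iso C h \<and> h \<cdot>\<^bsub>C\<^esub> i = i' \<and> p' \<cdot>\<^bsub>C\<^esub> h = p)}"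

definition Ext1 :: "('o, 'm, 'e) add_cat_scheme \<Rightarrow> 'o \<Rightarrow> 'o \<Rightarrow> ('m \<times> 'm) set set" where
  "Ext1 C X Y = extensions C X Y // ext_equiv C X Y"

text \<open>The zero of the group \<open>Ext1 C X Y\<close> (for the Baer sum) is the class of the split extensions.\<close>

definition Ext1_zero :: "('o, 'm, 'e) add_cat_scheme \<Rightarrow> 'o \<Rightarrow> 'o \<Rightarrow> ('m \<times> 'm) set" where
  "Ext1_zero C X Y =
     {(i, p) \<in> extensions C X Y. \<exists>s \<in> Hom C X (Dom C p). p \<cdot>\<^bsub>C\<^esub> s = Id C X}"

definition cotorsion_pair :: "('o, 'm, 'e) add_cat_scheme \<Rightarrow> 'o set \<Rightarrow> 'o set \<Rightarrow> bool" where
  "cotorsion_pair C X Y \<longleftrightarrow>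
     Y = {B \<in> Ob C. \<forall>A \<in> X. Ext1 C A B = {Ext1_zero C A B}} \<and>
     X = {A \<in> Ob C. \<forall>B \<in> Y. Ext1 C A B = {Ext1_zero C A B}}"

definition complete_cotorsion_pair ::
  "('o, 'm, 'e) add_cat_scheme \<Rightarrow> 'o set \<Rightarrow> 'o set \<Rightarrow> bool" where
  "complete_cotorsion_pair C X Y \<longleftrightarrow> cotorsion_pair C X Y \<and> (\<forall>A \<in> Ob C.
     (\<exists>i p. short_exact C i p \<and> Dom C i \<in> Y \<and> Dom C p \<in> X \<and> Cod C p = A) \<and>
     (\<exists>i p. short_exact C i p \<and> Dom C i = A \<and> Cod C i \<in> Y \<and> Cod C p \<in> X))"

section \<open>t-structures\<close>

text \<open>The data of a triangulated category used to define t-structures: the suspension on objects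
  (\<open>Susp\<close>) and on morphisms (\<open>SuspA\<close>), a quasi-inverse of it on objects (\<open>Desusp\<close>), and the
  distinguished triangles \<open>(u, v, w)\<close>, where \<open>w\<close> goes from \<open>Cod v\<close> to \<open>Susp (Dom u)\<close>.\<close>

record ('o, 'm) tri_cat = "('o, 'm) add_cat" +
  Susp :: "'o \<Rightarrow> 'o"
  SuspA :: "'m \<Rightarrow> 'm"
  Desusp :: "'o \<Rightarrow> 'o"
  Triangles :: "('m \<times> 'm \<times> 'm) set"

text \<open>Images of subcategories under a functor are closed under isomorphisms.\<close>

definition ess_image :: "('o, 'm, 'e) cat_scheme \<Rightarrow> ('o \<Rightarrow> 'o) \<Rightarrow> 'o set \<Rightarrow> 'o set" where
  "ess_image C F X = {B \<in> Ob C. \<exists>A \<in> X. isomorphic C (F A) B}"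

text \<open>The pair \<open>(U, W)\<close> is $(\mathcal{D}^{\leq 0}, \mathcal{D}^{\geq 0})$; hence
  \<open>ess_image T (Desusp T) U\<close> is $\mathcal{D}^{\leq 1}$ and \<open>ess_image T (Desusp T) W\<close> is
  $\mathcal{D}^{\geq 1}$.\<close>

definition t_structure :: "('o, 'm, 'e) tri_cat_scheme \<Rightarrow> 'o set \<Rightarrow> 'o set \<Rightarrow> bool" where
  "t_structure T U W \<longleftrightarrow> subcategory T U \<and> subcategory T W \<and>
     (\<forall>D \<in> U. \<forall>D' \<in> ess_image T (Desusp T) W. Hom T D D' = {Zero T D D'}) \<and>
     U \<subseteq> ess_image T (Desusp T) U \<and>
     ess_image T (Desusp T) W \<subseteq> W \<and>
     (\<forall>D \<in> Ob T. \<exists>u v w. (u, v, w) \<in> Triangles T \<and>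
        Dom T u \<in> U \<and> Cod T u = D \<and> Dom T v = D \<and> Cod T v \<in> ess_image T (Desusp T) W)"

section \<open>The stable category of a Frobenius category\<close>

definition proj_ideal :: "('o, 'm, 'e) cat_scheme \<Rightarrow> 'o \<Rightarrow> 'o \<Rightarrow> 'm set" where
  "proj_ideal C A B = {g \<cdot>\<^bsub>C\<^esub> f | f g P. P \<in> Proj C \<and> f \<in> Hom C A P \<and> g \<in> Hom C P B}"

definition stable_class :: "('o, 'm, 'e) add_cat_scheme \<Rightarrow> 'm \<Rightarrow> 'm set" where
  "stable_class C f = {f \<boxplus>\<^bsub>C\<^esub> h | h. h \<in> proj_ideal C (Dom C f) (Cod C f)}"

definition rep :: "'m set \<Rightarrow> 'm" where
  "rep F = (SOME f. f \<in> F)"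

definition stable_cat :: "('o, 'm, 'e) add_cat_scheme \<Rightarrow> ('o, 'm set) add_cat" where
  "stable_cat C = \<lparr>
     Ob = Ob C,
     Arr = stable_class C ` Arr C,
     Dom = (\<lambda>F. Dom C (rep F)),
     Cod = (\<lambda>F. Cod C (rep F)),
     Id = (\<lambda>A. stable_class C (Id C A)),
     Comp = (\<lambda>G F. stable_class C (rep G \<cdot>\<^bsub>C\<^esub> rep F)),
     Add = (\<lambda>F G. stable_class C (rep F \<boxplus>\<^bsub>C\<^esub> rep G)),
     Zero = (\<lambda>A B. stable_class C (Zero C A B))\<rparr>"

text \<open>Chosen sequences $0 \to A \to I \to \Omega^{-1}A \to 0$ with \<open>I\<close> injective and
  $0 \to \Omega A \to P \to A \to 0$ with \<open>P\<close> projective.\<close>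

definition cosyzygy_seq :: "('o, 'm, 'e) add_cat_scheme \<Rightarrow> 'o \<Rightarrow> 'm \<times> 'm" where
  "cosyzygy_seq C A = (SOME (i, p). short_exact C i p \<and> Dom C i = A \<and> Cod C i \<in> Inj C)"

definition syzygy_seq :: "('o, 'm, 'e) add_cat_scheme \<Rightarrow> 'o \<Rightarrow> 'm \<times> 'm" where
  "syzygy_seq C A = (SOME (i, p). short_exact C i p \<and> Cod C p = A \<and> Dom C p \<in> Proj C)"

abbreviation inj_emb :: "('o, 'm, 'e) add_cat_scheme \<Rightarrow> 'o \<Rightarrow> 'm" where
  "inj_emb C A \<equiv> fst (cosyzygy_seq C A)"

abbreviation cosyz_proj :: "('o, 'm, 'e) add_cat_scheme \<Rightarrow> 'o \<Rightarrow> 'm" where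
  "cosyz_proj C A \<equiv> snd (cosyzygy_seq C A)"

definition Omega_inv :: "('o, 'm, 'e) add_cat_scheme \<Rightarrow> 'o \<Rightarrow> 'o" where
  "Omega_inv C A = Cod C (cosyz_proj C A)"

definition Omega :: "('o, 'm, 'e) add_cat_scheme \<Rightarrow> 'o \<Rightarrow> 'o" where
  "Omega C A = Dom C (fst (syzygy_seq C A))"

text \<open>On the class of \<open>f : A \<rightarrow> B\<close>, the functor $\Omega^{-1}$ takes as value the class of any \<open>h\<close>
  that is induced on cokernels by an extension \<open>g\<close> of \<open>f\<close> to the chosen injectives.\<close>

definition Omega_inv_arr :: "('o, 'm, 'e) add_cat_scheme \<Rightarrow> 'm set \<Rightarrow> 'm set" where
  "Omega_inv_arr C F = stable_class C (SOME h. \<exists>f \<in> F. \<exists>g.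
     let A = Dom C f; B = Cod C f in
       g \<in> Hom C (Cod C (inj_emb C A)) (Cod C (inj_emb C B)) \<and>
       h \<in> Hom C (Omega_inv C A) (Omega_inv C B) \<and>
       g \<cdot>\<^bsub>C\<^esub> inj_emb C A = inj_emb C B \<cdot>\<^bsub>C\<^esub> f \<and>
       h \<cdot>\<^bsub>C\<^esub> cosyz_proj C A = cosyz_proj C B \<cdot>\<^bsub>C\<^esub> g)"

text \<open>For \<open>f : A \<rightarrow> B\<close>, the standard triangle $A \to B \to E \to \Omega^{-1}A$ (Happel) is given by
  the pushout of \<open>0 \<rightarrow> A \<rightarrow> I \<rightarrow> \<Omega>\<^sup>-\<^sup>1A \<rightarrow> 0\<close> along \<open>f\<close>, i.e. by a morphism \<open>(f, t, id)\<close> of this short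
  exact sequence into a short exact sequence $0 \to B \to E \to \Omega^{-1}A \to 0$.\<close>

definition standard_triangles ::
  "('o, 'm, 'e) add_cat_scheme \<Rightarrow> ('m set \<times> 'm set \<times> 'm set) set" where
  "standard_triangles C = {(stable_class C f, stable_class C g, stable_class C h) | f g h t.
     f \<in> Arr C \<and> short_exact C g h \<and> Dom C g = Cod C f \<and>
     Cod C h = Omega_inv C (Dom C f) \<and>
     t \<in> Hom C (Cod C (inj_emb C (Dom C f))) (Cod C g) \<and>
     t \<cdot>\<^bsub>C\<^esub> inj_emb C (Dom C f) = g \<cdot>\<^bsub>C\<^esub> f \<and>
     h \<cdot>\<^bsub>C\<^esub> t = cosyz_proj C (Dom C f)}"

definition stable_triangles ::
  "('o, 'm, 'e) add_cat_scheme \<Rightarrow> ('m set \<times> 'm set \<times> 'm set) set" where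
  "stable_triangles C = (let S = stable_cat C in {(u, v, w).
     u \<in> Arr S \<and> v \<in> Arr S \<and> Dom S v = Cod S u \<and>
     w \<in> Hom S (Cod S v) (Omega_inv C (Dom S u)) \<and>
     (\<exists>u' v' w' a b c. (u', v', w') \<in> standard_triangles C \<and>
        a \<in> Hom S (Dom S u) (Dom S u') \<and> is_iso S a \<and>
        b \<in> Hom S (Cod S u) (Cod S u') \<and> is_iso S b \<and>
        c \<in> Hom S (Cod S v) (Cod S v') \<and> is_iso S c \<and>
        b \<cdot>\<^bsub>S\<^esub> u = u' \<cdot>\<^bsub>S\<^esub> a \<and> c \<cdot>\<^bsub>S\<^esub> v = v' \<cdot>\<^bsub>S\<^esub> b \<and>
        Omega_inv_arr C a \<cdot>\<^bsub>S\<^esub> w = w' \<cdot>\<^bsub>S\<^esub> c)})"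

definition stable_tri_cat :: "('o, 'm, 'e) add_cat_scheme \<Rightarrow> ('o, 'm set) tri_cat" where
  "stable_tri_cat C = add_cat.extend (stable_cat C)
     (tri_cat.fields (Omega_inv C) (Omega_inv_arr C) (Omega C) (stable_triangles C))"

end

theory Submission
  imports Defs
begin

text \<open>Modulo projectives, orthogonality for \<open>Ext1\<close> becomes vanishing of stable morphisms:
  $\mathrm{Ext}^1(A, B) = \underline{\mathcal A}(A, \Omega^{-1} B)
  = \underline{\mathcal A}(\Omega A, B)$. Hence for a complete cotorsion pair \<open>(Z, W)\<close> both closure
  conditions in (d) say that every morphism from \<open>Z\<close> to \<open>W\<close> factors through a projective.

  If \<open>X\<close> is precovering and coresolving, then comparing a precover of an object with a precover of
  its kernel produces a stable idempotent on an object of \<open>X\<close>; splitting it yields a stable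
  coreflection into \<open>X\<close>. Wakamatsu's argument shows that the kernel of such a coreflection (made
  epic by adding a projective) is orthogonal to \<open>X\<close>, and Salce's pullback gives the second
  approximation sequence. Part (1) is part (2) for the opposite category.

  In a t-structure \<open>(U, V')\<close> the classes \<open>U\<close> and \<open>\<Omega> V'\<close> determine each other as stable orthogonals, and the
  truncation triangles make \<open>U\<close> precovering, so part (2) applies to \<open>U\<close>.\<close>

section \<open>Calculus of arrows\<close>

text \<open>Stable statements are argued on representatives in \<open>C\<close>, through
  \<open>null\<close> (the arrow factors through a projective) and \<open>stab\<close> (the
  difference is null), so that kernels, cokernels and pushouts of \<open>C\<close> stay available.
  Of a triangle only its objects matter, and it is traded for a short exact sequence up to stable
  isomorphism. Projective = injective enters mostly in one form: a null map extends along every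
  monomorphism and lifts along every epimorphism, again as a null map. This turns stable identities
  into strict ones. The obstacle is that a precover is only weakly universal: two lifts along it may
  differ stably, and then its kernel need not be orthogonal to \<open>X\<close>. Usually minimality
  of covers repairs this; here it is the splitting of stable idempotents that turns weak
  universality into uniqueness up to null maps. The second component of the bijection with
  t-structures carries two shifts. Stable maps from \<open>Z\<close> to \<Omega>^-1 \<open>W\<close>
  vanish, so \<Omega>^-1 \<open>W\<close> is the class in degrees \<ge> 1, while a t-structure is
  recorded by its class in degrees \<ge> 0, one suspension further.\<close>

lemma Hom_iff: "f \<in> Hom C A B \<longleftrightarrow> f \<in> Arr C \<and> Dom C f = A \<and> Cod C f = B"
  by (simp add: Hom_def)

context category
begin

lemma Hom_Ob: "f \<in> Hom C A B \<Longrightarrow> A \<in> Ob C \<and> B \<in> Ob C"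
  using Dom_in Cod_in by (auto simp: Hom_iff)

lemma Arr_Hom: "f \<in> Arr C \<Longrightarrow> f \<in> Hom C (Dom C f) (Cod C f)"
  by (simp add: Hom_iff)

lemma comp_simps [simp]:
  assumes "f \<in> Arr C" "g \<in> Arr C" "Dom C g = Cod C f"
  shows "g \<cdot> f \<in> Arr C" "Dom C (g \<cdot> f) = Dom C f" "Cod C (g \<cdot> f) = Cod C g"
  using Comp_hom[of f "Dom C f" "Cod C f" g "Cod C g"] assms by (auto simp: Hom_iff)

lemma comp_assoc [simp]:
  assumes "f \<in> Arr C" "g \<in> Arr C" "h \<in> Arr C" "Dom C g = Cod C f" "Dom C h = Cod C g"
  shows "(h \<cdot> g) \<cdot> f = h \<cdot> (g \<cdot> f)"
  using Comp_assoc[of f "Dom C f" "Cod C f" g "Cod C g" h "Cod C h"] assms by (auto simp: Hom_iff)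

lemma Id_simps [simp]:
  assumes "A \<in> Ob C" shows "Id C A \<in> Arr C" "Dom C (Id C A) = A" "Cod C (Id C A) = A"
  using Id_hom[OF assms] by (auto simp: Hom_iff)

lemma Id_comp [simp]: "f \<in> Arr C \<Longrightarrow> Cod C f = A \<Longrightarrow> Id C A \<cdot> f = f"
  using Id_left by (auto simp: Hom_iff)

lemma comp_Id [simp]: "f \<in> Arr C \<Longrightarrow> Dom C f = A \<Longrightarrow> f \<cdot> Id C A = f"
  using Id_right by (auto simp: Hom_iff)

declare Dom_in [simp] Cod_in [simp]

text \<open>Composites are normalised to the right by \<open>comp_assoc\<close>, so the left side of
  an equation \<open>g \<cdot> f = w\<close> is met as \<open>g \<cdot> (f \<cdot> x)\<close>;
  instances of this rule let the simplifier use the equation there.\<close>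

lemma comp_reassoc:
  assumes "g \<cdot> f = w" "f \<in> Arr C" "g \<in> Arr C" "Dom C g = Cod C f" "x \<in> Arr C" "Cod C x = Dom C f"
  shows "g \<cdot> (f \<cdot> x) = w \<cdot> x"
  using comp_assoc[of x f g] assms by simp

end

definition neg :: "('o, 'm, 'e) add_cat_scheme \<Rightarrow> 'm \<Rightarrow> 'm" where
  "neg C f = inv\<^bsub>hom_group C (Dom C f) (Cod C f)\<^esub> f"

context preadditive_category
begin

abbreviation minus_arr :: "'m \<Rightarrow> 'm \<Rightarrow> 'm" (infixl "\<boxminus>" 65) where
  "f \<boxminus> g \<equiv> f \<boxplus> neg C g"

lemma hom_group_simps:
  "carrier (hom_group C A B) = Hom C A B" "mult (hom_group C A B) = Add C"
  "one (hom_group C A B) = Zero C A B"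
  by (simp_all add: hom_group_def)

lemma zero_simps [simp]:
  assumes "A \<in> Ob C" "B \<in> Ob C"
  shows "Zero C A B \<in> Arr C" "Dom C (Zero C A B) = A" "Cod C (Zero C A B) = B"
proof -
  interpret comm_group "hom_group C A B" by (rule hom_comm_group) fact+
  show "Zero C A B \<in> Arr C" "Dom C (Zero C A B) = A" "Cod C (Zero C A B) = B"
    using one_closed unfolding hom_group_simps by (auto simp: Hom_iff)
qed

lemma add_simps [simp]:
  assumes "f \<in> Arr C" "g \<in> Arr C" "Dom C g = Dom C f" "Cod C g = Cod C f"
  shows "f \<boxplus> g \<in> Arr C" "Dom C (f \<boxplus> g) = Dom C f" "Cod C (f \<boxplus> g) = Cod C f"
proof -
  interpret comm_group "hom_group C (Dom C f) (Cod C f)" by (rule hom_comm_group) (use assms in auto)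
  show "f \<boxplus> g \<in> Arr C" "Dom C (f \<boxplus> g) = Dom C f" "Cod C (f \<boxplus> g) = Cod C f"
    using m_closed[of f g] assms unfolding hom_group_simps by (auto simp: Hom_iff)
qed

lemma add_comm:
  assumes "f \<in> Arr C" "g \<in> Arr C" "Dom C g = Dom C f" "Cod C g = Cod C f"
  shows "f \<boxplus> g = g \<boxplus> f"
proof -
  interpret comm_group "hom_group C (Dom C f) (Cod C f)" by (rule hom_comm_group) (use assms in auto)
  show ?thesis using m_comm[of f g] assms unfolding hom_group_simps by (auto simp: Hom_iff)
qed

lemma neg_simps [simp]:
  assumes "f \<in> Arr C"
  shows "neg C f \<in> Arr C" "Dom C (neg C f) = Dom C f" "Cod C (neg C f) = Cod C f"
    "f \<boxplus> neg C f = Zero C (Dom C f) (Cod C f)" "neg C f \<boxplus> f = Zero C (Dom C f) (Cod C f)"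
    "neg C (neg C f) = f"
proof -
  interpret comm_group "hom_group C (Dom C f) (Cod C f)" by (rule hom_comm_group) (use assms in auto)
  have f: "f \<in> Hom C (Dom C f) (Cod C f)" using assms by (simp add: Hom_iff)
  show "neg C f \<in> Arr C" and D: "Dom C (neg C f) = Dom C f" and K: "Cod C (neg C f) = Cod C f"
    using inv_closed[of f] f unfolding hom_group_simps neg_def by (auto simp: Hom_iff)
  show "f \<boxplus> neg C f = Zero C (Dom C f) (Cod C f)" "neg C f \<boxplus> f = Zero C (Dom C f) (Cod C f)"
    using r_inv[of f] l_inv[of f] f unfolding hom_group_simps neg_def by auto
  have "neg C (neg C f) = inv\<^bsub>hom_group C (Dom C f) (Cod C f)\<^esub> (neg C f)"
    using neg_def D K by metis
  then show "neg C (neg C f) = f"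
    using inv_inv[of f] f unfolding hom_group_simps neg_def by auto
qed

lemma add_assoc [simp]:
  assumes "f \<in> Arr C" "g \<in> Arr C" "h \<in> Arr C" "Dom C g = Dom C f" "Cod C g = Cod C f"
    "Dom C h = Dom C f" "Cod C h = Cod C f"
  shows "(f \<boxplus> g) \<boxplus> h = f \<boxplus> (g \<boxplus> h)"
proof -
  interpret comm_group "hom_group C (Dom C f) (Cod C f)" by (rule hom_comm_group) (use assms in auto)
  show ?thesis using m_assoc[of f g h] assms unfolding hom_group_simps by (auto simp: Hom_iff)
qed

lemma add_zero [simp]:
  assumes "f \<in> Arr C" "Dom C f = A" "Cod C f = B"
  shows "f \<boxplus> Zero C A B = f" "Zero C A B \<boxplus> f = f"
proof -
  interpret comm_group "hom_group C (Dom C f) (Cod C f)" by (rule hom_comm_group) (use assms in auto)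
  show "f \<boxplus> Zero C A B = f" "Zero C A B \<boxplus> f = f"
    using r_one[of f] l_one[of f] assms unfolding hom_group_simps by (auto simp: Hom_iff)
qed

lemma add_left_comm:
  assumes "f \<in> Arr C" "g \<in> Arr C" "h \<in> Arr C" "Dom C g = Dom C f" "Cod C g = Cod C f"
    "Dom C h = Dom C f" "Cod C h = Cod C f"
  shows "f \<boxplus> (g \<boxplus> h) = g \<boxplus> (f \<boxplus> h)"
  by (metis add_assoc add_comm assms)

lemma add_neg_cancel [simp]:
  assumes "f \<in> Arr C" "h \<in> Arr C" "Dom C h = Dom C f" "Cod C h = Cod C f"
  shows "f \<boxplus> (neg C f \<boxplus> h) = h" "neg C f \<boxplus> (f \<boxplus> h) = h"
  using add_assoc[of f "neg C f" h] add_assoc[of "neg C f" f h] assms by simp_all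

lemma neg_unique:
  assumes "f \<in> Arr C" "g \<in> Arr C" "Dom C g = Dom C f" "Cod C g = Cod C f"
    "f \<boxplus> g = Zero C (Dom C f) (Cod C f)"
  shows "g = neg C f"
proof -
  have "g = neg C f \<boxplus> (f \<boxplus> g)" using assms(1-4) by simp
  then show ?thesis using assms(1-4) unfolding assms(5) by simp
qed

lemma neg_add [simp]:
  assumes "f \<in> Arr C" "g \<in> Arr C" "Dom C g = Dom C f" "Cod C g = Cod C f"
  shows "neg C (f \<boxplus> g) = neg C f \<boxplus> neg C g"
proof (rule neg_unique[symmetric])
  have "f \<boxplus> (g \<boxplus> (neg C f \<boxplus> neg C g)) = f \<boxplus> (neg C f \<boxplus> (g \<boxplus> neg C g))"
    using add_left_comm[of g "neg C f" "neg C g"] assms by simp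
  then show "f \<boxplus> g \<boxplus> (neg C f \<boxplus> neg C g) = Zero C (Dom C (f \<boxplus> g)) (Cod C (f \<boxplus> g))"
    using assms by simp
qed (use assms in auto)

lemma neg_zero [simp]: "A \<in> Ob C \<Longrightarrow> B \<in> Ob C \<Longrightarrow> neg C (Zero C A B) = Zero C A B"
  by (rule neg_unique[symmetric]) auto

lemma comp_add [simp]:
  assumes "f \<in> Arr C" "g \<in> Arr C" "Dom C g = Dom C f" "Cod C g = Cod C f"
  shows "h \<in> Arr C \<Longrightarrow> Dom C h = Cod C f \<Longrightarrow> h \<cdot> (f \<boxplus> g) = h \<cdot> f \<boxplus> h \<cdot> g"
    and "h \<in> Arr C \<Longrightarrow> Cod C h = Dom C f \<Longrightarrow> (f \<boxplus> g) \<cdot> h = f \<cdot> h \<boxplus> g \<cdot> h"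
  using assms Comp_Add_right[of f "Dom C f" "Cod C f" g h "Cod C h"]
    Comp_Add_left[of h "Dom C h" "Dom C f" f "Cod C f" g] by (auto simp: Hom_iff)

lemma idem_zero:
  assumes "f \<in> Arr C" "f \<boxplus> f = f" shows "f = Zero C (Dom C f) (Cod C f)"
  using add_neg_cancel(2)[of f f] neg_simps(5)[of f] assms by simp

lemma comp_zero [simp]:
  shows "h \<in> Arr C \<Longrightarrow> Dom C h = B \<Longrightarrow> A \<in> Ob C \<Longrightarrow> h \<cdot> Zero C A B = Zero C A (Cod C h)"
    and "h \<in> Arr C \<Longrightarrow> Cod C h = A \<Longrightarrow> B \<in> Ob C \<Longrightarrow> Zero C A B \<cdot> h = Zero C (Dom C h) B"
proof -
  assume h: "h \<in> Arr C" "Dom C h = B" "A \<in> Ob C"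
  then have "h \<cdot> Zero C A B \<boxplus> h \<cdot> Zero C A B = h \<cdot> (Zero C A B \<boxplus> Zero C A B)"
    by (intro comp_add(1)[symmetric]) auto
  then show "h \<cdot> Zero C A B = Zero C A (Cod C h)"
    using idem_zero[of "h \<cdot> Zero C A B"] h by auto
next
  assume h: "h \<in> Arr C" "Cod C h = A" "B \<in> Ob C"
  then have "Zero C A B \<cdot> h \<boxplus> Zero C A B \<cdot> h = (Zero C A B \<boxplus> Zero C A B) \<cdot> h"
    by (intro comp_add(2)[symmetric]) auto
  then show "Zero C A B \<cdot> h = Zero C (Dom C h) B"
    using idem_zero[of "Zero C A B \<cdot> h"] h by auto
qed

lemma comp_neg [simp]:
  assumes "f \<in> Arr C" "g \<in> Arr C" "Dom C g = Cod C f"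
  shows "g \<cdot> neg C f = neg C (g \<cdot> f)" "neg C g \<cdot> f = neg C (g \<cdot> f)"
proof -
  have "g \<cdot> f \<boxplus> g \<cdot> neg C f = g \<cdot> (f \<boxplus> neg C f)"
    by (rule comp_add(1)[symmetric]) (use assms in auto)
  then show "g \<cdot> neg C f = neg C (g \<cdot> f)"
    by (intro neg_unique) (use assms in auto)
  have "g \<cdot> f \<boxplus> neg C g \<cdot> f = (g \<boxplus> neg C g) \<cdot> f"
    by (rule comp_add(2)[symmetric]) (use assms in auto)
  then show "neg C g \<cdot> f = neg C (g \<cdot> f)"
    by (intro neg_unique) (use assms in auto)
qed

lemma minus_eq_zero_iff:
  assumes "f \<in> Arr C" "g \<in> Arr C" "Dom C g = Dom C f" "Cod C g = Cod C f"
  shows "f \<boxminus> g = Zero C (Dom C f) (Cod C f) \<longleftrightarrow> f = g"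
  using neg_unique[of "neg C g" f] add_comm[of f "neg C g"] assms by (auto dest: sym)

lemma add_minus_cancel:
  assumes "f \<in> Arr C" "g \<in> Arr C" "Dom C g = Dom C f" "Cod C g = Cod C f"
  shows "g \<boxplus> (f \<boxminus> g) = f" "(f \<boxminus> g) \<boxplus> g = f" "(f \<boxplus> g) \<boxminus> g = f"
  using assms add_left_comm[of g f "neg C g"] by simp_all

end

section \<open>Duality\<close>

text \<open>Dual statements are obtained by instantiating the locales at \<open>op C\<close>. The
  simp rules below rewrite each notion over \<open>op C\<close> into its dual over \<open>C\<close>,
  so that such an instance reads directly as a statement about \<open>C\<close>.\<close>

definition op :: "('o, 'm, 'e) add_cat_scheme \<Rightarrow> ('o, 'm) add_cat" where
  "op C = \<lparr>Ob = Ob C, Arr = Arr C, Dom = Cod C, Cod = Dom C, Id = Id C,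
     Comp = (\<lambda>g f. f \<cdot>\<^bsub>C\<^esub> g), Add = Add C, Zero = (\<lambda>A B. Zero C B A)\<rparr>"

lemma op_simps [simp]:
  "Ob (op C) = Ob C" "Arr (op C) = Arr C" "Dom (op C) = Cod C" "Cod (op C) = Dom C"
  "Id (op C) = Id C" "g \<cdot>\<^bsub>op C\<^esub> f = f \<cdot>\<^bsub>C\<^esub> g" "Add (op C) = Add C" "Zero (op C) A B = Zero C B A"
  by (simp_all add: op_def)

lemma Hom_op [simp]: "Hom (op C) A B = Hom C B A"
  by (auto simp: Hom_def)

lemma op_mono_epi [simp]: "is_mono (op C) f = is_epi C f" "is_epi (op C) f = is_mono C f"
  by (simp_all add: is_mono_def is_epi_def)

lemma op_kernel [simp]: "is_kernel (op C) k f = is_cokernel C k f" "is_cokernel (op C) k f = is_kernel C k f"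
  by (simp_all add: is_kernel_def is_cokernel_def)

lemma op_short_exact [simp]: "short_exact (op C) p i = short_exact C i p"
  by (auto simp: short_exact_def)

lemma op_Proj_Inj [simp]: "Proj (op C) = Inj C" "Inj (op C) = Proj C"
  by (simp_all add: Proj_def Inj_def)

lemma op_zero_object [simp]: "is_zero_object (op C) Z = is_zero_object C Z"
  unfolding is_zero_object_def by auto

lemma op_biproduct [simp]: "is_biproduct (op C) A B S = is_biproduct C A B S"
  unfolding is_biproduct_def Hom_op op_simps by blast

lemma op_covers [simp]:
  "precovering (op C) X = preenveloping C X" "preenveloping (op C) X = precovering C X"
  by (simp_all add: precovering_def preenveloping_def is_precover_def is_preenvelope_def)

lemma op_is_iso: "is_iso (op C) f \<longleftrightarrow> is_iso C f"
  by (auto simp: is_iso_def)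

lemma isomorphic_sym: "isomorphic C A B \<Longrightarrow> isomorphic C B A"
  unfolding isomorphic_def is_iso_def Hom_def by force

lemma op_isomorphic [simp]: "isomorphic (op C) A B \<longleftrightarrow> isomorphic C A B"
proof -
  have "isomorphic (op C) A B \<longleftrightarrow> isomorphic C B A"
    by (simp add: isomorphic_def op_is_iso)
  then show ?thesis using isomorphic_sym by metis
qed

lemma op_subcategory [simp]: "subcategory (op C) X = subcategory C X"
  by (simp add: subcategory_def)

lemma op_additive [simp]: "additive_subcategory (op C) X = additive_subcategory C X"
  by (simp add: additive_subcategory_def)

lemma op_summand_closed [simp]: "summand_closed (op C) X = summand_closed C X"
  by (simp add: summand_closed_def)

text \<open>Over \<open>op C\<close> the middle term of a sequence is read off as
  \<open>Dom C p\<close> instead of \<open>Cod C i\<close>; exactness identifies the two.\<close>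

lemma op_extension_closed [simp]:
  assumes "category C"
  shows "extension_closed (op C) X = extension_closed C X"
proof -
  have "Dom C p = Cod C i" if "short_exact C i p" for i p
    using that by (simp add: short_exact_def is_kernel_def)
  then show ?thesis
    unfolding extension_closed_def op_short_exact op_simps by metis
qed

lemma op_resolving:
  assumes "category C"
  shows "resolving (op C) X = coresolving C X" "coresolving (op C) X = resolving C X"
  using assms by (auto simp: resolving_def coresolving_def)

lemma (in preadditive_category) preadditive_op: "preadditive_category (op C)"
proof (intro preadditive_category.intro preadditive_category_axioms.intro)
  show "category (op C)"
    by unfold_locales (auto simp: Hom_iff)
  fix A B assume "A \<in> Ob (op C)" "B \<in> Ob (op C)"
  moreover have "hom_group (op C) A B = hom_group C B A"
    by (simp add: hom_group_def)
  ultimately show "comm_group (hom_group (op C) A B)"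
    using hom_comm_group by simp
qed (auto simp: Hom_iff)

lemma (in abelian_category) abelian_op: "abelian_category (op C)"
proof -
  interpret op: preadditive_category "op C" by (rule preadditive_op)
  show ?thesis
    using zero_object biproducts kernels cokernels mono_normal epi_normal
    by unfold_locales simp_all
qed

lemma (in frobenius_abelian_category) frobenius_op: "frobenius_abelian_category (op C)"
proof -
  interpret op: abelian_category "op C" by (rule abelian_op)
  show ?thesis
    using enough_proj enough_inj Proj_eq_Inj
    by unfold_locales simp_all
qed

lemma (in preadditive_category) neg_op:
  assumes f: "f \<in> Arr C"
  shows "neg (op C) f = neg C f"
proof -
  have "hom_group (op C) (Cod C f) (Dom C f) = hom_group C (Dom C f) (Cod C f)"
    by (simp add: hom_group_def)
  then show ?thesis using f by (simp add: neg_def)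
qed

section \<open>Short exact sequences\<close>

context abelian_category
begin

lemma short_exactD [dest]:
  assumes "short_exact C i p"
  shows "i \<in> Arr C" "p \<in> Arr C" "Dom C p = Cod C i" "p \<cdot> i = Zero C (Dom C i) (Cod C p)"
  using assms by (auto simp: short_exact_def is_kernel_def)

lemma short_exact_op: "short_exact C i p \<Longrightarrow> short_exact (op C) p i"
  by simp

lemma kernel_mono: assumes "is_kernel C i p" shows "is_mono C i"
  unfolding is_mono_def
proof (intro conjI allI ballI impI)
  show i: "i \<in> Arr C" using assms by (simp add: is_kernel_def)
  fix A g h assume gh: "g \<in> Hom C A (Dom C i)" "h \<in> Hom C A (Dom C i)" "i \<cdot> g = i \<cdot> h"
  have p: "p \<in> Arr C" "Cod C i = Dom C p" "p \<cdot> i = Zero C (Dom C i) (Cod C p)"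
    using assms by (auto simp: is_kernel_def)
  have "p \<cdot> (i \<cdot> g) = Zero C A (Cod C p)"
    using comp_reassoc[OF p(3), of g] i p gh by (simp add: Hom_iff)
  moreover have "i \<cdot> g \<in> Arr C" "Dom C (i \<cdot> g) = A" "Cod C (i \<cdot> g) = Dom C p"
    using i p gh(1) by (simp_all add: Hom_iff)
  ultimately have "\<exists>!u. u \<in> Hom C A (Dom C i) \<and> i \<cdot> u = i \<cdot> g"
    using assms unfolding is_kernel_def by metis
  then show "g = h" using gh by metis
qed

lemma mono_cancel:
  "is_mono C i \<Longrightarrow> i \<cdot> x = i \<cdot> y \<Longrightarrow> x \<in> Arr C \<Longrightarrow> y \<in> Arr C \<Longrightarrow> Cod C x = Dom C i
    \<Longrightarrow> Cod C y = Dom C i \<Longrightarrow> Dom C y = Dom C x \<Longrightarrow> x = y"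
  by (auto simp: is_mono_def Hom_iff)

lemma epi_cancel:
  "is_epi C p \<Longrightarrow> x \<cdot> p = y \<cdot> p \<Longrightarrow> x \<in> Arr C \<Longrightarrow> y \<in> Arr C \<Longrightarrow> Dom C x = Cod C p
    \<Longrightarrow> Dom C y = Cod C p \<Longrightarrow> Cod C y = Cod C x \<Longrightarrow> x = y"
  by (auto simp: is_epi_def Hom_iff)

lemma monoI:
  assumes i: "i \<in> Arr C"
    and *: "\<And>x. x \<in> Arr C \<Longrightarrow> Cod C x = Dom C i \<Longrightarrow> i \<cdot> x = Zero C (Dom C x) (Cod C i)
      \<Longrightarrow> x = Zero C (Dom C x) (Dom C i)"
  shows "is_mono C i"
  unfolding is_mono_def
proof (intro conjI allI ballI impI)
  fix A g h assume gh: "g \<in> Hom C A (Dom C i)" "h \<in> Hom C A (Dom C i)" "i \<cdot> g = i \<cdot> h"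
  have "i \<cdot> (g \<boxminus> h) = i \<cdot> g \<boxminus> i \<cdot> h" using gh(1,2) i by (simp add: Hom_iff)
  also have "\<dots> = Zero C A (Cod C i)" unfolding gh(3) using gh(1,2) i by (simp add: Hom_iff)
  finally have "g \<boxminus> h = Zero C A (Dom C i)" using *[of "g \<boxminus> h"] gh(1,2) i by (simp add: Hom_iff)
  then show "g = h" using minus_eq_zero_iff[of g h] gh(1,2) by (simp add: Hom_iff)
qed (rule i)

lemma epiI:
  assumes "p \<in> Arr C"
    and "\<And>x. x \<in> Arr C \<Longrightarrow> Dom C x = Cod C p \<Longrightarrow> x \<cdot> p = Zero C (Dom C p) (Cod C x)
      \<Longrightarrow> x = Zero C (Cod C p) (Cod C x)"
  shows "is_epi C p"
  using abelian_category.monoI[OF abelian_op, of p] assms by simp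

lemma cokernel_epi: "is_cokernel C p i \<Longrightarrow> is_epi C p"
  using abelian_category.kernel_mono[OF abelian_op, of p i] by simp

lemma short_exact_mono_epi:
  assumes "short_exact C i p" shows "is_mono C i" "is_epi C p"
  using assms kernel_mono cokernel_epi by (auto simp: short_exact_def)

lemma kernelI:
  assumes i: "is_mono C i" and p: "p \<in> Arr C" "Dom C p = Cod C i" "p \<cdot> i = Zero C (Dom C i) (Cod C p)"
    and *: "\<And>x. x \<in> Arr C \<Longrightarrow> Cod C x = Cod C i \<Longrightarrow> p \<cdot> x = Zero C (Dom C x) (Cod C p)
      \<Longrightarrow> \<exists>y \<in> Hom C (Dom C x) (Dom C i). i \<cdot> y = x"
  shows "is_kernel C i p"
proof -
  have i': "i \<in> Arr C" using i by (simp add: is_mono_def)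
  show ?thesis unfolding is_kernel_def
  proof (intro conjI ballI impI)
    fix h assume h: "h \<in> Arr C" "Cod C h = Dom C p \<and> p \<cdot> h = Zero C (Dom C h) (Cod C p)"
    then obtain y where "y \<in> Hom C (Dom C h) (Dom C i)" "i \<cdot> y = h" using *[of h] p by auto
    then show "\<exists>!u. u \<in> Hom C (Dom C h) (Dom C i) \<and> i \<cdot> u = h"
      using mono_cancel[OF i] by (intro ex1I[of _ y]) (auto simp: Hom_iff)
  qed (use i' p in auto)
qed

lemma cokernelI:
  assumes "is_epi C p" "i \<in> Arr C" "Dom C p = Cod C i" "p \<cdot> i = Zero C (Dom C i) (Cod C p)"
    and "\<And>x. x \<in> Arr C \<Longrightarrow> Dom C x = Cod C i \<Longrightarrow> x \<cdot> i = Zero C (Dom C i) (Cod C x)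
      \<Longrightarrow> \<exists>y \<in> Hom C (Cod C p) (Cod C x). y \<cdot> p = x"
  shows "is_cokernel C p i"
  using abelian_category.kernelI[OF abelian_op, of p i] assms by simp

lemma kernel_lift:
  "is_kernel C i p \<Longrightarrow> x \<in> Arr C \<Longrightarrow> Cod C x = Dom C p \<Longrightarrow> p \<cdot> x = Zero C (Dom C x) (Cod C p)
    \<Longrightarrow> \<exists>y \<in> Hom C (Dom C x) (Dom C i). i \<cdot> y = x"
  unfolding is_kernel_def by blast

lemma cokernel_lift:
  "is_cokernel C p i \<Longrightarrow> x \<in> Arr C \<Longrightarrow> Dom C x = Cod C i \<Longrightarrow> x \<cdot> i = Zero C (Dom C i) (Cod C x)
    \<Longrightarrow> \<exists>y \<in> Hom C (Cod C p) (Cod C x). y \<cdot> p = x"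
  unfolding is_cokernel_def by blast

lemma ses_lift:
  assumes "short_exact C i p" "x \<in> Arr C" "Cod C x = Cod C i" "p \<cdot> x = Zero C (Dom C x) (Cod C p)"
  shows "\<exists>y \<in> Hom C (Dom C x) (Dom C i). i \<cdot> y = x"
  using kernel_lift[of i p x] assms short_exactD[OF assms(1)] by (auto simp: short_exact_def)

lemma ses_colift:
  assumes "short_exact C i p" "x \<in> Arr C" "Dom C x = Cod C i" "x \<cdot> i = Zero C (Dom C i) (Cod C x)"
  shows "\<exists>y \<in> Hom C (Cod C p) (Cod C x). y \<cdot> p = x"
  using cokernel_lift[of p i x] assms by (auto simp: short_exact_def)

lemma ses_lift_diff:
  assumes "short_exact C i p" "x \<in> Arr C" "y \<in> Arr C" "Dom C y = Dom C x" "Cod C x = Cod C i"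
    "Cod C y = Cod C i" "p \<cdot> x = p \<cdot> y"
  shows "\<exists>z \<in> Hom C (Dom C x) (Dom C i). i \<cdot> z = x \<boxminus> y"
  using assms(2-) short_exactD[OF assms(1)] ses_lift[OF assms(1), of "x \<boxminus> y"]
    minus_eq_zero_iff[of "p \<cdot> x" "p \<cdot> y"] by simp

lemma ses_colift_diff:
  assumes "short_exact C i p" "x \<in> Arr C" "y \<in> Arr C" "Cod C y = Cod C x" "Dom C x = Cod C i"
    "Dom C y = Cod C i" "x \<cdot> i = y \<cdot> i"
  shows "\<exists>z \<in> Hom C (Cod C p) (Cod C x). z \<cdot> p = x \<boxminus> y"
  using assms(2-) short_exactD[OF assms(1)] ses_colift[OF assms(1), of "x \<boxminus> y"]
    minus_eq_zero_iff[of "x \<cdot> i" "y \<cdot> i"] by simp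

text \<open>A monomorphism is the kernel of some \<open>g\<close>, and \<open>g\<close> factors
  through the cokernel \<open>p\<close> of \<open>i\<close>. Hence \<open>p \<cdot> x = 0\<close>
  forces \<open>g \<cdot> x = 0\<close>, and \<open>i\<close> is also the kernel of its own
  cokernel.\<close>

lemma mono_cokernel_ses:
  assumes i: "is_mono C i" and c: "is_cokernel C p i"
  shows "short_exact C i p"
proof -
  have p [simp]: "p \<in> Arr C" "Dom C p = Cod C i" and pi: "p \<cdot> i = Zero C (Dom C i) (Cod C p)"
    using c by (auto simp: is_cokernel_def)
  obtain g where g: "is_kernel C i g" using mono_normal[OF i] by blast
  then have [simp]: "g \<in> Arr C" "Dom C g = Cod C i" and gi: "g \<cdot> i = Zero C (Dom C i) (Cod C g)"
    by (auto simp: is_kernel_def)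
  obtain g' where [simp]: "g' \<in> Arr C" "Dom C g' = Cod C p" "Cod C g' = Cod C g" and g': "g' \<cdot> p = g"
    using cokernel_lift[OF c _ _ gi] by (metis Hom_iff \<open>g \<in> Arr C\<close> \<open>Dom C g = Cod C i\<close>)
  have "is_kernel C i p"
  proof (rule kernelI[OF i])
    fix x assume x [simp]: "x \<in> Arr C" "Cod C x = Cod C i" and px: "p \<cdot> x = Zero C (Dom C x) (Cod C p)"
    have "g \<cdot> x = g' \<cdot> (p \<cdot> x)" using comp_assoc[of x p g'] by (simp add: g')
    then have "g \<cdot> x = Zero C (Dom C x) (Cod C g)" by (simp add: px)
    then show "\<exists>y\<in>Hom C (Dom C x) (Dom C i). i \<cdot> y = x" using kernel_lift[OF g] by simp
  qed (use pi in auto)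
  then show ?thesis using c by (simp add: short_exact_def)
qed

lemma epi_kernel_ses: "is_epi C p \<Longrightarrow> is_kernel C i p \<Longrightarrow> short_exact C i p"
  using abelian_category.mono_cokernel_ses[OF abelian_op, of p i] by simp

lemma mono_ses: "is_mono C i \<Longrightarrow> \<exists>p. short_exact C i p"
  using cokernels[of i] mono_cokernel_ses by (auto simp: is_mono_def)

lemma epi_ses: "is_epi C p \<Longrightarrow> \<exists>i. short_exact C i p"
  using kernels[of p] epi_kernel_ses by (auto simp: is_epi_def)

section \<open>Pushouts, pullbacks and split sequences\<close>

lemma biproductE:
  assumes "A \<in> Ob C" "B \<in> Ob C"
  obtains S i j p q where "is_biproduct C A B S"
    "i \<in> Hom C A S" "j \<in> Hom C B S" "p \<in> Hom C S A" "q \<in> Hom C S B"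
    "p \<cdot> i = Id C A" "q \<cdot> j = Id C B" "p \<cdot> j = Zero C B A" "q \<cdot> i = Zero C A B"
    "i \<cdot> p \<boxplus> j \<cdot> q = Id C S"
proof -
  obtain S where S: "is_biproduct C A B S" using biproducts assms by blast
  show ?thesis using that[OF S] S unfolding is_biproduct_def by blast
qed

text \<open>The pushout is the cokernel \<open>c\<close> of the pair \<open>(i, -f)\<close> into the
  biproduct of \<open>Cod C i\<close> and \<open>B\<close>; this pair is monic because its first
  component is. Existence and uniqueness of maps out of the pushout are exported, since later
  morphisms are defined by prescribing them on \<open>j\<close> and \<open>t\<close>.\<close>

lemma pushout:
  assumes ses: "short_exact C i p" and f: "f \<in> Hom C (Dom C i) B"
  obtains j q t where "short_exact C j q" "Dom C j = B" "Cod C q = Cod C p"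
    "t \<in> Hom C (Cod C i) (Cod C j)" "t \<cdot> i = j \<cdot> f" "q \<cdot> t = p"
    "\<And>T b m. b \<in> Hom C B T \<Longrightarrow> m \<in> Hom C (Cod C i) T \<Longrightarrow> m \<cdot> i = b \<cdot> f
      \<Longrightarrow> \<exists>e \<in> Hom C (Cod C j) T. e \<cdot> j = b \<and> e \<cdot> t = m"
    "\<And>x y. x \<in> Arr C \<Longrightarrow> y \<in> Arr C \<Longrightarrow> Dom C x = Cod C j \<Longrightarrow> Dom C y = Cod C j \<Longrightarrow> Cod C y = Cod C x
      \<Longrightarrow> x \<cdot> j = y \<cdot> j \<Longrightarrow> x \<cdot> t = y \<cdot> t \<Longrightarrow> x = y"
proof -
  note [simp] = short_exactD[OF ses] f[unfolded Hom_iff]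
  have [simp]: "B \<in> Ob C" using Hom_Ob[OF f] by simp
  obtain S i1 i2 p1 p2 where S: "is_biproduct C (Cod C i) B S"
    and h: "i1 \<in> Hom C (Cod C i) S" "i2 \<in> Hom C B S" "p1 \<in> Hom C S (Cod C i)" "p2 \<in> Hom C S B"
    and e: "p1 \<cdot> i1 = Id C (Cod C i)" "p2 \<cdot> i2 = Id C B" "p1 \<cdot> i2 = Zero C B (Cod C i)"
      "p2 \<cdot> i1 = Zero C (Cod C i) B" and sum: "i1 \<cdot> p1 \<boxplus> i2 \<cdot> p2 = Id C S"
    by (rule biproductE[of "Cod C i" B]) auto
  note [simp] = h[unfolded Hom_iff] e
  note [simp] = comp_reassoc[OF e(1)] comp_reassoc[OF e(2)] comp_reassoc[OF e(3)] comp_reassoc[OF e(4)]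
  have [simp]: "S \<in> Ob C" using Dom_in[of p1] by simp
  define \<phi> where "\<phi> = i1 \<cdot> i \<boxminus> i2 \<cdot> f"
  have [simp]: "\<phi> \<in> Arr C" "Dom C \<phi> = Dom C i" "Cod C \<phi> = S" by (auto simp: \<phi>_def)
  have p1\<phi>: "p1 \<cdot> \<phi> = i" and p2\<phi>: "p2 \<cdot> \<phi> = neg C f" by (simp_all add: \<phi>_def)
  note [simp] = p1\<phi> p2\<phi> comp_reassoc[OF p1\<phi>] comp_reassoc[OF p2\<phi>]
  have mono_i: "is_mono C i" using short_exact_mono_epi[OF ses] by simp
  have "is_mono C \<phi>"
  proof (rule monoI)
    fix x assume [simp]: "x \<in> Arr C" "Cod C x = Dom C \<phi>" and "\<phi> \<cdot> x = Zero C (Dom C x) (Cod C \<phi>)"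
    then have "i \<cdot> x = i \<cdot> Zero C (Dom C x) (Dom C i)"
      using comp_reassoc[OF p1\<phi>, of x] by simp
    from mono_cancel[OF mono_i this] show "x = Zero C (Dom C x) (Dom C \<phi>)" by simp
  qed simp
  then obtain c where \<phi>c: "short_exact C \<phi> c" using mono_ses by blast
  note \<phi>cD [simp] = short_exactD[OF \<phi>c]
  define E where "E = Cod C c"
  have [simp]: "Cod C c = E" "E \<in> Ob C" using Cod_in[of c] by (simp_all add: E_def)
  define j where "j = c \<cdot> i2"
  define t where "t = c \<cdot> i1"
  have [simp]: "j \<in> Arr C" "Dom C j = B" "Cod C j = E" "t \<in> Arr C" "Dom C t = Cod C i" "Cod C t = E"
    by (auto simp: j_def t_def)
  have "t \<cdot> i \<boxminus> j \<cdot> f = c \<cdot> \<phi>" by (simp add: t_def j_def \<phi>_def)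
  also have "\<dots> = Zero C (Dom C i) E" by simp
  finally have ti: "t \<cdot> i = j \<cdot> f" using minus_eq_zero_iff[of "t \<cdot> i" "j \<cdot> f"] by simp
  have univ: "\<exists>e \<in> Hom C E T. e \<cdot> j = b \<and> e \<cdot> t = m"
    if "b \<in> Hom C B T" "m \<in> Hom C (Cod C i) T" "m \<cdot> i = b \<cdot> f" for T b m
  proof -
    have [simp]: "b \<in> Arr C" "m \<in> Arr C" "Dom C b = B" "Cod C b = T" "Dom C m = Cod C i" "Cod C m = T"
      using that by (auto simp: Hom_iff)
    define w where "w = m \<cdot> p1 \<boxplus> b \<cdot> p2"
    have [simp]: "w \<in> Arr C" "Dom C w = S" "Cod C w = T" by (auto simp: w_def)
    have "w \<cdot> \<phi> = Zero C (Dom C i) T" by (simp add: w_def that(3))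
    then obtain e where [simp]: "e \<in> Arr C" "Dom C e = E" "Cod C e = T" and e: "e \<cdot> c = w"
      using ses_colift[OF \<phi>c, of w] by (auto simp: Hom_iff)
    have "e \<cdot> j = w \<cdot> i2" "e \<cdot> t = w \<cdot> i1" by (simp_all add: e[symmetric] j_def t_def)
    then show ?thesis by (intro bexI[of _ e]) (auto simp: w_def Hom_iff)
  qed
  obtain q where [simp]: "q \<in> Arr C" "Dom C q = E" "Cod C q = Cod C p"
    and qj: "q \<cdot> j = Zero C B (Cod C p)" and qt: "q \<cdot> t = p"
  proof -
    have "\<exists>q \<in> Hom C E (Cod C p). q \<cdot> j = Zero C B (Cod C p) \<and> q \<cdot> t = p"
      by (rule univ) (simp_all add: Hom_iff)
    then show ?thesis using that by (metis Hom_iff)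
  qed
  have joint: "x = y" if "x \<in> Arr C" "y \<in> Arr C" "Dom C x = E" "Dom C y = E" "Cod C y = Cod C x"
    "x \<cdot> j = y \<cdot> j" "x \<cdot> t = y \<cdot> t" for x y
  proof -
    note [simp] = that(1-5)
    have "x \<cdot> c = x \<cdot> c \<cdot> (i1 \<cdot> p1 \<boxplus> i2 \<cdot> p2)" by (subst sum) simp
    also have "\<dots> = (x \<cdot> t) \<cdot> p1 \<boxplus> (x \<cdot> j) \<cdot> p2" by (simp add: t_def j_def)
    also have "\<dots> = (y \<cdot> t) \<cdot> p1 \<boxplus> (y \<cdot> j) \<cdot> p2" by (simp only: that)
    also have "\<dots> = y \<cdot> c \<cdot> (i1 \<cdot> p1 \<boxplus> i2 \<cdot> p2)" by (simp add: t_def j_def)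
    also have "\<dots> = y \<cdot> c" by (subst sum) simp
    finally show "x = y" using epi_cancel[of c x y] short_exact_mono_epi[OF \<phi>c] by simp
  qed
  \<comment> \<open>If \<open>j \<cdot> x = 0\<close>, then \<open>i2 \<cdot> x\<close> is killed by
    \<open>c\<close> and comes from \<open>\<phi>\<close>; its first component
    \<open>i \<cdot> y\<close> is zero, and \<open>i\<close> is monic.\<close>
  have "is_mono C j"
  proof (rule monoI)
    fix x assume [simp]: "x \<in> Arr C" "Cod C x = Dom C j" and jx: "j \<cdot> x = Zero C (Dom C x) (Cod C j)"
    have "c \<cdot> (i2 \<cdot> x) = Zero C (Dom C x) E" using jx by (simp add: j_def)
    then obtain y where [simp]: "y \<in> Arr C" "Dom C y = Dom C x" "Cod C y = Dom C i" and y: "\<phi> \<cdot> y = i2 \<cdot> x"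
      using ses_lift[OF \<phi>c, of "i2 \<cdot> x"] by (auto simp: Hom_iff)
    have "i \<cdot> y = p1 \<cdot> (\<phi> \<cdot> y)" by simp
    also have "\<dots> = i \<cdot> Zero C (Dom C x) (Dom C i)" unfolding y by simp
    finally have y0: "y = Zero C (Dom C x) (Dom C i)"
      using mono_cancel[OF mono_i, of y "Zero C (Dom C x) (Dom C i)"] by simp
    have "x = p2 \<cdot> (\<phi> \<cdot> y)" unfolding y by simp
    also have "\<dots> = Zero C (Dom C x) (Dom C j)" unfolding y0 by simp
    finally show "x = Zero C (Dom C x) (Dom C j)" .
  qed simp
  moreover have "is_cokernel C q j"
  proof (rule cokernelI)
    show "is_epi C q"
    proof (rule epiI)
      fix x assume [simp]: "x \<in> Arr C" "Dom C x = Cod C q" and "x \<cdot> q = Zero C (Dom C q) (Cod C x)"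
      then have "x \<cdot> p = Zero C (Cod C p) (Cod C x) \<cdot> p"
        using comp_assoc[of t q x] by (simp add: qt)
      then show "x = Zero C (Cod C q) (Cod C x)"
        using epi_cancel[of p x "Zero C (Cod C p) (Cod C x)"] short_exact_mono_epi[OF ses] by simp
    qed simp
    fix x assume [simp]: "x \<in> Arr C" "Dom C x = Cod C j" and xj: "x \<cdot> j = Zero C (Dom C j) (Cod C x)"
    have "(x \<cdot> t) \<cdot> i = (x \<cdot> j) \<cdot> f" using ti by simp
    then have "(x \<cdot> t) \<cdot> i = Zero C (Dom C i) (Cod C x)" by (simp add: xj)
    then obtain y where [simp]: "y \<in> Arr C" "Dom C y = Cod C p" "Cod C y = Cod C x" and y: "y \<cdot> p = x \<cdot> t"
      using ses_colift[OF ses, of "x \<cdot> t"] by (auto simp: Hom_iff)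
    have "y \<cdot> q = x"
      by (rule joint) (simp_all add: qj qt xj y)
    then show "\<exists>y\<in>Hom C (Cod C q) (Cod C x). y \<cdot> q = x" by (intro bexI[of _ y]) (simp_all add: Hom_iff)
  qed (simp_all add: qj)
  ultimately have "short_exact C j q" by (rule mono_cokernel_ses)
  then show thesis by (rule that[of j q t]) (use univ ti qt joint in \<open>simp_all add: Hom_iff\<close>)
qed

text \<open>Along a monomorphism \<open>f\<close> the pushout carries two exact sequences through
  the same middle object: \<open>t\<close> is monic as well, and its cokernel map \<open>e\<close>
  is prescribed as \<open>r\<close> on \<open>j\<close> and zero on \<open>t\<close>.\<close>

lemma pushout_ses:
  assumes ses: "short_exact C i p" and ses': "short_exact C f r" and D: "Dom C f = Dom C i"
  obtains j q t s where "short_exact C j q" "Dom C j = Cod C f" "Cod C q = Cod C p"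
    "short_exact C t s" "Dom C t = Cod C i" "Cod C s = Cod C r" "Cod C t = Cod C j"
proof -
  note [simp] = short_exactD[OF ses] short_exactD[OF ses'] D
  have f: "f \<in> Hom C (Dom C i) (Cod C f)" by (simp add: Hom_iff)
  obtain j q t where jq: "short_exact C j q" "Dom C j = Cod C f" "Cod C q = Cod C p"
    and t: "t \<in> Hom C (Cod C i) (Cod C j)" "t \<cdot> i = j \<cdot> f" "q \<cdot> t = p"
    and univ: "\<And>T b m. b \<in> Hom C (Cod C f) T \<Longrightarrow> m \<in> Hom C (Cod C i) T \<Longrightarrow> m \<cdot> i = b \<cdot> f
      \<Longrightarrow> \<exists>e \<in> Hom C (Cod C j) T. e \<cdot> j = b \<and> e \<cdot> t = m"
    and joint: "\<And>x y. x \<in> Arr C \<Longrightarrow> y \<in> Arr C \<Longrightarrow> Dom C x = Cod C j \<Longrightarrow> Dom C y = Cod C j \<Longrightarrow> Cod C y = Cod C x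
      \<Longrightarrow> x \<cdot> j = y \<cdot> j \<Longrightarrow> x \<cdot> t = y \<cdot> t \<Longrightarrow> x = y"
    by (rule pushout[OF ses f]) blast
  note [simp] = short_exactD[OF jq(1)] jq(2,3) t(1)[unfolded Hom_iff]
  have "\<exists>e \<in> Hom C (Cod C j) (Cod C r). e \<cdot> j = r \<and> e \<cdot> t = Zero C (Cod C i) (Cod C r)"
    by (rule univ) (simp_all add: Hom_iff)
  then obtain e where e: "e \<in> Hom C (Cod C j) (Cod C r)" "e \<cdot> j = r" "e \<cdot> t = Zero C (Cod C i) (Cod C r)"
    by blast
  note [simp] = e(1)[unfolded Hom_iff] e(2,3)
  note me = short_exact_mono_epi[OF ses] short_exact_mono_epi[OF ses'] short_exact_mono_epi[OF jq(1)]
  have "is_mono C t"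
  proof (rule monoI)
    fix x assume x [simp]: "x \<in> Arr C" "Cod C x = Dom C t" and tx: "t \<cdot> x = Zero C (Dom C x) (Cod C t)"
    have "p \<cdot> x = Zero C (Dom C x) (Cod C p)" using comp_reassoc[OF t(3), of x] tx by simp
    then obtain y where y: "y \<in> Hom C (Dom C x) (Dom C i)" "i \<cdot> y = x" using ses_lift[OF ses, of x] by auto
    note [simp] = y(1)[unfolded Hom_iff]
    have "j \<cdot> (f \<cdot> y) = t \<cdot> x" using comp_reassoc[OF t(2), of y] y(2) by simp
    then have "j \<cdot> (f \<cdot> y) = j \<cdot> Zero C (Dom C x) (Cod C f)" using tx by simp
    then have "f \<cdot> y = f \<cdot> Zero C (Dom C x) (Dom C i)"
      using mono_cancel[OF me(5), of "f \<cdot> y" "Zero C (Dom C x) (Cod C f)"] by simp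
    then have y0: "y = Zero C (Dom C x) (Dom C i)"
      using mono_cancel[OF me(3), of y "Zero C (Dom C x) (Dom C i)"] by simp
    have "i \<cdot> y = Zero C (Dom C x) (Cod C i)" unfolding y0 by simp
    then show "x = Zero C (Dom C x) (Dom C t)" unfolding y(2) by simp
  qed simp
  moreover have "is_cokernel C e t"
  proof (rule cokernelI)
    show "is_epi C e"
    proof (rule epiI)
      fix x assume [simp]: "x \<in> Arr C" "Dom C x = Cod C e" and x: "x \<cdot> e = Zero C (Dom C e) (Cod C x)"
      have "x \<cdot> r = (x \<cdot> e) \<cdot> j" by simp
      then have "x \<cdot> r = Zero C (Cod C r) (Cod C x) \<cdot> r" unfolding x by simp
      then show "x = Zero C (Cod C e) (Cod C x)"
        using epi_cancel[OF me(4), of x "Zero C (Cod C r) (Cod C x)"] by simp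
    qed simp
    fix x assume x [simp]: "x \<in> Arr C" "Dom C x = Cod C t" and xt: "x \<cdot> t = Zero C (Dom C t) (Cod C x)"
    have "(x \<cdot> j) \<cdot> f = (x \<cdot> t) \<cdot> i" using t(2) by simp
    then have "(x \<cdot> j) \<cdot> f = Zero C (Dom C f) (Cod C x)" unfolding xt by simp
    then obtain y where y: "y \<in> Hom C (Cod C r) (Cod C x)" "y \<cdot> r = x \<cdot> j"
      using ses_colift[OF ses', of "x \<cdot> j"] by auto
    note [simp] = y(1)[unfolded Hom_iff]
    have "y \<cdot> e = x" by (rule joint) (simp_all add: y(2) xt)
    then show "\<exists>y\<in>Hom C (Cod C e) (Cod C x). y \<cdot> e = x" by (intro bexI[of _ y]) (simp_all add: Hom_iff)
  qed simp_all
  ultimately have "short_exact C t e" by (rule mono_cokernel_ses)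
  then show thesis by (rule that[OF jq]) simp_all
qed

text \<open>Dual of the pushout of two monomorphisms; it supplies the square in Salce's
  argument.\<close>

lemma pullback_ses:
  assumes ses: "short_exact C i p" and ses': "short_exact C r f" and D: "Cod C f = Cod C p"
  obtains j q s t where "short_exact C j q" "Dom C j = Dom C i" "Cod C q = Cod C r"
    "short_exact C s t" "Dom C s = Dom C r" "Cod C t = Cod C i" "Cod C s = Cod C j"
proof -
  interpret op: abelian_category "op C" by (rule abelian_op)
  obtain q j t s where *: "short_exact (op C) q j" "Dom (op C) q = Cod (op C) f" "Cod (op C) j = Cod (op C) i"
    "short_exact (op C) t s" "Dom (op C) t = Cod (op C) p" "Cod (op C) s = Cod (op C) r"
    "Cod (op C) t = Cod (op C) q"
    by (rule op.pushout_ses[OF short_exact_op[OF ses] short_exact_op[OF ses']]) (use D in simp)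
  have "Dom C p = Cod C i" "Dom C f = Cod C r" "Dom C q = Cod C j" "Dom C t = Cod C s"
    using ses ses' * by (auto dest: short_exactD(3))
  then show thesis using that[of j q s t] * by simp
qed

text \<open>The retraction is the factorisation of \<open>1 - s p\<close> through the kernel
  \<open>i\<close>; the remaining identities follow by cancelling the monomorphism
  \<open>i\<close>.\<close>

lemma split_retraction:
  assumes ses: "short_exact C i p" and s: "s \<in> Hom C (Cod C p) (Cod C i)" "p \<cdot> s = Id C (Cod C p)"
  shows "\<exists>r \<in> Hom C (Cod C i) (Dom C i). r \<cdot> i = Id C (Dom C i) \<and> i \<cdot> r \<boxplus> s \<cdot> p = Id C (Cod C i)
    \<and> r \<cdot> s = Zero C (Cod C p) (Dom C i)"
proof -
  note [simp] = short_exactD[OF ses] s[unfolded Hom_iff] comp_reassoc[OF s(2)]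
    comp_reassoc[OF short_exactD(4)[OF ses]]
  obtain r where [simp]: "r \<in> Arr C" "Dom C r = Cod C i" "Cod C r = Dom C i"
    and r: "i \<cdot> r = Id C (Cod C i) \<boxminus> s \<cdot> p"
    using ses_lift_diff[OF ses, of "Id C (Cod C i)" "s \<cdot> p"] by (auto simp: Hom_iff)
  have m: "is_mono C i" using short_exact_mono_epi[OF ses] by simp
  have "i \<cdot> (r \<cdot> i) = i \<cdot> Id C (Dom C i)" using comp_reassoc[OF r, of i] by simp
  then have 1: "r \<cdot> i = Id C (Dom C i)" using mono_cancel[OF m] by force
  have "i \<cdot> (r \<cdot> s) = i \<cdot> Zero C (Cod C p) (Dom C i)" using comp_reassoc[OF r, of s] by simp
  then have 2: "r \<cdot> s = Zero C (Cod C p) (Dom C i)"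
    using mono_cancel[OF m, of "r \<cdot> s" "Zero C (Cod C p) (Dom C i)"] by simp
  show ?thesis using 1 2 by (intro bexI[of _ r]) (auto simp: r Hom_iff)
qed

lemma split_biproduct:
  assumes ses: "short_exact C i p" and s: "s \<in> Hom C (Cod C p) (Cod C i)" "p \<cdot> s = Id C (Cod C p)"
  shows "is_biproduct C (Dom C i) (Cod C p) (Cod C i)" "is_biproduct C (Cod C p) (Dom C i) (Cod C i)"
proof -
  note [simp] = short_exactD[OF ses] s[unfolded Hom_iff]
  obtain r where r: "r \<in> Hom C (Cod C i) (Dom C i)" "r \<cdot> i = Id C (Dom C i)"
    "i \<cdot> r \<boxplus> s \<cdot> p = Id C (Cod C i)" "r \<cdot> s = Zero C (Cod C p) (Dom C i)"
    using split_retraction[OF ses s] by auto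
  note [simp] = r[unfolded Hom_iff]
  show "is_biproduct C (Dom C i) (Cod C p) (Cod C i)" unfolding is_biproduct_def
    by (intro conjI bexI[of _ i] bexI[of _ s] bexI[of _ r] bexI[of _ p]) (simp_all add: Hom_iff)
  show "is_biproduct C (Cod C p) (Dom C i) (Cod C i)" unfolding is_biproduct_def
    by (intro conjI bexI[of _ i] bexI[of _ s] bexI[of _ r] bexI[of _ p])
      (simp_all add: Hom_iff add_comm[of "s \<cdot> p" "i \<cdot> r"])
qed

lemma biproduct_ses:
  assumes "is_biproduct C A B S"
  obtains i p s where "short_exact C i p" "Dom C i = A" "Cod C i = S" "Cod C p = B" "s \<in> Hom C B S"
    "p \<cdot> s = Id C B"
proof -
  obtain i j p q where h: "i \<in> Hom C A S" "j \<in> Hom C B S" "p \<in> Hom C S A" "q \<in> Hom C S B"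
    and e: "p \<cdot> i = Id C A" "q \<cdot> j = Id C B" "p \<cdot> j = Zero C B A" "q \<cdot> i = Zero C A B"
    and sum: "i \<cdot> p \<boxplus> j \<cdot> q = Id C S" and Ob [simp]: "A \<in> Ob C" "B \<in> Ob C" "S \<in> Ob C"
    using assms unfolding is_biproduct_def by blast
  note [simp] = h[unfolded Hom_iff] e
  note [simp] = comp_reassoc[OF e(1)] comp_reassoc[OF e(2)] comp_reassoc[OF e(3)] comp_reassoc[OF e(4)]
  have "is_mono C i"
  proof (rule monoI)
    fix x assume [simp]: "x \<in> Arr C" "Cod C x = Dom C i" and "i \<cdot> x = Zero C (Dom C x) (Cod C i)"
    then show "x = Zero C (Dom C x) (Dom C i)" using comp_reassoc[OF e(1), of x] by simp
  qed simp
  moreover have "is_cokernel C q i"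
  proof (rule cokernelI)
    show "is_epi C q"
    proof (rule epiI)
      fix x assume [simp]: "x \<in> Arr C" "Dom C x = Cod C q" and x: "x \<cdot> q = Zero C (Dom C q) (Cod C x)"
      have "x = (x \<cdot> q) \<cdot> j" by simp
      then show "x = Zero C (Cod C q) (Cod C x)" unfolding x by simp
    qed simp
    fix x assume [simp]: "x \<in> Arr C" "Dom C x = Cod C i" and xi: "x \<cdot> i = Zero C (Dom C i) (Cod C x)"
    have "x = x \<cdot> (i \<cdot> p \<boxplus> j \<cdot> q)" by (subst sum) simp
    also have "\<dots> = (x \<cdot> i) \<cdot> p \<boxplus> (x \<cdot> j) \<cdot> q" by simp
    also have "\<dots> = (x \<cdot> j) \<cdot> q" unfolding xi by simp
    finally show "\<exists>y\<in>Hom C (Cod C q) (Cod C x). y \<cdot> q = x"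
      by (intro bexI[of _ "x \<cdot> j"]) (auto simp: Hom_iff)
  qed simp_all
  ultimately have "short_exact C i q" by (rule mono_cokernel_ses)
  then show thesis by (rule that[of i q j]) (simp_all add: Hom_iff)
qed

end

section \<open>Extension orthogonality\<close>

text \<open>Vanishing of Ext^1 as splitting of every extension, without equivalence classes;
  \<open>Ext1_zero_iff\<close> reconciles it with the quotient \<open>Ext1\<close>.\<close>

definition ext_orth :: "('o, 'm, 'e) add_cat_scheme \<Rightarrow> 'o \<Rightarrow> 'o \<Rightarrow> bool" where
  "ext_orth C A B \<longleftrightarrow> A \<in> Ob C \<and> B \<in> Ob C \<and>
     (\<forall>i p. short_exact C i p \<and> Dom C i = B \<and> Cod C p = A \<longrightarrow>
        (\<exists>s \<in> Hom C A (Cod C i). p \<cdot>\<^bsub>C\<^esub> s = Id C A))"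

lemma ext_orth_Ob: "ext_orth C A B \<Longrightarrow> A \<in> Ob C" "ext_orth C A B \<Longrightarrow> B \<in> Ob C"
  by (auto simp: ext_orth_def)

context abelian_category
begin

lemma ext_orth_retraction:
  assumes "ext_orth C A B" "short_exact C i p" "Dom C i = B" "Cod C p = A"
  shows "\<exists>r \<in> Hom C (Cod C i) B. r \<cdot> i = Id C B"
proof -
  obtain s where "s \<in> Hom C (Cod C p) (Cod C i)" "p \<cdot> s = Id C (Cod C p)"
    using assms unfolding ext_orth_def by blast
  from split_retraction[OF assms(2) this] show ?thesis using assms(3) by auto
qed

lemma ext_orth_op_imp: "ext_orth C A B \<Longrightarrow> ext_orth (op C) B A"
  unfolding ext_orth_def[of "op C"]
proof (intro conjI allI impI; (elim conjE)?)
  fix p i assume "ext_orth C A B" "short_exact (op C) p i" "Dom (op C) p = A" "Cod (op C) i = B"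
  then obtain r where "r \<in> Hom C (Cod C i) B" "r \<cdot> i = Id C B"
    using ext_orth_retraction[of A B i p] by auto
  moreover have "Dom C p = Cod C i" using \<open>short_exact (op C) p i\<close> by auto
  ultimately show "\<exists>s\<in>Hom (op C) B (Cod (op C) p). i \<cdot>\<^bsub>op C\<^esub> s = cat.Id (op C) B" by auto
qed (simp_all add: ext_orth_Ob)

text \<open>Pushing the sequence out along \<open>f\<close> gives an extension of
  \<open>Cod C p\<close> by \<open>B\<close>, which has a retraction onto \<open>B\<close>; composed
  with the map \<open>t\<close> into the pushout it extends \<open>f\<close>.\<close>

lemma ext_extend:
  assumes o: "ext_orth C (Cod C p) B" and ses: "short_exact C i p" and f: "f \<in> Hom C (Dom C i) B"
  shows "\<exists>g \<in> Hom C (Cod C i) B. g \<cdot> i = f"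
proof -
  obtain j q t where jq: "short_exact C j q" "Dom C j = B" "Cod C q = Cod C p"
    and t: "t \<in> Hom C (Cod C i) (Cod C j)" "t \<cdot> i = j \<cdot> f"
    by (rule pushout[OF ses f]) blast
  obtain r where r: "r \<in> Hom C (Cod C j) B" "r \<cdot> j = Id C B"
    using ext_orth_retraction[OF o jq] by blast
  note [simp] = r(1)[unfolded Hom_iff] t[unfolded Hom_iff] f[unfolded Hom_iff] jq(2)
    short_exactD[OF ses] short_exactD[OF jq(1)]
  have "(r \<cdot> t) \<cdot> i = f" using comp_reassoc[OF r(2), of f] by simp
  then show ?thesis by (intro bexI[of _ "r \<cdot> t"]) (simp_all add: Hom_iff)
qed

end

section \<open>Morphisms through projectives and stable congruence\<close>

definition null :: "('o, 'm, 'e) add_cat_scheme \<Rightarrow> 'm \<Rightarrow> bool" where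
  "null C f \<longleftrightarrow> f \<in> Arr C \<and> f \<in> proj_ideal C (Dom C f) (Cod C f)"

text \<open>Equality in the stable category on the level of representatives. Equality of domains and
  codomains is part of the relation, so congruent arrows are parallel.\<close>

definition stab :: "('o, 'm, 'e) add_cat_scheme \<Rightarrow> 'm \<Rightarrow> 'm \<Rightarrow> bool" where
  "stab C f g \<longleftrightarrow> f \<in> Arr C \<and> g \<in> Arr C \<and> Dom C g = Dom C f \<and> Cod C g = Cod C f \<and>
     null C (f \<boxplus>\<^bsub>C\<^esub> neg C g)"

definition stab_retract :: "('o, 'm, 'e) add_cat_scheme \<Rightarrow> 'o \<Rightarrow> 'o \<Rightarrow> bool" where
  "stab_retract C A B \<longleftrightarrow> (\<exists>u \<in> Hom C A B. \<exists>v \<in> Hom C B A. stab C (v \<cdot>\<^bsub>C\<^esub> u) (Id C A))"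

definition stab_iso :: "('o, 'm, 'e) add_cat_scheme \<Rightarrow> 'o \<Rightarrow> 'o \<Rightarrow> bool" where
  "stab_iso C A B \<longleftrightarrow> (\<exists>u \<in> Hom C A B. \<exists>v \<in> Hom C B A.
     stab C (v \<cdot>\<^bsub>C\<^esub> u) (Id C A) \<and> stab C (u \<cdot>\<^bsub>C\<^esub> v) (Id C B))"

lemma stab_iso_sym: "stab_iso C A B \<Longrightarrow> stab_iso C B A"
  unfolding stab_iso_def by blast

lemma stab_iso_retract: "stab_iso C A B \<Longrightarrow> stab_retract C A B"
  unfolding stab_iso_def stab_retract_def by blast

context abelian_category
begin

lemma nullI: "P \<in> Proj C \<Longrightarrow> a \<in> Hom C A P \<Longrightarrow> b \<in> Hom C P B \<Longrightarrow> null C (b \<cdot> a)"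
  unfolding null_def proj_ideal_def by (auto simp: Hom_iff)

lemma nullE:
  assumes "null C f"
  obtains P a b where "P \<in> Proj C" "a \<in> Hom C (Dom C f) P" "b \<in> Hom C P (Cod C f)" "f = b \<cdot> a"
  using assms unfolding null_def proj_ideal_def by blast

lemma null_Arr [simp]: "null C f \<Longrightarrow> f \<in> Arr C"
  by (simp add: null_def)

lemma Proj_Ob [simp]: "P \<in> Proj C \<Longrightarrow> P \<in> Ob C"
  by (simp add: Proj_def)

lemma null_comp:
  assumes "null C f"
  shows "g \<in> Arr C \<Longrightarrow> Dom C g = Cod C f \<Longrightarrow> null C (g \<cdot> f)"
    and "g \<in> Arr C \<Longrightarrow> Cod C g = Dom C f \<Longrightarrow> null C (f \<cdot> g)"
proof -
  obtain P a b where P: "P \<in> Proj C" and ab: "a \<in> Hom C (Dom C f) P" "b \<in> Hom C P (Cod C f)"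
    and f: "f = b \<cdot> a"
    using nullE[OF assms] .
  note abs = ab[unfolded Hom_iff]
  show "null C (g \<cdot> f)" if g: "g \<in> Arr C" "Dom C g = Cod C f"
  proof -
    have "g \<cdot> f = (g \<cdot> b) \<cdot> a" unfolding f using abs g by simp
    then show ?thesis using nullI[OF P ab(1), of "g \<cdot> b" "Cod C g"] abs g by (simp add: Hom_iff)
  qed
  show "null C (f \<cdot> g)" if g: "g \<in> Arr C" "Cod C g = Dom C f"
  proof -
    have "f \<cdot> g = b \<cdot> (a \<cdot> g)" unfolding f using abs g by simp
    then show ?thesis using nullI[OF P _ ab(2), of "a \<cdot> g" "Dom C g"] abs g by (simp add: Hom_iff)
  qed
qed

lemma null_neg: "null C f \<Longrightarrow> null C (neg C f)"
  using null_comp(1)[of f "neg C (Id C (Cod C f))"] by simp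

lemma Proj_biproduct:
  assumes "is_biproduct C P Q S" "P \<in> Proj C" "Q \<in> Proj C"
  shows "S \<in> Proj C"
proof -
  obtain i j p q where h: "i \<in> Hom C P S" "j \<in> Hom C Q S" "p \<in> Hom C S P" "q \<in> Hom C S Q"
    and sum: "i \<cdot> p \<boxplus> j \<cdot> q = Id C S" and S: "S \<in> Ob C"
    using assms unfolding is_biproduct_def by blast
  note [simp] = h[unfolded Hom_iff] S
  show ?thesis unfolding Proj_def
  proof (intro CollectI conjI allI impI ballI S)
    fix e f assume e: "is_epi C e" and f: "f \<in> Hom C S (Cod C e)"
    then have [simp]: "f \<in> Arr C" "Dom C f = S" "Cod C f = Cod C e" "e \<in> Arr C"
      by (auto simp: is_epi_def Hom_iff)
    have "f \<cdot> i \<in> Hom C P (Cod C e)" "f \<cdot> j \<in> Hom C Q (Cod C e)" by (simp_all add: Hom_iff)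
    obtain g where g: "g \<in> Hom C P (Dom C e)" "e \<cdot> g = f \<cdot> i"
      using assms(2) e \<open>f \<cdot> i \<in> _\<close> unfolding Proj_def by blast
    obtain g' where g': "g' \<in> Hom C Q (Dom C e)" "e \<cdot> g' = f \<cdot> j"
      using assms(3) e \<open>f \<cdot> j \<in> _\<close> unfolding Proj_def by blast
    note [simp] = g(1)[unfolded Hom_iff] g'(1)[unfolded Hom_iff] comp_reassoc[OF g(2)] comp_reassoc[OF g'(2)]
    have "e \<cdot> (g \<cdot> p \<boxplus> g' \<cdot> q) = f \<cdot> (i \<cdot> p \<boxplus> j \<cdot> q)" by simp
    also have "\<dots> = f" unfolding sum by simp
    finally show "\<exists>g\<in>Hom C S (Dom C e). e \<cdot> g = f"
      by (intro bexI[of _ "g \<cdot> p \<boxplus> g' \<cdot> q"]) (simp_all add: Hom_iff)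
  qed
qed

text \<open>A map through \<open>P\<close> plus a map through \<open>Q\<close> passes through their
  biproduct, which is again projective. Transitivity of \<open>stab\<close> rests on this.\<close>

lemma null_add:
  assumes f: "null C f" and g: "null C g" and D: "Dom C g = Dom C f" "Cod C g = Cod C f"
  shows "null C (f \<boxplus> g)"
proof -
  obtain P a b where P: "P \<in> Proj C" and ab: "a \<in> Hom C (Dom C f) P" "b \<in> Hom C P (Cod C f)"
    and fe: "f = b \<cdot> a" using nullE[OF f] .
  obtain Q c d where Q: "Q \<in> Proj C" and cd: "c \<in> Hom C (Dom C f) Q" "d \<in> Hom C Q (Cod C f)"
    and ge: "g = d \<cdot> c" using nullE[OF g] unfolding D .
  obtain S i j p q where S: "is_biproduct C P Q S"
    and h: "i \<in> Hom C P S" "j \<in> Hom C Q S" "p \<in> Hom C S P" "q \<in> Hom C S Q"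
    and e: "p \<cdot> i = Id C P" "q \<cdot> j = Id C Q" "p \<cdot> j = Zero C Q P" "q \<cdot> i = Zero C P Q"
    by (rule biproductE[of P Q]) (use P Q in auto)
  have S': "S \<in> Proj C" using Proj_biproduct[OF S P Q] .
  have [simp]: "S \<in> Ob C" "f \<in> Arr C" using S' f by simp_all
  note [simp] = h[unfolded Hom_iff] ab[unfolded Hom_iff] cd[unfolded Hom_iff]
    comp_reassoc[OF e(1)] comp_reassoc[OF e(2)] comp_reassoc[OF e(3)] comp_reassoc[OF e(4)] Proj_Ob[OF P] Proj_Ob[OF Q]
  have "f \<boxplus> g = (b \<cdot> p \<boxplus> d \<cdot> q) \<cdot> (i \<cdot> a \<boxplus> j \<cdot> c)"
    unfolding fe ge by simp
  also have "null C \<dots>" by (rule nullI[OF S']) (auto simp: Hom_iff)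
  finally show ?thesis .
qed

lemma stabD: "stab C f g \<Longrightarrow> f \<in> Arr C" "stab C f g \<Longrightarrow> g \<in> Arr C" "stab C f g \<Longrightarrow> Dom C g = Dom C f"
  "stab C f g \<Longrightarrow> Cod C g = Cod C f" "stab C f g \<Longrightarrow> null C (f \<boxminus> g)"
  by (auto simp: stab_def)

lemma stab_sym: assumes "stab C f g" shows "stab C g f"
  using null_neg[OF stabD(5)[OF assms]] assms add_comm[of g "neg C f"] by (auto simp: stab_def)

lemma stab_trans [trans]:
  assumes fg: "stab C f g" and gh: "stab C g h" shows "stab C f h"
proof -
  note [simp] = stabD[OF fg] stabD[OF gh]
  have "(f \<boxminus> g) \<boxplus> (g \<boxminus> h) = f \<boxminus> h" by simp
  moreover have "null C ((f \<boxminus> g) \<boxplus> (g \<boxminus> h))"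
    by (rule null_add) (use stabD(5)[OF fg] stabD(5)[OF gh] in auto)
  ultimately show ?thesis unfolding stab_def by auto
qed

lemma stab_comp:
  assumes "stab C f f'"
  shows "g \<in> Arr C \<Longrightarrow> Dom C g = Cod C f \<Longrightarrow> stab C (g \<cdot> f) (g \<cdot> f')"
    and "g \<in> Arr C \<Longrightarrow> Cod C g = Dom C f \<Longrightarrow> stab C (f \<cdot> g) (f' \<cdot> g)"
proof -
  note [simp] = stabD(1-4)[OF assms]
  show "stab C (g \<cdot> f) (g \<cdot> f')" if "g \<in> Arr C" "Dom C g = Cod C f"
    using null_comp(1)[OF stabD(5)[OF assms], of g] that by (simp add: stab_def)
  show "stab C (f \<cdot> g) (f' \<cdot> g)" if "g \<in> Arr C" "Cod C g = Dom C f"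
    using null_comp(2)[OF stabD(5)[OF assms], of g] that by (simp add: stab_def)
qed

lemma null_cong: "stab C f g \<Longrightarrow> null C g \<Longrightarrow> null C f"
  using null_add[of "f \<boxminus> g" g] add_minus_cancel(2)[of f g] by (auto simp: stab_def)

lemma stab_add_null:
  assumes "f \<in> Arr C" "null C n" "Dom C n = Dom C f" "Cod C n = Cod C f"
  shows "stab C (f \<boxplus> n) f"
  using assms add_minus_cancel(3)[of n f] add_comm[of n f] unfolding stab_def by simp

end

section \<open>Dimension shifting and closure properties of Ext-orthogonality\<close>

context frobenius_abelian_category
begin

text \<open>Factoring through projectives is self-dual because projectives and injectives coincide;
  hence the stable notions transfer to \<open>op C\<close> unchanged.\<close>

lemma null_op [simp]: "null (op C) f = null C f"
  unfolding null_def proj_ideal_def using Proj_eq_Inj by auto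

lemma stab_op [simp]: "stab (op C) f g = stab C f g"
  unfolding stab_def by (auto simp: neg_op)

lemma stab_iso_op: "stab_iso C A B \<Longrightarrow> stab_iso (op C) A B"
  unfolding stab_iso_def by auto

lemma enough_proj_ses:
  assumes "A \<in> Ob C"
  obtains i p where "short_exact C i p" "Cod C p = A" "Cod C i \<in> Proj C"
  using enough_proj[OF assms] epi_ses short_exactD(3) by metis

lemma enough_inj_ses:
  assumes "A \<in> Ob C"
  obtains i p where "short_exact C i p" "Dom C i = A" "Cod C i \<in> Proj C"
  using enough_inj[OF assms] mono_ses Proj_eq_Inj by metis

lemma null_zero:
  assumes "A \<in> Ob C" "B \<in> Ob C" shows "null C (Zero C A B)"
proof -
  obtain e where e: "is_epi C e" "Cod C e = B" "Dom C e \<in> Proj C" using enough_proj assms(2) by blast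
  have [simp]: "e \<in> Arr C" using e(1) by (simp add: is_epi_def)
  have "null C (e \<cdot> Zero C A (Dom C e))"
    by (rule nullI[OF e(3)]) (use e assms in \<open>auto simp: Hom_iff\<close>)
  then show ?thesis using e assms by simp
qed

lemma stab_refl [simp]: "f \<in> Arr C \<Longrightarrow> stab C f f"
  by (simp add: stab_def null_zero)

lemma null_iff_stab: "f \<in> Arr C \<Longrightarrow> null C f \<longleftrightarrow> stab C f (Zero C (Dom C f) (Cod C f))"
  by (simp add: stab_def)

lemma Inj_extend:
  assumes "Q \<in> Proj C" "short_exact C i p" "f \<in> Hom C (Dom C i) Q"
  shows "\<exists>g \<in> Hom C (Cod C i) Q. g \<cdot> i = f"
  using assms short_exact_mono_epi(1)[OF assms(2)] unfolding Proj_eq_Inj Inj_def by blast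

lemma Proj_lift:
  assumes "P \<in> Proj C" "short_exact C i p" "f \<in> Hom C P (Cod C p)"
  shows "\<exists>g \<in> Hom C P (Cod C i). p \<cdot> g = f"
  using assms short_exact_mono_epi(2)[OF assms(2)] short_exactD(3)[OF assms(2)]
  unfolding Proj_def by auto

text \<open>The projective through which \<open>f\<close> passes is also injective, so the first
  factor extends along \<open>i\<close> and the extension still passes through that
  projective.\<close>

lemma null_extend:
  assumes f: "null C f" and ses: "short_exact C i p" and D: "Dom C i = Dom C f"
  shows "\<exists>g \<in> Hom C (Cod C i) (Cod C f). null C g \<and> g \<cdot> i = f"
proof -
  obtain P a b where P: "P \<in> Proj C" and ab: "a \<in> Hom C (Dom C f) P" "b \<in> Hom C P (Cod C f)"
    and fe: "f = b \<cdot> a" using nullE[OF f] .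
  obtain g where g: "g \<in> Hom C (Cod C i) P" "g \<cdot> i = a" using Inj_extend[OF P ses] ab D by auto
  note gs = g(1)[unfolded Hom_iff] ab[unfolded Hom_iff] short_exactD[OF ses] D
  have "(b \<cdot> g) \<cdot> i = f" using gs g(2) by (simp add: fe[symmetric])
  then show ?thesis using gs nullI[OF P g(1) ab(2)] by (intro bexI[of _ "b \<cdot> g"]) (simp_all add: Hom_iff)
qed

lemma null_lift:
  assumes f: "null C f" and ses: "short_exact C i p" and D: "Cod C p = Cod C f"
  shows "\<exists>g \<in> Hom C (Dom C f) (Cod C i). null C g \<and> p \<cdot> g = f"
  using frobenius_abelian_category.null_extend[OF frobenius_op _ short_exact_op[OF ses], of f]
    f D short_exactD(3)[OF ses] by simp

text \<open>One sequence with projective middle term tests all extensions: \<open>p\<close> lifts to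
  a map \<open>l\<close> into the given extension, \<open>l\<close> induces some \<open>f\<close> on
  kernels, and once \<open>f\<close> is extended to \<open>g\<close> the difference
  \<open>l - j g\<close> kills \<open>i\<close> and descends to a section.\<close>

lemma ext_orthI:
  assumes ses: "short_exact C i p" and P: "Cod C i \<in> Proj C" and B: "B \<in> Ob C"
    and ext: "\<And>f. f \<in> Hom C (Dom C i) B \<Longrightarrow> \<exists>g \<in> Hom C (Cod C i) B. g \<cdot> i = f"
  shows "ext_orth C (Cod C p) B"
  unfolding ext_orth_def
proof (intro conjI allI impI; (elim conjE)?)
  note [simp] = short_exactD[OF ses]
  show "Cod C p \<in> Ob C" by simp
  show "B \<in> Ob C" by (rule B)
  fix j q assume jq: "short_exact C j q" "Dom C j = B" "Cod C q = Cod C p"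
  note [simp] = short_exactD[OF jq(1)] jq(2,3)
  obtain l where l: "l \<in> Hom C (Cod C i) (Cod C j)" "q \<cdot> l = p"
    using Proj_lift[OF P jq(1), of p] by (auto simp: Hom_iff)
  note [simp] = l(1)[unfolded Hom_iff] comp_reassoc[OF l(2)]
  obtain f where f: "f \<in> Hom C (Dom C i) B" "j \<cdot> f = l \<cdot> i"
    using ses_lift[OF jq(1), of "l \<cdot> i"] by auto
  obtain g where g: "g \<in> Hom C (Cod C i) B" "g \<cdot> i = f" using ext[OF f(1)] by blast
  note [simp] = g(1)[unfolded Hom_iff] g(2) f(2)
  obtain s where s: "s \<in> Hom C (Cod C p) (Cod C j)" "s \<cdot> p = l \<boxminus> j \<cdot> g"
    using ses_colift_diff[OF ses, of l "j \<cdot> g"] by auto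
  note [simp] = s(1)[unfolded Hom_iff]
  have "(q \<cdot> s) \<cdot> p = q \<cdot> (l \<boxminus> j \<cdot> g)" using s(2) by simp
  also have "\<dots> = Id C (Cod C p) \<cdot> p"
    using comp_reassoc[OF short_exactD(4)[OF jq(1)], of g] l(2) by simp
  finally have "q \<cdot> s = Id C (Cod C p)"
    using epi_cancel[of p "q \<cdot> s" "Id C (Cod C p)"] short_exact_mono_epi[OF ses] by simp
  then show "\<exists>s\<in>Hom C (Cod C p) (Cod C j). q \<cdot> s = cat.Id C (Cod C p)" using s(1) by blast
qed

lemma ext_orth_op: "ext_orth (op C) B A \<Longrightarrow> ext_orth C A B"
  unfolding ext_orth_def
proof (intro conjI allI impI; (elim conjE)?)
  assume *: "B \<in> Ob (op C)" "A \<in> Ob (op C)"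
    "\<forall>i p. short_exact (op C) i p \<and> Dom (op C) i = A \<and> Cod (op C) p = B
      \<longrightarrow> (\<exists>s\<in>Hom (op C) B (Cod (op C) i). p \<cdot>\<^bsub>op C\<^esub> s = Id (op C) B)"
  then show "A \<in> Ob C" "B \<in> Ob C" by auto
  fix i p assume ip: "short_exact C i p" "Dom C i = B" "Cod C p = A"
  obtain r where r: "r \<in> Hom (op C) B (Cod (op C) p)" "i \<cdot>\<^bsub>op C\<^esub> r = Id (op C) B"
    using *(3)[rule_format, of p i] ip by auto
  interpret op: abelian_category "op C" by (rule abelian_op)
  obtain s where "s \<in> Hom (op C) (Cod (op C) p) (Dom (op C) p)" "s \<cdot>\<^bsub>op C\<^esub> p = Id (op C) (Dom (op C) p)"
    using op.split_retraction[OF short_exact_op[OF ip(1)], of r] r ip by auto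
  then show "\<exists>s\<in>Hom C A (Cod C i). p \<cdot> s = cat.Id C A"
    using ip short_exactD(3)[OF ip(1)] by (intro bexI[of _ s]) auto
qed

lemma ext_orth_op_iff [simp]: "ext_orth (op C) B A = ext_orth C A B"
  using ext_orth_op ext_orth_op_imp by blast

lemma ext_lift:
  assumes "ext_orth C A (Dom C i)" and ses: "short_exact C i p" and "f \<in> Hom C A (Cod C p)"
  shows "\<exists>g \<in> Hom C A (Cod C i). p \<cdot> g = f"
  using abelian_category.ext_extend[OF abelian_op _ short_exact_op[OF ses], of A f] assms
    short_exactD(3)[OF ses] by simp

text \<open>Dimension shift from Ext^1 to stable maps out of a syzygy: an extension over the
  projective middle term exhibits a factorisation through it, and conversely a null map
  extends.\<close>

lemma ext_orth_null_left:
  assumes ses: "short_exact C i p" and P: "Cod C i \<in> Proj C" and B: "B \<in> Ob C"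
  shows "ext_orth C (Cod C p) B \<longleftrightarrow> (\<forall>f \<in> Hom C (Dom C i) B. null C f)"
proof
  assume o: "ext_orth C (Cod C p) B"
  show "\<forall>f \<in> Hom C (Dom C i) B. null C f"
  proof
    fix f assume "f \<in> Hom C (Dom C i) B"
    then obtain g where g: "g \<in> Hom C (Cod C i) B" "g \<cdot> i = f" using ext_extend[OF o ses] by blast
    show "null C f" unfolding g(2)[symmetric]
      by (rule nullI[OF P _ g(1)]) (use short_exactD[OF ses] in \<open>auto simp: Hom_iff\<close>)
  qed
next
  assume n: "\<forall>f \<in> Hom C (Dom C i) B. null C f"
  show "ext_orth C (Cod C p) B"
  proof (rule ext_orthI[OF ses P B])
    fix f assume f: "f \<in> Hom C (Dom C i) B"
    then have "null C f" "Dom C i = Dom C f" "Cod C f = B" using n by (auto simp: Hom_iff)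
    then show "\<exists>g\<in>Hom C (Cod C i) B. g \<cdot> i = f" using null_extend[OF _ ses] by blast
  qed
qed

lemma ext_orth_null_right:
  assumes ses: "short_exact C i p" and P: "Cod C i \<in> Proj C" and A: "A \<in> Ob C"
  shows "ext_orth C A (Dom C i) \<longleftrightarrow> (\<forall>f \<in> Hom C A (Cod C p). null C f)"
  using frobenius_abelian_category.ext_orth_null_left[OF frobenius_op short_exact_op[OF ses], of A]
    P A short_exactD(3)[OF ses] Proj_eq_Inj by simp

text \<open>After shifting to stable maps into a cosyzygy of \<open>B\<close>, a map
  \<open>f\<close> on \<open>A'\<close> agrees stably with \<open>f v u\<close>, and
  \<open>f v\<close> is null. Stable retracts cover direct summands, isomorphic objects and stably
  isomorphic objects at once.\<close>

lemma ext_orth_retract_left: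
  assumes o: "ext_orth C A B" and r: "stab_retract C A' A"
  shows "ext_orth C A' B"
proof -
  have [simp]: "A \<in> Ob C" "B \<in> Ob C" using o by (auto simp: ext_orth_def)
  obtain u v where u: "u \<in> Hom C A' A" and v: "v \<in> Hom C A A'" and vu: "stab C (v \<cdot> u) (Id C A')"
    using r unfolding stab_retract_def by blast
  note uv [simp] = u[unfolded Hom_iff] v[unfolded Hom_iff]
  have [simp]: "A' \<in> Ob C" using Hom_Ob[OF u] by simp
  obtain i p where ip: "short_exact C i p" "Dom C i = B" "Cod C i \<in> Proj C"
    using enough_inj_ses[of B] by auto
  have n: "null C f" if "f \<in> Hom C A (Cod C p)" for f
    using ext_orth_null_right[OF ip(1,3), of A] o ip(2) that by simp
  have "null C f" if f: "f \<in> Hom C A' (Cod C p)" for f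
  proof -
    note [simp] = f[unfolded Hom_iff]
    have "stab C (f \<cdot> (v \<cdot> u)) (f \<cdot> Id C A')" by (rule stab_comp(1)[OF vu]) simp_all
    then have "stab C f ((f \<cdot> v) \<cdot> u)" using stab_sym by simp
    moreover have "null C ((f \<cdot> v) \<cdot> u)"
      by (intro null_comp(2) n) (simp_all add: Hom_iff)
    ultimately show "null C f" by (rule null_cong)
  qed
  then show ?thesis using ext_orth_null_right[OF ip(1,3), of A'] ip(2) by simp
qed

lemma stab_retract_op: "stab_retract C A B \<Longrightarrow> stab_retract (op C) A B"
  unfolding stab_retract_def by auto

lemma ext_orth_retract_right:
  assumes "ext_orth C A B" and "stab_retract C B' B"
  shows "ext_orth C A B'"
  using frobenius_abelian_category.ext_orth_retract_left[OF frobenius_op _ stab_retract_op[OF assms(2)], of A]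
    assms(1) by simp

text \<open>Half-exactness of stable maps into the cosyzygy \<open>Cod C q\<close>: on
  \<open>Dom C i\<close> the map \<open>f\<close> factors through the injective
  \<open>Cod C k\<close>, this factorisation extends to \<open>Cod C i\<close>, and the remainder
  descends to \<open>Cod C p\<close>, where it is null.\<close>

lemma ext_orth_middle:
  assumes ses: "short_exact C i p" and o: "ext_orth C (Dom C i) B" "ext_orth C (Cod C p) B"
  shows "ext_orth C (Cod C i) B"
proof -
  have [simp]: "B \<in> Ob C" using o by (auto simp: ext_orth_def)
  note [simp] = short_exactD[OF ses]
  obtain k q where kq: "short_exact C k q" "Dom C k = B" "Cod C k \<in> Proj C"
    using enough_inj_ses[of B] by auto
  note [simp] = short_exactD[OF kq(1)] kq(2)
  have "null C f" if f: "f \<in> Hom C (Cod C i) (Cod C q)" for f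
  proof -
    note [simp] = f[unfolded Hom_iff]
    obtain l where l: "l \<in> Hom C (Dom C i) (Cod C k)" "q \<cdot> l = f \<cdot> i"
      using ext_lift[OF _ kq(1), of "Dom C i" "f \<cdot> i"] o by (auto simp: Hom_iff)
    obtain l' where l': "l' \<in> Hom C (Cod C i) (Cod C k)" "l' \<cdot> i = l"
      using Inj_extend[OF kq(3) ses l(1)] by blast
    note [simp] = l(1)[unfolded Hom_iff] l(2) l'(1)[unfolded Hom_iff] l'(2)
    obtain w where w: "w \<in> Hom C (Cod C p) (Cod C q)" "w \<cdot> p = f \<boxminus> q \<cdot> l'"
      using ses_colift_diff[OF ses, of f "q \<cdot> l'"] by auto
    have "null C w" using ext_orth_null_right[OF kq(1,3), of "Cod C p"] o w(1) by auto
    then have "null C (f \<boxminus> q \<cdot> l')" using null_comp(2)[of w p] w by (auto simp: Hom_iff)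
    then have "stab C f (q \<cdot> l')" by (simp add: stab_def)
    moreover have "null C (q \<cdot> l')" by (rule nullI[OF kq(3) l'(1)]) (simp add: Hom_iff)
    ultimately show "null C f" by (rule null_cong)
  qed
  then show ?thesis using ext_orth_null_right[OF kq(1,3), of "Cod C i"] by simp
qed

text \<open>Stably, \<open>Cod C p\<close> is the cone of \<open>i\<close> and sits between
  \<open>Cod C i\<close> and the cosyzygy \<open>Cod C r\<close> of \<open>Dom C i\<close>. This
  gives closure under cokernels of monomorphisms.\<close>

lemma ext_orth_third:
  assumes ses: "short_exact C i p" and ses': "short_exact C j r" "Dom C j = Dom C i" "Cod C j \<in> Proj C"
    and o: "ext_orth C (Cod C r) B" "ext_orth C (Cod C i) B"
  shows "ext_orth C (Cod C p) B"
proof -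
  have [simp]: "B \<in> Ob C" using o by (auto simp: ext_orth_def)
  note [simp] = short_exactD[OF ses]
  obtain k q where kq: "short_exact C k q" "Dom C k = B" "Cod C k \<in> Proj C"
    using enough_inj_ses[of B] by auto
  note [simp] = short_exactD[OF kq(1)] kq(2)
  have "null C f" if f: "f \<in> Hom C (Cod C p) (Cod C q)" for f
  proof -
    note [simp] = f[unfolded Hom_iff]
    obtain l where l: "l \<in> Hom C (Cod C i) (Cod C k)" "q \<cdot> l = f \<cdot> p"
      using ext_lift[OF _ kq(1), of "Cod C i" "f \<cdot> p"] o by (auto simp: Hom_iff)
    note [simp] = l(1)[unfolded Hom_iff] l(2) comp_reassoc[OF l(2)]
    obtain m where m: "m \<in> Hom C (Dom C i) B" "k \<cdot> m = l \<cdot> i"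
      using ses_lift[OF kq(1), of "l \<cdot> i"] by auto
    note [simp] = m(1)[unfolded Hom_iff] m(2)
    \<comment> \<open>\<open>m\<close> obstructs the descent of \<open>l\<close> to
      \<open>Cod C p\<close>. Orthogonality of the cosyzygy \<open>Cod C r\<close> makes it null,
      hence extendable over \<open>Cod C i\<close> and removable from \<open>l\<close>.\<close>
    have "null C m" using ext_orth_null_left[OF ses'(1,3), of B] o m(1) ses'(2) by auto
    then obtain m' where m': "m' \<in> Hom C (Cod C i) B" "m' \<cdot> i = m"
      using null_extend[OF _ ses, of m] by auto
    note [simp] = m'(1)[unfolded Hom_iff] m'(2)
    obtain l' where l': "l' \<in> Hom C (Cod C p) (Cod C k)" "l' \<cdot> p = l \<boxminus> k \<cdot> m'"
      using ses_colift_diff[OF ses, of l "k \<cdot> m'"] by auto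
    note [simp] = l'(1)[unfolded Hom_iff]
    have "(q \<cdot> l') \<cdot> p = f \<cdot> p"
      using l'(2) comp_reassoc[OF short_exactD(4)[OF kq(1)], of m'] by simp
    then have "q \<cdot> l' = f"
      using epi_cancel[of p "q \<cdot> l'" f] short_exact_mono_epi[OF ses] by simp
    then show "null C f" using nullI[OF kq(3) l'(1), of q] by (auto simp: Hom_iff)
  qed
  then show ?thesis using ext_orth_null_right[OF kq(1,3), of "Cod C p"] by simp
qed

lemma ext_orth_Proj:
  assumes "P \<in> Proj C" "B \<in> Ob C"
  shows "ext_orth C P B"
  unfolding ext_orth_def
proof (intro conjI allI impI; (elim conjE)?)
  fix i p assume "short_exact C i p" "Dom C i = B" "Cod C p = P"
  then show "\<exists>s\<in>Hom C P (Cod C i). p \<cdot> s = cat.Id C P"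
    using Proj_lift[OF assms(1), of i p "Id C P"] assms by (auto simp: Hom_iff)
qed (use assms in auto)

section \<open>Stable functoriality of syzygies\<close>

text \<open>Passing to cosyzygies is well defined on stable morphisms. The null map \<open>f\<close>
  extends to \<open>f'\<close> over \<open>Cod C i\<close>, and \<open>g - i' f'\<close> descends to
  a lift of \<open>h\<close> into the projective \<open>Cod C i'\<close>.\<close>

lemma ses_map_null:
  assumes ses: "short_exact C i p" "short_exact C i' p'" and P: "Cod C i' \<in> Proj C"
    and m: "f \<in> Hom C (Dom C i) (Dom C i')" "g \<in> Hom C (Cod C i) (Cod C i')" "h \<in> Hom C (Cod C p) (Cod C p')"
    and e: "g \<cdot> i = i' \<cdot> f" "h \<cdot> p = p' \<cdot> g" and n: "null C f"
  shows "null C h"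
proof -
  note [simp] = short_exactD[OF ses(1)] short_exactD[OF ses(2)] m[unfolded Hom_iff] e(1)
  obtain f' where f': "f' \<in> Hom C (Cod C i) (Dom C i')" "f' \<cdot> i = f"
    using null_extend[OF n ses(1)] by auto
  note [simp] = f'(1)[unfolded Hom_iff] f'(2)
  obtain l where l: "l \<in> Hom C (Cod C p) (Cod C i')" "l \<cdot> p = g \<boxminus> i' \<cdot> f'"
    using ses_colift_diff[OF ses(1), of g "i' \<cdot> f'"] by auto
  note [simp] = l(1)[unfolded Hom_iff]
  have "(p' \<cdot> l) \<cdot> p = h \<cdot> p"
    using l(2) comp_reassoc[OF short_exactD(4)[OF ses(2)], of f'] e(2) by simp
  then have "p' \<cdot> l = h"
    using epi_cancel[of p "p' \<cdot> l" h] short_exact_mono_epi[OF ses(1)] by simp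
  then show ?thesis using nullI[OF P l(1), of p'] by (auto simp: Hom_iff)
qed

lemma ses_map_exists:
  assumes ses: "short_exact C i p" "short_exact C i' p'" and P: "Cod C i' \<in> Proj C"
    and f: "f \<in> Hom C (Dom C i) (Dom C i')"
  shows "\<exists>g \<in> Hom C (Cod C i) (Cod C i'). \<exists>h \<in> Hom C (Cod C p) (Cod C p').
    g \<cdot> i = i' \<cdot> f \<and> h \<cdot> p = p' \<cdot> g"
proof -
  note [simp] = short_exactD[OF ses(1)] short_exactD[OF ses(2)] f[unfolded Hom_iff]
  obtain g where g: "g \<in> Hom C (Cod C i) (Cod C i')" "g \<cdot> i = i' \<cdot> f"
    using Inj_extend[OF P ses(1), of "i' \<cdot> f"] by (auto simp: Hom_iff)
  note [simp] = g(1)[unfolded Hom_iff] g(2)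
  have "p' \<cdot> (i' \<cdot> f) = Zero C (Dom C i) (Cod C p')"
    using comp_reassoc[OF short_exactD(4)[OF ses(2)], of f] by simp
  then obtain h where "h \<in> Hom C (Cod C p) (Cod C p')" "h \<cdot> p = p' \<cdot> g"
    using ses_colift[OF ses(1), of "p' \<cdot> g"] by auto
  then show ?thesis using g by blast
qed

text \<open>Stable form of Schanuel's lemma: cosyzygies depend neither on the sequence nor on the
  stable representative. The map induced on cokernels by the null map \<open>v u - 1\<close> is null
  by \<open>ses_map_null\<close>; \<open>half\<close> serves once for each composite.\<close>

lemma cosyzygy_iso:
  assumes ses: "short_exact C i p" "short_exact C i' p'" and P: "Cod C i \<in> Proj C" "Cod C i' \<in> Proj C"
    and "stab_iso C (Dom C i) (Dom C i')"
  shows "stab_iso C (Cod C p) (Cod C p')"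
proof -
  have half: "stab C (h' \<cdot> h) (Id C (Cod C p))"
    if ses: "short_exact C i p" "short_exact C i' p'" and P: "Cod C i \<in> Proj C"
      and uv: "u \<in> Hom C (Dom C i) (Dom C i')" "v \<in> Hom C (Dom C i') (Dom C i)"
        "stab C (v \<cdot> u) (Id C (Dom C i))"
      and g: "g \<in> Hom C (Cod C i) (Cod C i')" "g \<cdot> i = i' \<cdot> u"
      and h: "h \<in> Hom C (Cod C p) (Cod C p')" "h \<cdot> p = p' \<cdot> g"
      and g': "g' \<in> Hom C (Cod C i') (Cod C i)" "g' \<cdot> i' = i \<cdot> v"
      and h': "h' \<in> Hom C (Cod C p') (Cod C p)" "h' \<cdot> p' = p \<cdot> g'"
    for i p i' p' u v g h g' h'
  proof -
    note [simp] = short_exactD[OF ses(1)] short_exactD[OF ses(2)] uv(1,2)[unfolded Hom_iff]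
      g(1)[unfolded Hom_iff] h(1)[unfolded Hom_iff] g'(1)[unfolded Hom_iff] h'(1)[unfolded Hom_iff]
      g(2) h(2) g'(2) h'(2) comp_reassoc[OF g'(2)] comp_reassoc[OF h'(2)]
    have "null C (h' \<cdot> h \<boxminus> Id C (Cod C p))"
      by (rule ses_map_null[OF ses(1) ses(1) P, of "v \<cdot> u \<boxminus> Id C (Dom C i)" "g' \<cdot> g \<boxminus> Id C (Cod C i)"])
        (use stabD(5)[OF uv(3)] in \<open>simp_all add: Hom_iff\<close>)
    then show ?thesis by (simp add: stab_def)
  qed
  obtain u v where uv: "u \<in> Hom C (Dom C i) (Dom C i')" "v \<in> Hom C (Dom C i') (Dom C i)"
    "stab C (v \<cdot> u) (Id C (Dom C i))" "stab C (u \<cdot> v) (Id C (Dom C i'))"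
    using assms(5) unfolding stab_iso_def by blast
  obtain g h where g: "g \<in> Hom C (Cod C i) (Cod C i')" "g \<cdot> i = i' \<cdot> u"
      and h: "h \<in> Hom C (Cod C p) (Cod C p')" "h \<cdot> p = p' \<cdot> g"
    using ses_map_exists[OF ses P(2) uv(1)] by blast
  obtain g' h' where g': "g' \<in> Hom C (Cod C i') (Cod C i)" "g' \<cdot> i' = i \<cdot> v"
      and h': "h' \<in> Hom C (Cod C p') (Cod C p)" "h' \<cdot> p' = p \<cdot> g'"
    using ses_map_exists[OF ses(2,1) P(1) uv(2)] by blast
  show ?thesis unfolding stab_iso_def
    using half[OF ses P(1) uv(1-3) g h g' h'] half[OF ses(2,1) P(2) uv(2,1,4) g' h' g h] h(1) h'(1)
    by blast
qed

lemma syzygy_iso: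
  assumes ses: "short_exact C i p" "short_exact C i' p'" and P: "Cod C i \<in> Proj C" "Cod C i' \<in> Proj C"
    and i: "stab_iso C (Cod C p) (Cod C p')"
  shows "stab_iso C (Dom C i) (Dom C i')"
proof -
  interpret op: frobenius_abelian_category "op C" by (rule frobenius_op)
  have "stab_iso (op C) (Dom C i) (Dom C i')"
    using op.cosyzygy_iso[OF short_exact_op[OF ses(1)] short_exact_op[OF ses(2)]] stab_iso_op[OF i] P
      short_exactD(3)[OF ses(1)] short_exactD(3)[OF ses(2)] Proj_eq_Inj by simp
  then show ?thesis unfolding stab_iso_def by auto
qed

lemma stab_iso_refl: "A \<in> Ob C \<Longrightarrow> stab_iso C A A"
  unfolding stab_iso_def by (intro bexI[of _ "Id C A"]) (auto simp: Hom_iff)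

lemma stab_iso_trans:
  assumes "stab_iso C A B" "stab_iso C B D" shows "stab_iso C A D"
proof -
  have half: "stab C ((v \<cdot> v') \<cdot> (u' \<cdot> u)) (Id C A)"
    if m: "u \<in> Hom C A B" "v \<in> Hom C B A" "u' \<in> Hom C B D" "v' \<in> Hom C D B"
      and s: "stab C (v \<cdot> u) (Id C A)" "stab C (v' \<cdot> u') (Id C B)" for A B D u v u' v'
  proof -
    note [simp] = m[unfolded Hom_iff]
    have "stab C (v \<cdot> ((v' \<cdot> u') \<cdot> u)) (v \<cdot> (Id C B \<cdot> u))"
      by (intro stab_comp s) simp_all
    also have "v \<cdot> (Id C B \<cdot> u) = v \<cdot> u" by simp
    also note s(1)
    finally show ?thesis by simp
  qed
  obtain u v where 1: "u \<in> Hom C A B" "v \<in> Hom C B A" "stab C (v \<cdot> u) (Id C A)" "stab C (u \<cdot> v) (Id C B)"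
    using assms(1) unfolding stab_iso_def by blast
  obtain u' v' where 2: "u' \<in> Hom C B D" "v' \<in> Hom C D B" "stab C (v' \<cdot> u') (Id C B)" "stab C (u' \<cdot> v') (Id C D)"
    using assms(2) unfolding stab_iso_def by blast
  have "u' \<cdot> u \<in> Hom C A D" "v \<cdot> v' \<in> Hom C D A" using 1 2 Comp_hom by auto
  then show ?thesis unfolding stab_iso_def
    using half[OF 1(1,2) 2(1,2) 1(3) 2(3)] half[OF 2(2,1) 1(2,1) 2(4) 1(4)] by blast
qed

end

section \<open>Cotorsion pairs and approximations\<close>

definition left_orth :: "('o, 'm, 'e) add_cat_scheme \<Rightarrow> 'o set \<Rightarrow> 'o set" where
  "left_orth C Y = {A \<in> Ob C. \<forall>B \<in> Y. ext_orth C A B}"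

definition right_orth :: "('o, 'm, 'e) add_cat_scheme \<Rightarrow> 'o set \<Rightarrow> 'o set" where
  "right_orth C X = {B \<in> Ob C. \<forall>A \<in> X. ext_orth C A B}"

text \<open>Quantifying over all sequences with projective middle term avoids the chosen
  \<open>Omega_inv\<close>; for classes closed under stable isomorphism the two formulations
  agree.\<close>

definition cosyzygy_closed :: "('o, 'm, 'e) add_cat_scheme \<Rightarrow> 'o set \<Rightarrow> bool" where
  "cosyzygy_closed C X \<longleftrightarrow>
     (\<forall>i p. short_exact C i p \<and> Cod C i \<in> Proj C \<and> Dom C i \<in> X \<longrightarrow> Cod C p \<in> X)"

definition syzygy_closed :: "('o, 'm, 'e) add_cat_scheme \<Rightarrow> 'o set \<Rightarrow> bool" where
  "syzygy_closed C X \<longleftrightarrow>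
     (\<forall>i p. short_exact C i p \<and> Cod C i \<in> Proj C \<and> Cod C p \<in> X \<longrightarrow> Dom C i \<in> X)"

text \<open>Splitting of stable idempotents on representatives, a form that dualises without forming
  the stable category of \<open>op C\<close>.\<close>

definition split_stably :: "('o, 'm, 'e) add_cat_scheme \<Rightarrow> bool" where
  "split_stably C \<longleftrightarrow> (\<forall>A \<in> Ob C. \<forall>e \<in> Hom C A A. stab C (e \<cdot>\<^bsub>C\<^esub> e) e \<longrightarrow>
     (\<exists>B \<in> Ob C. \<exists>p \<in> Hom C A B. \<exists>i \<in> Hom C B A. stab C (i \<cdot>\<^bsub>C\<^esub> p) e \<and> stab C (p \<cdot>\<^bsub>C\<^esub> i) (Id C B)))"

definition special_pair :: "('o, 'm, 'e) add_cat_scheme \<Rightarrow> 'o set \<Rightarrow> 'o set \<Rightarrow> bool" where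
  "special_pair C X Y \<longleftrightarrow> Y = right_orth C X \<and> X = left_orth C Y \<and> (\<forall>A \<in> Ob C.
     (\<exists>i p. short_exact C i p \<and> Dom C i \<in> Y \<and> Cod C i \<in> X \<and> Cod C p = A) \<and>
     (\<exists>i p. short_exact C i p \<and> Dom C i = A \<and> Cod C i \<in> Y \<and> Cod C p \<in> X))"

context abelian_category
begin

text \<open>The content is that the split extensions form exactly one equivalence class and that
  this class is inhabited, by a biproduct; with no extension at all the quotient would be empty
  rather than a singleton.\<close>

lemma Ext1_zero_iff:
  assumes A: "A \<in> Ob C" and B: "B \<in> Ob C"
  shows "Ext1 C A B = {Ext1_zero C A B} \<longleftrightarrow> ext_orth C A B"
proof -
  let ?X = "extensions C A B"
  let ?R = "ext_equiv C A B"
  note [simp] = A B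
  have refl: "((i, p), (i, p)) \<in> ?R" if "(i, p) \<in> ?X" for i p
  proof -
    have ip: "short_exact C i p" "Dom C i = B" "Cod C p = A" using that by (auto simp: extensions_def)
    note [simp] = short_exactD[OF ip(1)]
    have "is_iso C (Id C (Cod C i))" unfolding is_iso_def by (auto intro!: bexI[of _ "Id C (Cod C i)"] simp: Hom_iff)
    then show ?thesis using that unfolding ext_equiv_def
      by (auto intro!: bexI[of _ "Id C (Cod C i)"] simp: Hom_iff)
  qed
  have zero_class: "?R `` {(i, p)} = Ext1_zero C A B" if ip: "(i, p) \<in> Ext1_zero C A B" for i p
  proof -
    have 1: "short_exact C i p" "Dom C i = B" "Cod C p = A"
      using ip by (auto simp: extensions_def Ext1_zero_def)
    note [simp] = short_exactD[OF 1(1)] 1(2,3)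
    obtain s where s: "s \<in> Hom C A (Cod C i)" "p \<cdot> s = Id C A" using ip by (auto simp: Ext1_zero_def)
    note [simp] = s(1)[unfolded Hom_iff] s(2) comp_reassoc[OF s(2)]
    have "(i', p') \<in> Ext1_zero C A B" if R: "((i, p), i', p') \<in> ?R" for i' p'
    proof -
      obtain h where h: "h \<in> Hom C (Cod C i) (Cod C i')" "h \<cdot> i = i'" "p' \<cdot> h = p"
        and ip': "(i', p') \<in> ?X" using R by (auto simp: ext_equiv_def)
      from ip' have 2: "short_exact C i' p'" "Dom C i' = B" "Cod C p' = A" by (auto simp: extensions_def)
      note [simp] = short_exactD[OF 2(1)] h(1)[unfolded Hom_iff]
      have "p' \<cdot> (h \<cdot> s) = Id C A" using comp_reassoc[OF h(3), of s] by simp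
      then show ?thesis using ip' unfolding Ext1_zero_def
        by (auto intro!: bexI[of _ "h \<cdot> s"] simp: Hom_iff)
    qed
    moreover have "((i, p), i', p') \<in> ?R" if *: "(i', p') \<in> Ext1_zero C A B" for i' p'
    proof -
      have 2: "short_exact C i' p'" "Dom C i' = B" "Cod C p' = A"
        using * by (auto simp: extensions_def Ext1_zero_def)
      note [simp] = short_exactD[OF 2(1)] 2(2,3)
      obtain s' where s': "s' \<in> Hom C A (Cod C i')" "p' \<cdot> s' = Id C A"
        using * by (auto simp: Ext1_zero_def)
      note [simp] = s'(1)[unfolded Hom_iff] s'(2) comp_reassoc[OF s'(2)]
      obtain r where r: "r \<in> Hom C (Cod C i) B" "r \<cdot> i = Id C B" "i \<cdot> r \<boxplus> s \<cdot> p = Id C (Cod C i)"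
        "r \<cdot> s = Zero C A B"
        using split_retraction[OF 1(1), of s] s by auto
      obtain r' where r': "r' \<in> Hom C (Cod C i') B" "r' \<cdot> i' = Id C B"
        "i' \<cdot> r' \<boxplus> s' \<cdot> p' = Id C (Cod C i')" "r' \<cdot> s' = Zero C A B"
        using split_retraction[OF 2(1), of s'] s' by auto
      note [simp] = r(1)[unfolded Hom_iff] r'(1)[unfolded Hom_iff] r(2,4) r'(2,4)
        comp_reassoc[OF r(2)] comp_reassoc[OF r(4)] comp_reassoc[OF r'(2)] comp_reassoc[OF r'(4)]
        comp_reassoc[OF short_exactD(4)[OF 1(1)]] comp_reassoc[OF short_exactD(4)[OF 2(1)]]
      \<comment> \<open>The components of the first middle term, read off by \<open>r\<close> and
        \<open>p\<close>, are put into the second by \<open>i'\<close> and \<open>s'\<close>;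
        \<open>g\<close> goes back in the same way.\<close>
      define h where "h = i' \<cdot> r \<boxplus> s' \<cdot> p"
      define g where "g = i \<cdot> r' \<boxplus> s \<cdot> p'"
      have h: "h \<in> Hom C (Cod C i) (Cod C i')" "h \<cdot> i = i'" "p' \<cdot> h = p"
        unfolding h_def by (auto simp: Hom_iff)
      have g: "g \<in> Hom C (Cod C i') (Cod C i)" unfolding g_def by (auto simp: Hom_iff)
      have "g \<cdot> h = Id C (Cod C i)" unfolding g_def h_def using r(3) by simp
      moreover have "h \<cdot> g = Id C (Cod C i')" unfolding g_def h_def using r'(3) by simp
      ultimately have "is_iso C h" unfolding is_iso_def using h(1) g by (auto simp: Hom_iff)
      then show ?thesis unfolding ext_equiv_def
        using h ip * by (auto simp: Ext1_zero_def)
    qed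
    ultimately show ?thesis by auto
  qed
  obtain S where S: "is_biproduct C B A S" using biproducts[OF B A] by blast
  obtain i0 p0 s0 where "short_exact C i0 p0" "Dom C i0 = B" "Cod C i0 = S" "Cod C p0 = A" "s0 \<in> Hom C A S"
    "p0 \<cdot> s0 = Id C A" by (rule biproduct_ses[OF S])
  then have split: "(i0, p0) \<in> Ext1_zero C A B"
    unfolding Ext1_zero_def extensions_def using short_exactD(3)[of i0 p0] by auto
  show ?thesis
  proof
    assume E: "Ext1 C A B = {Ext1_zero C A B}"
    show "ext_orth C A B" unfolding ext_orth_def
    proof (intro conjI allI impI A B; elim conjE)
      fix i p assume ip: "short_exact C i p" "Dom C i = B" "Cod C p = A"
      then have "(i, p) \<in> ?X" by (simp add: extensions_def)
      then have "?R `` {(i, p)} \<in> Ext1 C A B" unfolding Ext1_def by (rule quotientI)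
      then have "(i, p) \<in> Ext1_zero C A B" using refl[OF \<open>(i, p) \<in> ?X\<close>] unfolding E by blast
      then show "\<exists>s\<in>Hom C A (Cod C i). p \<cdot> s = cat.Id C A"
        using short_exactD(3)[OF ip(1)] by (auto simp: Ext1_zero_def)
    qed
  next
    assume o: "ext_orth C A B"
    have "(i, p) \<in> Ext1_zero C A B" if "(i, p) \<in> ?X" for i p
      using o that short_exactD(3)[of i p] unfolding Ext1_zero_def ext_orth_def extensions_def by auto
    then have "?R `` {x} = Ext1_zero C A B" if "x \<in> ?X" for x
      using that zero_class by (cases x) auto
    moreover have "(i0, p0) \<in> ?X" using split by (simp add: Ext1_zero_def)
    ultimately show "Ext1 C A B = {Ext1_zero C A B}"
      unfolding Ext1_def quotient_def by auto
  qed
qed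

lemma complete_cotorsion_pair_iff: "complete_cotorsion_pair C X Y \<longleftrightarrow> special_pair C X Y"
proof -
  have D: "short_exact C i p \<Longrightarrow> Dom C p = Cod C i" for i p by auto
  have 1: "cotorsion_pair C X Y \<longleftrightarrow> Y = right_orth C X \<and> X = left_orth C Y"
  proof (cases "X \<subseteq> Ob C \<and> Y \<subseteq> Ob C")
    case True
    then have "{B \<in> Ob C. \<forall>A \<in> X. Ext1 C A B = {Ext1_zero C A B}} = right_orth C X"
      "{A \<in> Ob C. \<forall>B \<in> Y. Ext1 C A B = {Ext1_zero C A B}} = left_orth C Y"
      unfolding right_orth_def left_orth_def
      by (intro Collect_cong conj_cong ball_cong refl Ext1_zero_iff; blast)+
    then show ?thesis unfolding cotorsion_pair_def by simp
  next
    case False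
    then show ?thesis unfolding cotorsion_pair_def right_orth_def left_orth_def by blast
  qed
  have "(\<exists>i p. short_exact C i p \<and> Dom C i \<in> Y \<and> Dom C p \<in> X \<and> Cod C p = A) \<longleftrightarrow>
    (\<exists>i p. short_exact C i p \<and> Dom C i \<in> Y \<and> Cod C i \<in> X \<and> Cod C p = A)" for A
    using D by metis
  then show ?thesis unfolding complete_cotorsion_pair_def special_pair_def 1 by simp
qed

text \<open>The complement is the kernel of the split epimorphism \<open>r\<close>.\<close>

lemma split_epi_biproduct:
  assumes "s \<in> Hom C A S" "r \<in> Hom C S A" "r \<cdot> s = Id C A"
  obtains B where "is_biproduct C A B S"
proof -
  note [simp] = assms(1,2)[unfolded Hom_iff]
  have "is_epi C r"
  proof (rule epiI)
    fix x assume [simp]: "x \<in> Arr C" "Dom C x = Cod C r" and x: "x \<cdot> r = Zero C (Dom C r) (Cod C x)"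
    have [simp]: "A \<in> Ob C" "S \<in> Ob C" using Hom_Ob[OF assms(1)] by auto
    have "x = (x \<cdot> r) \<cdot> s" using assms(3) by simp
    also have "\<dots> = Zero C (Cod C r) (Cod C x)" unfolding x by simp
    finally show "x = Zero C (Cod C r) (Cod C x)" .
  qed simp
  then obtain k where k: "short_exact C k r" using epi_ses by blast
  have "is_biproduct C (Cod C r) (Dom C k) (Cod C k)"
    by (rule split_biproduct(2)[OF k, of s]) (use assms short_exactD[OF k] in \<open>auto simp: Hom_iff\<close>)
  then show thesis using that short_exactD(3)[OF k] by simp
qed

lemma isomorphicE:
  assumes "isomorphic C A B"
  obtains u v where "u \<in> Hom C A B" "v \<in> Hom C B A" "v \<cdot> u = Id C A" "u \<cdot> v = Id C B"
  using assms unfolding isomorphic_def is_iso_def Hom_def by force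

end

context frobenius_abelian_category
begin

section \<open>Orthogonal classes: duality and closure properties\<close>

lemma left_orth_op [simp]: "left_orth (op C) X = right_orth C X"
  and right_orth_op [simp]: "right_orth (op C) X = left_orth C X"
  by (simp_all add: left_orth_def right_orth_def)

lemma syzygy_closed_op [simp]: "cosyzygy_closed (op C) X = syzygy_closed C X"
proof -
  have "Dom C p = Cod C i" if "short_exact C i p" for i p using that by auto
  then show ?thesis unfolding cosyzygy_closed_def syzygy_closed_def op_short_exact op_simps op_Proj_Inj
      Proj_eq_Inj by (simp cong: conj_cong) blast
qed

lemma special_pair_op [simp]: "special_pair (op C) Y X = special_pair C X Y"
proof -
  have "Dom C p = Cod C i" if "short_exact C i p" for i p using that by auto
  then have
    "(\<exists>i p. short_exact C p i \<and> Cod C i \<in> X \<and> Dom C i \<in> Y \<and> Dom C p = A) \<longleftrightarrow>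
     (\<exists>i p. short_exact C i p \<and> Dom C i = A \<and> Cod C i \<in> Y \<and> Cod C p \<in> X)"
    "(\<exists>i p. short_exact C p i \<and> Cod C i = A \<and> Dom C i \<in> X \<and> Dom C p \<in> Y) \<longleftrightarrow>
     (\<exists>i p. short_exact C i p \<and> Dom C i \<in> Y \<and> Cod C i \<in> X \<and> Cod C p = A)" for A
    by metis+
  then show ?thesis
    unfolding special_pair_def left_orth_op right_orth_op op_short_exact op_simps
    by blast
qed

lemma split_stably_op: assumes "split_stably C" shows "split_stably (op C)"
  unfolding split_stably_def
proof (intro ballI impI)
  fix A e assume "A \<in> Ob (op C)" "e \<in> Hom (op C) A A" "stab (op C) (e \<cdot>\<^bsub>op C\<^esub> e) e"
  then obtain B p i where "B \<in> Ob C" "p \<in> Hom C A B" "i \<in> Hom C B A" "stab C (i \<cdot> p) e" "stab C (p \<cdot> i) (Id C B)"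
    using assms[unfolded split_stably_def, rule_format, of A e] by auto
  then show "\<exists>B\<in>Ob (op C). \<exists>p\<in>Hom (op C) A B. \<exists>i\<in>Hom (op C) B A.
     stab (op C) (i \<cdot>\<^bsub>op C\<^esub> p) e \<and> stab (op C) (p \<cdot>\<^bsub>op C\<^esub> i) (cat.Id (op C) B)"
    by (intro bexI[of _ B] bexI[of _ i] bexI[of _ p]) auto
qed

text \<open>Two closure properties of orthogonality suffice: stable retracts give summands and
  isomorphic objects, extensions give biproducts. The zero object belongs to the class because it is
  projective.\<close>

lemma left_orth_closure:
  assumes X: "X = left_orth C Y" and Y: "Y \<subseteq> Ob C"
  shows left_orth_Ob: "X \<subseteq> Ob C"
    and left_orth_retract: "A \<in> X \<Longrightarrow> stab_retract C A' A \<Longrightarrow> A' \<in> X"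
    and left_orth_Proj: "Proj C \<subseteq> X"
    and left_orth_extension: "extension_closed C X"
    and left_orth_summand: "summand_closed C X"
    and left_orth_additive: "additive_subcategory C X"
proof -
  show Ob: "X \<subseteq> Ob C" unfolding X left_orth_def by blast
  show retract: "A' \<in> X" if A: "A \<in> X" and r: "stab_retract C A' A" for A A'
  proof -
    have "A' \<in> Ob C" using r Hom_Ob unfolding stab_retract_def by blast
    then show ?thesis using A ext_orth_retract_left[OF _ r] unfolding X left_orth_def by blast
  qed
  show P: "Proj C \<subseteq> X" unfolding X left_orth_def using Y ext_orth_Proj by auto
  show ext: "extension_closed C X" unfolding extension_closed_def
    unfolding X left_orth_def using ext_orth_middle by (auto dest: short_exactD)
  have bi_retract: "stab_retract C A S" if bi: "is_biproduct C A B S" for A B S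
  proof -
    obtain i p where "i \<in> Hom C A S" "p \<in> Hom C S A" "p \<cdot> i = Id C A" "A \<in> Ob C"
      using bi unfolding is_biproduct_def by blast
    then show ?thesis unfolding stab_retract_def by (intro bexI[of _ i] bexI[of _ p]) simp_all
  qed
  then show "summand_closed C X" unfolding summand_closed_def using retract by blast
  have "B \<in> X" if A: "A \<in> X" and iso: "isomorphic C A B" for A B
  proof -
    obtain u v where "u \<in> Hom C A B" "v \<in> Hom C B A" "u \<cdot> v = Id C B" by (rule isomorphicE[OF iso])
    then have "stab_retract C B A" unfolding stab_retract_def
      by (intro bexI[of _ v] bexI[of _ u]) (auto simp: Hom_iff)
    then show ?thesis using retract A by blast
  qed
  moreover have "\<exists>Z \<in> X. is_zero_object C Z"
  proof -
    obtain Z where Z: "is_zero_object C Z" using zero_object by blast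
    have [simp]: "Z \<in> Ob C" using Z by (simp add: is_zero_object_def)
    have "Z \<in> Proj C" unfolding Proj_def
    proof (intro CollectI conjI allI impI ballI)
      fix e f assume e: "is_epi C e" and f: "f \<in> Hom C Z (Cod C e)"
      then have [simp]: "e \<in> Arr C" by (simp add: is_epi_def)
      have "e \<cdot> Zero C Z (Dom C e) \<in> Hom C Z (Cod C e)" by (simp add: Hom_iff)
      then have "e \<cdot> Zero C Z (Dom C e) = f"
        using Z f Hom_Ob[OF f] unfolding is_zero_object_def by blast
      then show "\<exists>g\<in>Hom C Z (Dom C e). e \<cdot> g = f"
        by (intro bexI[of _ "Zero C Z (Dom C e)"]) (simp_all add: Hom_iff)
    qed simp
    then show ?thesis using P Z by blast
  qed
  moreover have "S \<in> X" if "A \<in> X" "B \<in> X" and S: "is_biproduct C A B S" for A B S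
  proof -
    obtain i p s where "short_exact C i p" "Dom C i = A" "Cod C i = S" "Cod C p = B"
      by (rule biproduct_ses[OF S]) blast
    then show ?thesis using ext that(1,2) unfolding extension_closed_def by blast
  qed
  ultimately show "additive_subcategory C X"
    unfolding additive_subcategory_def subcategory_def using Ob by blast
qed

text \<open>Embed \<open>Dom C i\<close> in an injective: its cosyzygy lies in \<open>X\<close>, and
  \<open>ext_orth_third\<close> carries orthogonality from this cosyzygy and from
  \<open>Cod C i\<close> over to the cokernel.\<close>

lemma left_orth_coresolving:
  assumes X: "X = left_orth C Y" and Y: "Y \<subseteq> Ob C" and c: "cosyzygy_closed C X"
  shows "coresolving C X"
proof -
  have "Cod C p \<in> X" if "is_mono C i" "is_cokernel C p i" and iX: "Dom C i \<in> X" "Cod C i \<in> X" for p i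
  proof -
    have ses: "short_exact C i p" using mono_cokernel_ses that by blast
    obtain j r where jr: "short_exact C j r" "Dom C j = Dom C i" "Cod C j \<in> Proj C"
      using enough_inj_ses[of "Dom C i"] iX left_orth_Ob[OF X Y] by blast
    have "Cod C r \<in> X" using jr c iX unfolding cosyzygy_closed_def by metis
    then show ?thesis using iX ext_orth_third[OF ses jr] ses unfolding X left_orth_def
      by (auto dest: short_exactD)
  qed
  then show ?thesis unfolding coresolving_def
    using left_orth_closure[OF X Y] Proj_eq_Inj by blast
qed

text \<open>If \<open>v u - 1 = b a\<close> with \<open>a\<close> and \<open>b\<close> through a
  projective \<open>P\<close>, then \<open>(v, -b)\<close> after \<open>(u, a)\<close> is strictly
  the identity, so \<open>A\<close> is a direct summand of the biproduct of \<open>U\<close> and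
  \<open>P\<close>.\<close>

lemma coresolving_stab_retract:
  assumes X: "coresolving C X" "summand_closed C X" and U: "U \<in> X" and r: "stab_retract C A U"
  shows "A \<in> X"
proof -
  obtain u v where u: "u \<in> Hom C A U" and v: "v \<in> Hom C U A" and vu: "stab C (v \<cdot> u) (Id C A)"
    using r unfolding stab_retract_def by blast
  note [simp] = u[unfolded Hom_iff] v[unfolded Hom_iff]
  have [simp]: "A \<in> Ob C" "U \<in> Ob C" using Hom_Ob[OF u] by auto
  have D: "Dom C (v \<cdot> u \<boxminus> Id C A) = A" "Cod C (v \<cdot> u \<boxminus> Id C A) = A" by simp_all
  obtain P a b where P: "P \<in> Proj C" and a: "a \<in> Hom C A P" and b: "b \<in> Hom C P A"
    and ba: "v \<cdot> u \<boxminus> Id C A = b \<cdot> a"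
    using nullE[OF stabD(5)[OF vu], unfolded D] .
  note [simp] = a[unfolded Hom_iff] b[unfolded Hom_iff] Proj_Ob[OF P]
  obtain S i j p q where S: "is_biproduct C U P S"
    and h: "i \<in> Hom C U S" "j \<in> Hom C P S" "p \<in> Hom C S U" "q \<in> Hom C S P"
    and e: "p \<cdot> i = Id C U" "q \<cdot> j = Id C P" "p \<cdot> j = Zero C P U" "q \<cdot> i = Zero C U P"
    by (rule biproductE[of U P]) auto
  note [simp] = h[unfolded Hom_iff] comp_reassoc[OF e(1)] comp_reassoc[OF e(2)]
    comp_reassoc[OF e(3)] comp_reassoc[OF e(4)]
  have SX: "S \<in> X" using X(1) S U P Proj_eq_Inj unfolding coresolving_def additive_subcategory_def by blast
  have "(v \<cdot> p \<boxminus> b \<cdot> q) \<cdot> (i \<cdot> u \<boxplus> j \<cdot> a) = v \<cdot> u \<boxminus> (v \<cdot> u \<boxminus> Id C A)"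
    unfolding ba by simp
  also have "\<dots> = Id C A" by simp
  finally obtain B where "is_biproduct C A B S"
    by (rule split_epi_biproduct[rotated 2]) (simp_all add: Hom_iff)
  then show ?thesis using X(2) SX unfolding summand_closed_def by blast
qed

section \<open>Precovers, stable coreflections and special precovers\<close>

lemma coresolving_cosyzygy:
  assumes "coresolving C X" shows "cosyzygy_closed C X"
  using assms short_exact_mono_epi(1) Proj_eq_Inj
  unfolding coresolving_def cosyzygy_closed_def short_exact_def by blast

text \<open>An epimorphism onto \<open>A\<close> from a projective is added to \<open>f\<close> as a
  second component. The result is epic, so it has a kernel sequence, and stably nothing changes:
  \<open>i\<close> and \<open>p\<close> are mutually inverse stable isomorphisms between
  \<open>U\<close> and \<open>S\<close>.\<close>

lemma epification:
  assumes f: "f \<in> Hom C U A"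
  obtains S P i p g where "is_biproduct C U P S" "P \<in> Proj C" "i \<in> Hom C U S" "p \<in> Hom C S U"
    "p \<cdot> i = Id C U" "stab C (i \<cdot> p) (Id C S)" "g \<in> Hom C S A" "is_epi C g" "g \<cdot> i = f"
proof -
  note [simp] = f[unfolded Hom_iff]
  have [simp]: "U \<in> Ob C" "A \<in> Ob C" using Hom_Ob[OF f] by auto
  obtain \<pi> where \<pi>: "is_epi C \<pi>" "Cod C \<pi> = A" "Dom C \<pi> \<in> Proj C" using enough_proj[of A] by auto
  have [simp]: "\<pi> \<in> Arr C" using \<pi>(1) by (simp add: is_epi_def)
  note [simp] = \<pi>(2)
  obtain S i j p q where S: "is_biproduct C U (Dom C \<pi>) S"
    and h: "i \<in> Hom C U S" "j \<in> Hom C (Dom C \<pi>) S" "p \<in> Hom C S U" "q \<in> Hom C S (Dom C \<pi>)"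
    and e: "p \<cdot> i = Id C U" "q \<cdot> j = Id C (Dom C \<pi>)" "p \<cdot> j = Zero C (Dom C \<pi>) U"
      "q \<cdot> i = Zero C U (Dom C \<pi>)"
    and sum: "i \<cdot> p \<boxplus> j \<cdot> q = Id C S"
    by (rule biproductE[of U "Dom C \<pi>"]) auto
  note [simp] = h[unfolded Hom_iff] e comp_reassoc[OF e(1)] comp_reassoc[OF e(2)]
    comp_reassoc[OF e(3)] comp_reassoc[OF e(4)]
  define g where "g = f \<cdot> p \<boxplus> \<pi> \<cdot> q"
  have g: "g \<in> Hom C S A" "g \<cdot> i = f" "g \<cdot> j = \<pi>" by (simp_all add: g_def Hom_iff)
  note [simp] = g(1)[unfolded Hom_iff]
  have "is_epi C g"
  proof (rule epiI)
    fix x assume [simp]: "x \<in> Arr C" "Dom C x = Cod C g" and x: "x \<cdot> g = Zero C (Dom C g) (Cod C x)"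
    have [simp]: "S \<in> Ob C" using S by (simp add: is_biproduct_def)
    have "x \<cdot> \<pi> = (x \<cdot> g) \<cdot> j" using g(3) by simp
    also have "\<dots> = Zero C A (Cod C x) \<cdot> \<pi>" unfolding x by simp
    finally show "x = Zero C (Cod C g) (Cod C x)"
      using epi_cancel[OF \<pi>(1), of x "Zero C A (Cod C x)"] by simp
  qed simp
  moreover have "stab C (i \<cdot> p) (Id C S)"
  proof -
    have "null C (j \<cdot> q)" by (rule nullI[OF \<pi>(3) h(4) h(2)])
    then have "stab C (i \<cdot> p \<boxplus> j \<cdot> q) (i \<cdot> p)" by (intro stab_add_null) simp_all
    then show ?thesis unfolding sum by (rule stab_sym)
  qed
  ultimately show thesis using that[OF S \<pi>(3) h(1,3) e(1)] g by blast
qed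

lemma coresolving_biproduct_Proj:
  "coresolving C X \<Longrightarrow> is_biproduct C U P S \<Longrightarrow> U \<in> X \<Longrightarrow> P \<in> Proj C \<Longrightarrow> S \<in> X"
  using Proj_eq_Inj unfolding coresolving_def additive_subcategory_def by blast

lemma epi_precover:
  assumes X: "precovering C X" "coresolving C X" and A: "A \<in> Ob C"
  obtains k f where "short_exact C k f" "Cod C k \<in> X" "Cod C f = A"
    "\<And>T x. T \<in> X \<Longrightarrow> x \<in> Hom C T A \<Longrightarrow> \<exists>y \<in> Hom C T (Cod C k). f \<cdot> y = x"
proof -
  obtain f0 where "is_precover C X A f0" using X(1) A unfolding precovering_def by blast
  then obtain U0 where U0: "U0 \<in> X" and f0h: "f0 \<in> Hom C U0 A"
    and f0: "\<And>T x. T \<in> X \<Longrightarrow> x \<in> Hom C T A \<Longrightarrow> \<exists>y \<in> Hom C T U0. f0 \<cdot> y = x"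
    unfolding is_precover_def by (auto simp: Hom_iff)
  obtain S P i p g where S: "is_biproduct C U0 P S" "P \<in> Proj C" "i \<in> Hom C U0 S"
    "g \<in> Hom C S A" "is_epi C g" "g \<cdot> i = f0"
    by (rule epification[OF f0h]) blast
  have SX: "S \<in> X" using coresolving_biproduct_Proj[OF X(2) S(1) U0 S(2)] .
  note [simp] = S(3,4)[unfolded Hom_iff] f0h[unfolded Hom_iff]
  obtain k where k: "short_exact C k g" using epi_ses S(5) by blast
  have [simp]: "Cod C k = S" using short_exactD(3)[OF k] by simp
  show thesis
  proof (rule that[OF k])
    fix T x assume "T \<in> X" "x \<in> Hom C T A"
    then obtain y where y: "y \<in> Hom C T U0" "f0 \<cdot> y = x" using f0 by blast
    note [simp] = y(1)[unfolded Hom_iff]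
    have "g \<cdot> (i \<cdot> y) = x" using comp_reassoc[OF S(6), of y] y(2) by simp
    then show "\<exists>y\<in>Hom C T (Cod C k). g \<cdot> y = x" by (intro bexI[of _ "i \<cdot> y"]) (simp_all add: Hom_iff)
  qed (use SX in simp_all)
qed

text \<open>The precover is corrected to a stable coreflection: the failure of uniqueness is measured by
  a stable idempotent on an extension of the precover, and it disappears after splitting it.\<close>

lemma stable_coreflection:
  assumes split: "split_stably C" and X: "precovering C X" "coresolving C X" "summand_closed C X"
    and A: "A \<in> Ob C"
  obtains c g where "c \<in> X" "g \<in> Hom C c A"
    "\<And>T x. T \<in> X \<Longrightarrow> x \<in> Hom C T A \<Longrightarrow> \<exists>y \<in> Hom C T c. stab C (g \<cdot> y) x"
    "\<And>T y. T \<in> X \<Longrightarrow> y \<in> Hom C T c \<Longrightarrow> null C (g \<cdot> y) \<Longrightarrow> null C y"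
proof -
  obtain k f where kf: "short_exact C k f" "Cod C k \<in> X" "Cod C f = A"
    and f: "\<And>T x. T \<in> X \<Longrightarrow> x \<in> Hom C T A \<Longrightarrow> \<exists>y \<in> Hom C T (Cod C k). f \<cdot> y = x"
    by (rule epi_precover[OF X(1,2) A]) blast
  note [simp] = A short_exactD[OF kf(1)] kf(3)
  define U where "U = Cod C k"
  note [simp] = U_def[symmetric]
  have UX: "U \<in> X" and [simp]: "U \<in> Ob C" using kf(2) Cod_in[of k] by simp_all
  \<comment> \<open>A second precover, of the kernel of \<open>f\<close>: every map from an object
    of \<open>X\<close> to \<open>U\<close> that \<open>f\<close> kills factors through
    \<open>\<alpha> = k f'\<close>.\<close>
  obtain k' f' where kf': "short_exact C k' f'" "Cod C k' \<in> X" "Cod C f' = Dom C k"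
    and f': "\<And>T x. T \<in> X \<Longrightarrow> x \<in> Hom C T (Dom C k) \<Longrightarrow> \<exists>y \<in> Hom C T (Cod C k'). f' \<cdot> y = x"
    by (rule epi_precover[OF X(1,2), of "Dom C k"]) auto
  note [simp] = short_exactD[OF kf'(1)] kf'(3)
  define U' where "U' = Cod C k'"
  note [simp] = U'_def[symmetric]
  have [simp]: "U' \<in> Ob C" using Cod_in[of k'] by simp
  define \<alpha> where "\<alpha> = k \<cdot> f'"
  have \<alpha>h: "\<alpha> \<in> Hom C U' U" by (simp add: \<alpha>_def Hom_iff)
  note [simp] = \<alpha>h[unfolded Hom_iff]
  have f\<alpha>: "f \<cdot> \<alpha> = Zero C U' A"
    using comp_reassoc[OF short_exactD(4)[OF kf(1)], of f'] by (simp add: \<alpha>_def)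
  obtain \<iota> \<pi> where \<iota>: "short_exact C \<iota> \<pi>" "Dom C \<iota> = U'" "Cod C \<iota> \<in> Proj C"
    using enough_inj_ses[of U'] by auto
  note [simp] = short_exactD[OF \<iota>(1)] \<iota>(2)
  have \<alpha>h': "\<alpha> \<in> Hom C (Dom C \<iota>) U" by (simp add: Hom_iff)
  \<comment> \<open>The cone of \<open>\<alpha>\<close>: pushing out along an injective embedding of
    \<open>U'\<close> makes \<open>\<beta> \<alpha>\<close> null, and its object \<open>c\<close>,
    an extension of a cosyzygy of \<open>U'\<close> by \<open>U\<close>, stays in
    \<open>X\<close>.\<close>
  obtain \<beta> q t where \<beta>q: "short_exact C \<beta> q" "Dom C \<beta> = U" "Cod C q = Cod C \<pi>"
    and t: "t \<in> Hom C (Cod C \<iota>) (Cod C \<beta>)" "t \<cdot> \<iota> = \<beta> \<cdot> \<alpha>"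
    and univ: "\<And>T b m. b \<in> Hom C U T \<Longrightarrow> m \<in> Hom C (Cod C \<iota>) T \<Longrightarrow> m \<cdot> \<iota> = b \<cdot> \<alpha>
      \<Longrightarrow> \<exists>e \<in> Hom C (Cod C \<beta>) T. e \<cdot> \<beta> = b \<and> e \<cdot> t = m"
    by (rule pushout[OF \<iota>(1) \<alpha>h']) blast
  note [simp] = short_exactD[OF \<beta>q(1)] \<beta>q(2,3) t(1)[unfolded Hom_iff]
  define c where "c = Cod C \<beta>"
  note [simp] = c_def[symmetric]
  have [simp]: "c \<in> Ob C" using Cod_in[of \<beta>] by simp
  have "Cod C \<pi> \<in> X"
    using coresolving_cosyzygy[OF X(2)] \<iota> kf'(2) unfolding cosyzygy_closed_def U'_def by metis
  then have cX: "c \<in> X" using X(2) \<beta>q UX c_def unfolding coresolving_def extension_closed_def by metis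
  \<comment> \<open>Since \<open>f \<alpha> = 0\<close>, the precover extends to the cone, with
    value zero on the injective.\<close>
  have "\<exists>e \<in> Hom C (Cod C \<beta>) A. e \<cdot> \<beta> = f \<and> e \<cdot> t = Zero C (Cod C \<iota>) A"
    by (rule univ) (use A f\<alpha> in \<open>simp_all add: Hom_iff\<close>)
  then obtain g where g: "g \<in> Hom C c A" "g \<cdot> \<beta> = f" by auto
  note [simp] = g(1)[unfolded Hom_iff]
  \<comment> \<open>As \<open>c\<close> lies in \<open>X\<close>, \<open>g\<close> lifts back along
    \<open>f\<close>. From \<open>f (1 - h \<beta>) = 0\<close> one gets
    \<open>1 - h \<beta> = \<alpha> \<gamma>\<close>, which \<open>\<beta>\<close> turns into a null
    map; so \<open>\<beta> h\<close> is a stable idempotent on \<open>c\<close>.\<close>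
  obtain h where h: "h \<in> Hom C c U" "f \<cdot> h = g" using f[OF cX g(1)] by auto
  note [simp] = h(1)[unfolded Hom_iff]
  have "f \<cdot> Id C U = f \<cdot> (h \<cdot> \<beta>)" using comp_reassoc[OF h(2), of \<beta>] g(2) by simp
  then obtain z where z: "z \<in> Hom C U (Dom C k)" "k \<cdot> z = Id C U \<boxminus> h \<cdot> \<beta>"
    using ses_lift_diff[OF kf(1), of "Id C U" "h \<cdot> \<beta>"] by auto
  note [simp] = z(1)[unfolded Hom_iff]
  obtain \<gamma> where \<gamma>: "\<gamma> \<in> Hom C U U'" "f' \<cdot> \<gamma> = z" using f'[OF UX z(1)] by auto
  note [simp] = \<gamma>(1)[unfolded Hom_iff]
  have \<alpha>\<gamma>: "\<alpha> \<cdot> \<gamma> = Id C U \<boxminus> h \<cdot> \<beta>" by (simp add: \<alpha>_def \<gamma>(2) z(2))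
  have null_\<beta>\<alpha>: "null C (\<beta> \<cdot> (\<alpha> \<cdot> x))" if "x \<in> Arr C" "Cod C x = U'" for x
  proof -
    have "\<beta> \<cdot> (\<alpha> \<cdot> x) = t \<cdot> (\<iota> \<cdot> x)" using comp_reassoc[OF t(2), of x] that by simp
    moreover have "null C (t \<cdot> (\<iota> \<cdot> x))"
      by (rule nullI[OF \<iota>(3)]) (use that in \<open>simp_all add: Hom_iff\<close>)
    ultimately show ?thesis by simp
  qed
  have "null C (\<beta> \<boxminus> \<beta> \<cdot> (h \<cdot> \<beta>))" using null_\<beta>\<alpha>[of \<gamma>] by (simp add: \<alpha>\<gamma>)
  then have \<beta>h\<beta>: "stab C (\<beta> \<cdot> (h \<cdot> \<beta>)) \<beta>" by (intro stab_sym[of \<beta>]) (simp add: stab_def)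
  define e where "e = \<beta> \<cdot> h"
  have eh: "e \<in> Hom C c c" by (simp add: e_def Hom_iff)
  have "stab C ((\<beta> \<cdot> (h \<cdot> \<beta>)) \<cdot> h) (\<beta> \<cdot> h)" by (rule stab_comp(2)[OF \<beta>h\<beta>]) simp_all
  then have "stab C (e \<cdot> e) e" by (simp add: e_def)
  then obtain c0 p i where c0 [simp]: "c0 \<in> Ob C" and p: "p \<in> Hom C c c0" and i: "i \<in> Hom C c0 c"
    and ip: "stab C (i \<cdot> p) e" and pi: "stab C (p \<cdot> i) (Id C c0)"
    using split eh unfolding split_stably_def by (metis \<open>c \<in> Ob C\<close>)
  note [simp] = p[unfolded Hom_iff] i[unfolded Hom_iff]
  have c0X: "c0 \<in> X"
    by (rule coresolving_stab_retract[OF X(2,3) cX]) (use p i pi in \<open>auto simp: stab_retract_def\<close>)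
  have gih: "g \<cdot> i \<in> Hom C c0 A" by (simp add: Hom_iff)
  show thesis
  proof (rule that[OF c0X gih])
    fix T x assume T: "T \<in> X" and x: "x \<in> Hom C T A"
    note [simp] = x[unfolded Hom_iff]
    obtain y where y: "y \<in> Hom C T U" "f \<cdot> y = x" using f[OF T x] by auto
    note [simp] = y(1)[unfolded Hom_iff]
    have "stab C (g \<cdot> ((i \<cdot> p) \<cdot> (\<beta> \<cdot> y))) (g \<cdot> (e \<cdot> (\<beta> \<cdot> y)))"
      by (intro stab_comp ip) simp_all
    moreover have "g \<cdot> (e \<cdot> (\<beta> \<cdot> y)) = x"
    proof -
      have "g \<cdot> (e \<cdot> (\<beta> \<cdot> y)) = f \<cdot> (h \<cdot> (\<beta> \<cdot> y))"
        using comp_reassoc[OF g(2), of "h \<cdot> (\<beta> \<cdot> y)"] by (simp add: e_def)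
      also have "\<dots> = f \<cdot> y"
        using comp_reassoc[OF h(2), of "\<beta> \<cdot> y"] comp_reassoc[OF g(2), of y] by simp
      finally show ?thesis using y(2) by simp
    qed
    ultimately show "\<exists>y\<in>Hom C T c0. stab C (g \<cdot> i \<cdot> y) x"
      by (intro bexI[of _ "p \<cdot> (\<beta> \<cdot> y)"]) (simp_all add: Hom_iff)
  next
    fix T y assume T: "T \<in> X" and y: "y \<in> Hom C T c0" and n: "null C (g \<cdot> i \<cdot> y)"
    note [simp] = y[unfolded Hom_iff]
    have fhiy: "f \<cdot> (h \<cdot> (i \<cdot> y)) = g \<cdot> i \<cdot> y"
      using comp_reassoc[OF h(2), of "i \<cdot> y"] by simp
    obtain m where m: "m \<in> Hom C T U" "null C m" "f \<cdot> m = g \<cdot> i \<cdot> y"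
      using null_lift[OF n kf(1)] by auto
    note [simp] = m(1)[unfolded Hom_iff]
    \<comment> \<open>The same mechanism gives uniqueness: two maps equal after \<open>f\<close>
      differ by a map through \<open>\<alpha>\<close>, which \<open>\<beta>\<close> makes null. So
      \<open>e\<close> stably annihilates \<open>i y\<close>, and as \<open>i\<close>,
      \<open>p\<close> split \<open>e\<close>, \<open>y\<close> itself is null.\<close>
    have "f \<cdot> (h \<cdot> (i \<cdot> y)) = f \<cdot> m" using fhiy m(3) by metis
    then obtain z' where z': "z' \<in> Hom C T (Dom C k)" "k \<cdot> z' = h \<cdot> (i \<cdot> y) \<boxminus> m"
      using ses_lift_diff[OF kf(1), of "h \<cdot> (i \<cdot> y)" m] by auto
    note [simp] = z'(1)[unfolded Hom_iff]
    obtain \<delta> where \<delta>: "\<delta> \<in> Hom C T U'" "f' \<cdot> \<delta> = z'" using f'[OF T z'(1)] by auto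
    note [simp] = \<delta>(1)[unfolded Hom_iff]
    have "\<alpha> \<cdot> \<delta> = h \<cdot> (i \<cdot> y) \<boxminus> m" by (simp add: \<alpha>_def \<delta>(2) z'(2))
    then have "null C (\<beta> \<cdot> (h \<cdot> (i \<cdot> y)) \<boxminus> \<beta> \<cdot> m)" using null_\<beta>\<alpha>[of \<delta>] by simp
    then have "stab C (\<beta> \<cdot> (h \<cdot> (i \<cdot> y))) (\<beta> \<cdot> m)" by (simp add: stab_def)
    moreover have "null C (\<beta> \<cdot> m)" using null_comp(1)[OF m(2), of \<beta>] by simp
    ultimately have "null C (\<beta> \<cdot> (h \<cdot> (i \<cdot> y)))" by (rule null_cong)
    then have "null C (e \<cdot> (i \<cdot> y))" by (simp add: e_def)
    moreover have "stab C ((i \<cdot> p) \<cdot> (i \<cdot> y)) (e \<cdot> (i \<cdot> y))" by (rule stab_comp(2)[OF ip]) simp_all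
    ultimately have "null C ((i \<cdot> p) \<cdot> (i \<cdot> y))" using null_cong by blast
    then have n2: "null C (p \<cdot> ((i \<cdot> p) \<cdot> (i \<cdot> y)))" by (rule null_comp(1)) simp_all
    have "stab C ((p \<cdot> i) \<cdot> (p \<cdot> (i \<cdot> y))) (Id C c0 \<cdot> (p \<cdot> (i \<cdot> y)))"
      by (rule stab_comp(2)[OF pi]) simp_all
    then have "stab C (p \<cdot> ((i \<cdot> p) \<cdot> (i \<cdot> y))) (p \<cdot> (i \<cdot> y))" by simp
    then have n3: "null C (p \<cdot> (i \<cdot> y))" using null_cong stab_sym n2 by blast
    have "stab C ((p \<cdot> i) \<cdot> y) (Id C c0 \<cdot> y)" by (rule stab_comp(2)[OF pi]) simp_all
    then show "null C y" using null_cong stab_sym n3 by force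
  qed
qed

text \<open>Wakamatsu's argument: the middle term \<open>E\<close> of the pushout extension lies in \<open>X\<close>, so the coreflection
  provides a retraction of \<open>j\<close>, and extending \<open>r\<close> becomes a lifting problem along \<open>g\<close>.\<close>

lemma special_precover:
  assumes split: "split_stably C" and X: "precovering C X" "coresolving C X" "summand_closed C X"
    and A: "A \<in> Ob C"
  obtains k g where "short_exact C k g" "Cod C k \<in> X" "Cod C g = A" "Dom C k \<in> right_orth C X"
proof -
  obtain c g1 where c: "c \<in> X" and g1: "g1 \<in> Hom C c A"
    and surj1: "\<And>T x. T \<in> X \<Longrightarrow> x \<in> Hom C T A \<Longrightarrow> \<exists>y \<in> Hom C T c. stab C (g1 \<cdot> y) x"
    and inj1: "\<And>T y. T \<in> X \<Longrightarrow> y \<in> Hom C T c \<Longrightarrow> null C (g1 \<cdot> y) \<Longrightarrow> null C y"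
    by (rule stable_coreflection[OF split X A]) blast
  obtain S P i p g where S: "is_biproduct C c P S" "P \<in> Proj C" "i \<in> Hom C c S" "p \<in> Hom C S c"
    "p \<cdot> i = Id C c" "stab C (i \<cdot> p) (Id C S)" "g \<in> Hom C S A" "is_epi C g" "g \<cdot> i = g1"
    by (rule epification[OF g1])
  have SX: "S \<in> X" using coresolving_biproduct_Proj[OF X(2) S(1) c S(2)] .
  note [simp] = g1[unfolded Hom_iff] S(3,4,7)[unfolded Hom_iff] A
  have [simp]: "S \<in> Ob C" "c \<in> Ob C" using S(1) by (auto simp: is_biproduct_def)
  obtain k where k: "short_exact C k g" using epi_ses S(8) by blast
  note [simp] = short_exactD(1,2,4)[OF k]
  have [simp]: "Cod C k = S" using short_exactD(3)[OF k] by simp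
  \<comment> \<open>The coreflection lifts \<open>x\<close> only up to a null map; that error lifts
    along the epimorphism \<open>g\<close>, so lifting becomes strict.\<close>
  have surj: "\<exists>y \<in> Hom C T S. g \<cdot> y = x" if T: "T \<in> X" and x: "x \<in> Hom C T A" for T x
  proof -
    note [simp] = x[unfolded Hom_iff]
    obtain y where y: "y \<in> Hom C T c" "stab C (g1 \<cdot> y) x" using surj1[OF T x] by blast
    note [simp] = y(1)[unfolded Hom_iff]
    have gi: "g \<cdot> (i \<cdot> y) = g1 \<cdot> y" using comp_reassoc[OF S(9), of y] by simp
    have "null C (x \<boxminus> g1 \<cdot> y)" using stabD(5)[OF stab_sym[OF y(2)]] .
    then obtain l where l: "l \<in> Hom C T S" "g \<cdot> l = x \<boxminus> g1 \<cdot> y"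
      using null_lift[OF _ k, of "x \<boxminus> g1 \<cdot> y"] by auto
    note [simp] = l(1)[unfolded Hom_iff]
    have "g \<cdot> (i \<cdot> y \<boxplus> l) = x" using add_minus_cancel(1)[of x "g1 \<cdot> y"] by (simp add: l(2) gi)
    then show ?thesis by (intro bexI[of _ "i \<cdot> y \<boxplus> l"]) (simp_all add: Hom_iff)
  qed
  \<comment> \<open>Uniqueness for \<open>c\<close> carries over to \<open>S\<close> because
    \<open>i p\<close> is stably the identity of \<open>S\<close>.\<close>
  have inj: "null C y" if T: "T \<in> X" and y: "y \<in> Hom C T S" and n: "null C (g \<cdot> y)" for T y
  proof -
    note [simp] = y[unfolded Hom_iff]
    have s: "stab C ((i \<cdot> p) \<cdot> y) (Id C S \<cdot> y)" by (rule stab_comp(2)[OF S(6)]) simp_all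
    then have "stab C (g \<cdot> (i \<cdot> (p \<cdot> y))) (g \<cdot> y)" using stab_comp(1)[OF s, of g] by simp
    then have "null C (g1 \<cdot> (p \<cdot> y))" using null_cong n comp_reassoc[OF S(9), of "p \<cdot> y"] by simp
    then have "null C (p \<cdot> y)" using inj1[OF T, of "p \<cdot> y"] by (simp add: Hom_iff)
    then have "null C (i \<cdot> (p \<cdot> y))" by (rule null_comp(1)) simp_all
    then show ?thesis using null_cong[OF stab_sym[OF s]] by simp
  qed
  have "ext_orth C T (Dom C k)" if T: "T \<in> X" for T
  proof -
    have "T \<in> Ob C" using T X(2) unfolding coresolving_def additive_subcategory_def subcategory_def by blast
    then obtain \<rho> \<pi> where \<rho>: "short_exact C \<rho> \<pi>" "Cod C \<pi> = T" "Cod C \<rho> \<in> Proj C"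
      using enough_proj_ses by blast
    note [simp] = short_exactD[OF \<rho>(1)] \<rho>(2)
    have "ext_orth C (Cod C \<pi>) (Dom C k)"
    proof (rule ext_orthI[OF \<rho>(1,3)])
      fix r assume r: "r \<in> Hom C (Dom C \<rho>) (Dom C k)"
      note [simp] = r[unfolded Hom_iff]
      have kr: "k \<cdot> r \<in> Hom C (Dom C \<rho>) S" by (simp add: Hom_iff)
      obtain j q t where jq: "short_exact C j q" "Dom C j = S" "Cod C q = Cod C \<pi>"
        and t: "t \<in> Hom C (Cod C \<rho>) (Cod C j)" "t \<cdot> \<rho> = j \<cdot> (k \<cdot> r)"
        and univ: "\<And>T b m. b \<in> Hom C S T \<Longrightarrow> m \<in> Hom C (Cod C \<rho>) T \<Longrightarrow> m \<cdot> \<rho> = b \<cdot> (k \<cdot> r)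
          \<Longrightarrow> \<exists>e \<in> Hom C (Cod C j) T. e \<cdot> j = b \<and> e \<cdot> t = m"
        by (rule pushout[OF \<rho>(1) kr]) blast
      note [simp] = short_exactD[OF jq(1)] jq(2,3) t(1)[unfolded Hom_iff]
      have EX: "Cod C j \<in> X" using X(2) jq SX T \<rho>(2) unfolding coresolving_def extension_closed_def by metis
      have gkr: "g \<cdot> (k \<cdot> r) = Zero C (Dom C \<rho>) A"
        using comp_reassoc[OF short_exactD(4)[OF k], of r] by simp
      \<comment> \<open>\<open>g k = 0\<close> makes the value zero on the projective
        \<open>Cod C \<rho>\<close> compatible with \<open>g\<close> on \<open>S\<close>.\<close>
      have "\<exists>e \<in> Hom C (Cod C j) A. e \<cdot> j = g \<and> e \<cdot> t = Zero C (Cod C \<rho>) A"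
        by (rule univ) (simp_all add: Hom_iff gkr)
      then obtain \<phi> where \<phi>: "\<phi> \<in> Hom C (Cod C j) A" "\<phi> \<cdot> j = g" "\<phi> \<cdot> t = Zero C (Cod C \<rho>) A" by blast
      note [simp] = \<phi>(1)[unfolded Hom_iff]
      obtain r0 where r0: "r0 \<in> Hom C (Cod C j) S" "g \<cdot> r0 = \<phi>" using surj[OF EX \<phi>(1)] by blast
      note [simp] = r0(1)[unfolded Hom_iff]
      \<comment> \<open>\<open>g\<close> does not distinguish \<open>r0 j\<close> from the identity,
        so \<open>inj\<close> makes their difference null; extending it along \<open>j\<close>
        corrects \<open>r0\<close> to a strict retraction.\<close>
      have grj: "g \<cdot> (r0 \<cdot> j) = g" using comp_reassoc[OF r0(2), of j] \<phi>(2) by simp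
      have "null C (Id C S \<boxminus> r0 \<cdot> j)"
        by (rule inj[OF SX]) (use grj in \<open>simp_all add: Hom_iff null_zero\<close>)
      then obtain l where l: "l \<in> Hom C (Cod C j) S" "l \<cdot> j = Id C S \<boxminus> r0 \<cdot> j" "null C l"
        using null_extend[OF _ jq(1), of "Id C S \<boxminus> r0 \<cdot> j"] by auto
      note [simp] = l(1)[unfolded Hom_iff]
      have r1: "(r0 \<boxplus> l) \<cdot> j = Id C S" using add_minus_cancel(1)[of "Id C S" "r0 \<cdot> j"] by (simp add: l(2))
      define s where "s = (r0 \<boxplus> l) \<cdot> t"
      have sh: "s \<in> Hom C (Cod C \<rho>) S" by (simp add: s_def Hom_iff)
      note [simp] = sh[unfolded Hom_iff]
      have "s \<cdot> \<rho> = (r0 \<boxplus> l) \<cdot> (j \<cdot> (k \<cdot> r))" unfolding s_def using t(2) by simp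
      also have "\<dots> = ((r0 \<boxplus> l) \<cdot> j) \<cdot> (k \<cdot> r)" by (rule comp_assoc[symmetric]) simp_all
      also have "\<dots> = k \<cdot> r" unfolding r1 by simp
      finally have s\<rho>: "s \<cdot> \<rho> = k \<cdot> r" .
      \<comment> \<open>\<open>s\<close> extends \<open>k r\<close> but need not land in the kernel
        of \<open>g\<close>. As \<open>g s\<close> kills \<open>\<rho>\<close>, it comes from a map
        \<open>x\<close> on \<open>T\<close>; subtracting \<open>z \<pi>\<close> for a lift
        \<open>z\<close> of \<open>x\<close> moves \<open>s\<close> into the kernel without changing
        its restriction along \<open>\<rho>\<close>.\<close>
      have "(g \<cdot> s) \<cdot> \<rho> = Zero C (Dom C \<rho>) A" using s\<rho> gkr by simp
      then obtain x where x: "x \<in> Hom C T A" "x \<cdot> \<pi> = g \<cdot> s"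
        using ses_colift[OF \<rho>(1), of "g \<cdot> s"] by auto
      obtain z where z: "z \<in> Hom C T S" "g \<cdot> z = x" using surj[OF T x(1)] by blast
      note [simp] = x(1)[unfolded Hom_iff] z(1)[unfolded Hom_iff]
      have "g \<cdot> s = g \<cdot> (z \<cdot> \<pi>)" using comp_reassoc[OF z(2), of \<pi>] x(2) by simp
      then obtain s' where s': "s' \<in> Hom C (Cod C \<rho>) (Dom C k)" "k \<cdot> s' = s \<boxminus> z \<cdot> \<pi>"
        using ses_lift_diff[OF k, of s "z \<cdot> \<pi>"] by auto
      note [simp] = s'(1)[unfolded Hom_iff]
      have "k \<cdot> (s' \<cdot> \<rho>) = k \<cdot> r" using comp_reassoc[OF s'(2), of \<rho>] s\<rho> by simp
      then have "s' \<cdot> \<rho> = r"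
        using mono_cancel[of k "s' \<cdot> \<rho>" r] short_exact_mono_epi[OF k] by simp
      then show "\<exists>g\<in>Hom C (Cod C \<rho>) (Dom C k). g \<cdot> \<rho> = r" using s'(1) by blast
    qed simp
    then show ?thesis by simp
  qed
  then have "Dom C k \<in> right_orth C X" by (simp add: right_orth_def)
  then show thesis by (intro that[OF k]) (simp_all add: SX)
qed

section \<open>From coresolving classes to complete cotorsion pairs and back\<close>

lemma right_orth_extension:
  assumes "short_exact C i p" "Dom C i \<in> right_orth C X" "Cod C p \<in> right_orth C X"
  shows "Cod C i \<in> right_orth C X"
proof -
  interpret op: frobenius_abelian_category "op C" by (rule frobenius_op)
  have "Dom C p = Cod C i" using assms(1) by auto
  then have "ext_orth C A (Cod C i)" if "A \<in> X" for A
    using op.ext_orth_middle[OF short_exact_op[OF assms(1)], of A] that assms(2,3)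
    by (simp add: right_orth_def)
  then show ?thesis using assms(1) by (auto simp: right_orth_def dest: short_exactD)
qed

lemma Proj_right_orth:
  assumes "X \<subseteq> Ob C" shows "Proj C \<subseteq> right_orth C X"
proof
  fix P assume P: "P \<in> Proj C"
  have "ext_orth (op C) P A" if "A \<in> X" for A
    using frobenius_abelian_category.ext_orth_Proj[OF frobenius_op, of P A] P that assms Proj_eq_Inj by auto
  then show "P \<in> right_orth C X" using P by (simp add: right_orth_def)
qed

text \<open>For an object of the double orthogonal the special precover sequence splits, which
  exhibits the object as a summand of an object of \<open>X\<close>.\<close>

lemma special_pair_of_coresolving:
  assumes split: "split_stably C" and X: "precovering C X" "coresolving C X" "summand_closed C X"
  shows "special_pair C X (right_orth C X)"
proof -
  have XO: "X \<subseteq> Ob C" using X(2) by (simp add: coresolving_def additive_subcategory_def subcategory_def)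
  have "left_orth C (right_orth C X) \<subseteq> X"
  proof
    fix A assume A: "A \<in> left_orth C (right_orth C X)"
    then have AO: "A \<in> Ob C" by (simp add: left_orth_def)
    obtain k g where kg: "short_exact C k g" "Cod C k \<in> X" "Cod C g = A" "Dom C k \<in> right_orth C X"
      using special_precover[OF split X AO] .
    then have "ext_orth C A (Dom C k)" using A by (simp add: left_orth_def)
    then obtain s where "s \<in> Hom C (Cod C g) (Cod C k)" "g \<cdot> s = Id C (Cod C g)"
      using kg unfolding ext_orth_def by blast
    from split_biproduct(2)[OF kg(1) this] show "A \<in> X"
      using X(3) kg(2,3) unfolding summand_closed_def by blast
  qed
  moreover have "X \<subseteq> left_orth C (right_orth C X)"
    using XO by (auto simp: left_orth_def right_orth_def)
  moreover have "\<exists>i p. short_exact C i p \<and> Dom C i \<in> right_orth C X \<and> Cod C i \<in> X \<and> Cod C p = A"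
    if "A \<in> Ob C" for A
    using special_precover[OF split X that] by metis
  moreover have "\<exists>i p. short_exact C i p \<and> Dom C i = A \<and> Cod C i \<in> right_orth C X \<and> Cod C p \<in> X"
    if A: "A \<in> Ob C" for A
  proof -
    obtain \<iota> \<pi> where \<iota>: "short_exact C \<iota> \<pi>" "Dom C \<iota> = A" "Cod C \<iota> \<in> Proj C"
      using enough_inj_ses[OF A] .
    have "Cod C \<pi> \<in> Ob C" using short_exactD(2)[OF \<iota>(1)] by simp
    from special_precover[OF split X this] obtain k g where kg: "short_exact C k g" "Cod C k \<in> X"
      "Cod C g = Cod C \<pi>" "Dom C k \<in> right_orth C X" .
    \<comment> \<open>The pullback of the special precover of the cosyzygy
      \<open>Cod C \<pi>\<close> along \<open>\<pi>\<close> is at once an extension of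
      \<open>Cod C k\<close> by \<open>A\<close> and of the injective \<open>Cod C \<iota>\<close>
      by \<open>Dom C k\<close>; the second description puts it in the right orthogonal.\<close>
    obtain j q s t where jq: "short_exact C j q" "Dom C j = Dom C \<iota>" "Cod C q = Cod C k"
      and st: "short_exact C s t" "Dom C s = Dom C k" "Cod C t = Cod C \<iota>" "Cod C s = Cod C j"
      by (rule pullback_ses[OF \<iota>(1) kg(1,3)])
    have "Cod C s \<in> right_orth C X"
      by (rule right_orth_extension[OF st(1)]) (use st kg \<iota> Proj_right_orth[OF XO] in auto)
    then show ?thesis using jq st kg(2) \<iota>(2) by metis
  qed
  ultimately show ?thesis unfolding special_pair_def by blast
qed

lemma special_pair_coresolving:
  assumes XY: "special_pair C X Y" and c: "cosyzygy_closed C X"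
  shows "precovering C X" "coresolving C X" "summand_closed C X"
proof -
  have X: "X = left_orth C Y" and Y: "Y = right_orth C X" using XY unfolding special_pair_def by blast+
  have YO: "Y \<subseteq> Ob C" unfolding Y right_orth_def by blast
  show "coresolving C X" "summand_closed C X"
    using left_orth_coresolving[OF X YO c] left_orth_summand[OF X YO] .
  show "precovering C X" unfolding precovering_def
  proof
    fix A assume "A \<in> Ob C"
    then obtain i p where ip: "short_exact C i p" "Dom C i \<in> Y" "Cod C i \<in> X" "Cod C p = A"
      using XY unfolding special_pair_def by blast
    have "ext_orth C T (Dom C i)" if "T \<in> X" for T
      using that ip(2) X unfolding left_orth_def by blast
    then have "is_precover C X A p" unfolding is_precover_def
      using ip short_exactD[OF ip(1)] ext_lift[OF _ ip(1)] by auto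
    then show "\<exists>f. is_precover C X A f" by blast
  qed
qed

text \<open>The sequence embedding \<open>A\<close> in an injective also shows \<open>A\<close> as a
  syzygy, so orthogonality of the cosyzygy to \<open>B\<close> is vanishing of stable maps from
  \<open>A\<close> to \<open>B\<close>. The criterion is symmetric in \<open>Z\<close> and
  \<open>W\<close> and hence self-dual.\<close>

lemma cosyzygy_closed_iff_null:
  assumes Z: "Z = left_orth C W" and WO: "W \<subseteq> Ob C"
  shows "cosyzygy_closed C Z \<longleftrightarrow> (\<forall>A \<in> Z. \<forall>B \<in> W. \<forall>f \<in> Hom C A B. null C f)"
proof
  assume c: "cosyzygy_closed C Z"
  show "\<forall>A \<in> Z. \<forall>B \<in> W. \<forall>f \<in> Hom C A B. null C f"
  proof (intro ballI)
    fix A B f assume *: "A \<in> Z" "B \<in> W" "f \<in> Hom C A B"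
    then have "A \<in> Ob C" using Z unfolding left_orth_def by blast
    then obtain i p where ip: "short_exact C i p" "Dom C i = A" "Cod C i \<in> Proj C"
      using enough_inj_ses by blast
    then have "Cod C p \<in> Z" using c *(1) unfolding cosyzygy_closed_def by blast
    then have "ext_orth C (Cod C p) B" using *(2) Z unfolding left_orth_def by blast
    then show "null C f" using ext_orth_null_left[OF ip(1,3), of B] *(2,3) WO ip(2) by blast
  qed
next
  assume n: "\<forall>A \<in> Z. \<forall>B \<in> W. \<forall>f \<in> Hom C A B. null C f"
  show "cosyzygy_closed C Z" unfolding cosyzygy_closed_def
  proof (intro allI impI; elim conjE)
    fix i p assume ip: "short_exact C i p" "Cod C i \<in> Proj C" "Dom C i \<in> Z"
    have "ext_orth C (Cod C p) B" if "B \<in> W" for B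
      using ext_orth_null_left[OF ip(1,2), of B] n ip(3) WO that by blast
    then show "Cod C p \<in> Z" unfolding Z left_orth_def using short_exactD(2)[OF ip(1)] by auto
  qed
qed

lemma syzygy_closed_iff_null:
  assumes "W = right_orth C Z" "Z \<subseteq> Ob C"
  shows "syzygy_closed C W \<longleftrightarrow> (\<forall>A \<in> Z. \<forall>B \<in> W. \<forall>f \<in> Hom C A B. null C f)"
  using frobenius_abelian_category.cosyzygy_closed_iff_null[OF frobenius_op, of W Z] assms by auto

lemma special_pair_orth:
  assumes "special_pair C Z W"
  shows "W = right_orth C Z" "Z = left_orth C W" "W \<subseteq> Ob C" "Z \<subseteq> Ob C"
  using assms unfolding special_pair_def left_orth_def right_orth_def by blast+

lemma special_pair_closed_iff:
  assumes "special_pair C Z W"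
  shows "cosyzygy_closed C Z \<longleftrightarrow> syzygy_closed C W"
  using cosyzygy_closed_iff_null[OF special_pair_orth(2,3)[OF assms]]
    syzygy_closed_iff_null[OF special_pair_orth(1,4)[OF assms]] by blast

end

section \<open>The stable category\<close>

context frobenius_abelian_category
begin

lemma proj_ideal_iff: "h \<in> proj_ideal C A B \<longleftrightarrow> null C h \<and> Dom C h = A \<and> Cod C h = B"
proof
  assume "h \<in> proj_ideal C A B"
  then obtain f g P where P: "P \<in> Proj C" "f \<in> Hom C A P" "g \<in> Hom C P B" and h: "h = g \<cdot> f"
    unfolding proj_ideal_def by blast
  then show "null C h \<and> Dom C h = A \<and> Cod C h = B"
    using nullI[OF P] unfolding h by (simp add: Hom_iff)
qed (auto simp: null_def)

lemma mem_stable_class: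
  assumes [simp]: "f \<in> Arr C"
  shows "g \<in> stable_class C f \<longleftrightarrow> stab C g f"
proof -
  have "stab C (f \<boxplus> h) f" if "null C h" "Dom C h = Dom C f" "Cod C h = Cod C f" for h
    using stab_add_null that by simp
  moreover have "\<exists>h. g = f \<boxplus> h \<and> null C h \<and> Dom C h = Dom C f \<and> Cod C h = Cod C f" if "stab C g f"
    using stabD[OF that] add_minus_cancel(1)[of g f] by (intro exI[of _ "g \<boxminus> f"]) simp
  ultimately show "g \<in> stable_class C f \<longleftrightarrow> stab C g f"
    unfolding stable_class_def proj_ideal_iff by blast
qed

lemma stable_class_eq_iff:
  assumes f: "f \<in> Arr C" and g: "g \<in> Arr C"
  shows "stable_class C f = stable_class C g \<longleftrightarrow> stab C f g"
proof
  assume "stable_class C f = stable_class C g"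
  moreover have "f \<in> stable_class C f" using f by (simp add: mem_stable_class)
  ultimately show "stab C f g" using g mem_stable_class by blast
next
  assume "stab C f g"
  then have "stab C h f \<longleftrightarrow> stab C h g" for h using stab_sym stab_trans by blast
  then show "stable_class C f = stable_class C g" using f g by (auto simp: mem_stable_class)
qed

lemma rep_stab: assumes "f \<in> Arr C" shows "stab C (rep (stable_class C f)) f"
proof -
  have "rep (stable_class C f) \<in> stable_class C f"
    unfolding rep_def by (rule someI[of _ f]) (simp add: mem_stable_class assms)
  then show ?thesis using mem_stable_class[OF assms] by blast
qed

lemma rep_simps [simp]:
  assumes "f \<in> Arr C"
  shows "rep (stable_class C f) \<in> Arr C" "Dom C (rep (stable_class C f)) = Dom C f"
    "Cod C (rep (stable_class C f)) = Cod C f"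
  using stabD[OF rep_stab[OF assms]] by simp_all

lemma stable_simps [simp]:
  "Ob (stable_cat C) = Ob C" "Arr (stable_cat C) = stable_class C ` Arr C"
  "Id (stable_cat C) A = stable_class C (Id C A)"
  "Zero (stable_cat C) A B = stable_class C (Zero C A B)"
  by (simp_all add: stable_cat_def)

lemma stable_Dom_Cod [simp]:
  assumes "f \<in> Arr C"
  shows "Dom (stable_cat C) (stable_class C f) = Dom C f" "Cod (stable_cat C) (stable_class C f) = Cod C f"
  using assms by (simp_all add: stable_cat_def)

text \<open>Composition in \<open>stable_cat\<close> goes through representatives selected by
  \<open>rep\<close>; they are replaced one at a time by congruence.\<close>

lemma stable_Comp [simp]:
  assumes "f \<in> Arr C" "g \<in> Arr C" "Dom C g = Cod C f"
  shows "stable_class C g \<cdot>\<^bsub>stable_cat C\<^esub> stable_class C f = stable_class C (g \<cdot> f)"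
proof -
  have 1: "stab C (rep (stable_class C g) \<cdot> rep (stable_class C f)) (g \<cdot> rep (stable_class C f))"
    by (rule stab_comp(2)[OF rep_stab]) (use assms in simp_all)
  have 2: "stab C (g \<cdot> rep (stable_class C f)) (g \<cdot> f)"
    by (rule stab_comp(1)[OF rep_stab]) (use assms in simp_all)
  show ?thesis using stab_trans[OF 1 2] assms by (simp add: stable_cat_def stable_class_eq_iff)
qed

lemma stable_Hom: "Hom (stable_cat C) A B = stable_class C ` Hom C A B"
  unfolding Hom_def by auto

lemma stable_isomorphic: "isomorphic (stable_cat C) A B \<longleftrightarrow> stab_iso C A B"
proof
  assume "isomorphic (stable_cat C) A B"
  then obtain F G where FG: "F \<in> Hom (stable_cat C) A B" "G \<in> Hom (stable_cat C) B A"
    "G \<cdot>\<^bsub>stable_cat C\<^esub> F = Id (stable_cat C) A" "F \<cdot>\<^bsub>stable_cat C\<^esub> G = Id (stable_cat C) B"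
    unfolding isomorphic_def is_iso_def Hom_def by force
  then obtain u v where u: "u \<in> Hom C A B" "F = stable_class C u" and v: "v \<in> Hom C B A" "G = stable_class C v"
    unfolding stable_Hom by blast
  note [simp] = u(1)[unfolded Hom_iff] v(1)[unfolded Hom_iff]
  have [simp]: "A \<in> Ob C" "B \<in> Ob C" using Hom_Ob[OF u(1)] by auto
  have "stab C (v \<cdot> u) (Id C A)" "stab C (u \<cdot> v) (Id C B)"
    using FG(3,4) unfolding u(2) v(2) by (simp_all add: stable_class_eq_iff)
  then show "stab_iso C A B" using u v unfolding stab_iso_def by blast
next
  assume "stab_iso C A B"
  then obtain u v where uv: "u \<in> Hom C A B" "v \<in> Hom C B A" "stab C (v \<cdot> u) (Id C A)" "stab C (u \<cdot> v) (Id C B)"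
    unfolding stab_iso_def by blast
  note [simp] = uv(1,2)[unfolded Hom_iff]
  have [simp]: "A \<in> Ob C" "B \<in> Ob C" using Hom_Ob[OF uv(1)] by auto
  have "is_iso (stable_cat C) (stable_class C u)" unfolding is_iso_def
  proof (intro conjI bexI[of _ "stable_class C v"])
    show "stable_class C v \<in> Hom (stable_cat C) (Cod (stable_cat C) (stable_class C u))
      (Dom (stable_cat C) (stable_class C u))"
      using uv(2) by (simp add: stable_Hom)
  qed (use uv in \<open>simp_all add: stable_class_eq_iff\<close>)
  then show "isomorphic (stable_cat C) A B"
    unfolding isomorphic_def stable_Hom using uv(1) by blast
qed

lemma split_stablyI:
  assumes "split_idempotents (stable_cat C)" shows "split_stably C"
  unfolding split_stably_def
proof (intro ballI impI)
  fix A e assume A: "A \<in> Ob C" and e: "e \<in> Hom C A A" and ee: "stab C (e \<cdot> e) e"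
  note [simp] = A e[unfolded Hom_iff]
  have "stable_class C e \<cdot>\<^bsub>stable_cat C\<^esub> stable_class C e = stable_class C e"
    using ee by (simp add: stable_class_eq_iff)
  moreover have "stable_class C e \<in> Hom (stable_cat C) A A" using e unfolding stable_Hom by blast
  ultimately obtain B F G where B: "B \<in> Ob C" and FG: "F \<in> Hom (stable_cat C) A B" "G \<in> Hom (stable_cat C) B A"
    "stable_class C e = G \<cdot>\<^bsub>stable_cat C\<^esub> F" "F \<cdot>\<^bsub>stable_cat C\<^esub> G = Id (stable_cat C) B"
    using assms[unfolded split_idempotents_def, rule_format, of A "stable_class C e"] A by auto
  then obtain p i where p: "p \<in> Hom C A B" and i: "i \<in> Hom C B A"
    and *: "stable_class C e = stable_class C i \<cdot>\<^bsub>stable_cat C\<^esub> stable_class C p"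
      "stable_class C p \<cdot>\<^bsub>stable_cat C\<^esub> stable_class C i = Id (stable_cat C) B"
    unfolding stable_Hom by blast
  note [simp] = B p[unfolded Hom_iff] i[unfolded Hom_iff]
  have "stab C (i \<cdot> p) e" "stab C (p \<cdot> i) (Id C B)"
    using *(1)[symmetric] *(2) by (simp_all add: stable_class_eq_iff)
  then show "\<exists>B\<in>Ob C. \<exists>p\<in>Hom C A B. \<exists>i\<in>Hom C B A. stab C (i \<cdot> p) e \<and> stab C (p \<cdot> i) (cat.Id C B)"
    using B p i by blast
qed

lemma tri_simps [simp]:
  "Ob (stable_tri_cat C) = Ob C" "Susp (stable_tri_cat C) = Omega_inv C"
  "Desusp (stable_tri_cat C) = Omega C" "Triangles (stable_tri_cat C) = stable_triangles C"
  "Zero (stable_tri_cat C) = Zero (stable_cat C)"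
  "Dom (stable_tri_cat C) = Dom (stable_cat C)" "Cod (stable_tri_cat C) = Cod (stable_cat C)"
  by (simp_all add: stable_tri_cat_def add_cat.defs tri_cat.defs)

lemma tri_Hom [simp]: "Hom (stable_tri_cat C) = Hom (stable_cat C)"
  by (intro ext) (simp add: Hom_def stable_tri_cat_def add_cat.defs)

lemma tri_isomorphic [simp]: "isomorphic (stable_tri_cat C) A B \<longleftrightarrow> stab_iso C A B"
  unfolding stable_isomorphic[symmetric] isomorphic_def is_iso_def tri_Hom
  by (simp add: stable_tri_cat_def add_cat.defs)

section \<open>Shifts of classes of stable objects\<close>

lemma stab_iso_Ob: "stab_iso C A B \<Longrightarrow> A \<in> Ob C" "stab_iso C A B \<Longrightarrow> B \<in> Ob C"
  unfolding stab_iso_def using Hom_Ob by blast+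

text \<open>Closure under isomorphism in the stable category, stronger than in \<open>C\<close>: it
  allows, for example, adding and removing projective summands.\<close>

definition stab_closed :: "'o set \<Rightarrow> bool" where
  "stab_closed X \<longleftrightarrow> X \<subseteq> Ob C \<and> (\<forall>A \<in> X. \<forall>B. stab_iso C A B \<longrightarrow> B \<in> X)"

lemma tri_subcategory: "subcategory (stable_tri_cat C) X \<longleftrightarrow> stab_closed X"
  unfolding subcategory_def stab_closed_def using stab_iso_Ob by auto

lemma left_orth_stab_closed: "X = left_orth C Y \<Longrightarrow> Y \<subseteq> Ob C \<Longrightarrow> stab_closed X"
  unfolding stab_closed_def using left_orth_Ob left_orth_retract stab_iso_retract stab_iso_sym by metis

lemma right_orth_stab_closed: "stab_closed (right_orth C X)"
  unfolding stab_closed_def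
proof (intro conjI ballI allI impI)
  show "right_orth C X \<subseteq> Ob C" by (auto simp: right_orth_def)
  fix A B assume A: "A \<in> right_orth C X" and AB: "stab_iso C A B"
  have "stab_retract C B A" by (rule stab_iso_retract[OF stab_iso_sym[OF AB]])
  then show "B \<in> right_orth C X"
    using A ext_orth_retract_right stab_iso_Ob(2)[OF AB] unfolding right_orth_def by blast
qed

lemma stab_closedD: "stab_closed X \<Longrightarrow> A \<in> X \<Longrightarrow> stab_iso C A B \<Longrightarrow> B \<in> X"
  "stab_closed X \<Longrightarrow> A \<in> X \<Longrightarrow> A \<in> Ob C"
  unfolding stab_closed_def by blast+

abbreviation susp :: "'o set \<Rightarrow> 'o set" where
  "susp X \<equiv> ess_image (stable_tri_cat C) (Omega_inv C) X"

abbreviation desusp :: "'o set \<Rightarrow> 'o set" where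
  "desusp X \<equiv> ess_image (stable_tri_cat C) (Omega C) X"

lemma ess_image_iff: "B \<in> ess_image (stable_tri_cat C) F X \<longleftrightarrow> (\<exists>A \<in> X. stab_iso C (F A) B)"
  unfolding ess_image_def using stab_iso_Ob by auto

lemma ess_image_stab_closed: "stab_closed (ess_image (stable_tri_cat C) F X)"
  unfolding stab_closed_def
proof (intro conjI ballI allI impI)
  show "ess_image (stable_tri_cat C) F X \<subseteq> Ob C" by (auto simp: ess_image_def)
  fix A B assume "A \<in> ess_image (stable_tri_cat C) F X" and AB: "stab_iso C A B"
  then obtain A' where "A' \<in> X" "stab_iso C (F A') A" unfolding ess_image_iff by blast
  then show "B \<in> ess_image (stable_tri_cat C) F X" using stab_iso_trans[OF _ AB] unfolding ess_image_iff by blast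
qed

lemma cosyzygy_seq:
  assumes "A \<in> Ob C"
  shows "short_exact C (inj_emb C A) (cosyz_proj C A)" "Dom C (inj_emb C A) = A"
    "Cod C (inj_emb C A) \<in> Proj C" "Cod C (cosyz_proj C A) = Omega_inv C A"
proof -
  obtain i p where "short_exact C i p \<and> Dom C i = A \<and> Cod C i \<in> Inj C"
    using enough_inj_ses[OF assms] Proj_eq_Inj by metis
  then have "case cosyzygy_seq C A of (i, p) \<Rightarrow> short_exact C i p \<and> Dom C i = A \<and> Cod C i \<in> Inj C"
    unfolding cosyzygy_seq_def by - (rule someI[of _ "(i, p)"], simp)
  then show "short_exact C (inj_emb C A) (cosyz_proj C A)" "Dom C (inj_emb C A) = A"
    "Cod C (inj_emb C A) \<in> Proj C" "Cod C (cosyz_proj C A) = Omega_inv C A"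
    by (auto simp: case_prod_beta Proj_eq_Inj Omega_inv_def)
qed

lemma syzygy_seq:
  assumes "A \<in> Ob C"
  obtains i p where "short_exact C i p" "Cod C p = A" "Cod C i \<in> Proj C" "Dom C i = Omega C A"
proof -
  obtain i p where ip: "short_exact C i p" "Cod C p = A" "Cod C i \<in> Proj C"
    using enough_proj_ses[OF assms] .
  then have "short_exact C i p \<and> Cod C p = A \<and> Dom C p \<in> Proj C" using short_exactD(3)[OF ip(1)] by simp
  then have "case syzygy_seq C A of (i, p) \<Rightarrow> short_exact C i p \<and> Cod C p = A \<and> Dom C p \<in> Proj C"
    unfolding syzygy_seq_def by - (rule someI[of _ "(i, p)"], simp)
  then show thesis
    using that[of "fst (syzygy_seq C A)" "snd (syzygy_seq C A)"] short_exactD(3)[of "fst (syzygy_seq C A)" "snd (syzygy_seq C A)"]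
    by (auto simp: case_prod_beta Omega_def)
qed

text \<open>Any sequence with projective middle term computes the chosen \<open>Omega_inv\<close> up
  to stable isomorphism, so the choice can be forgotten.\<close>

lemma Omega_inv_iso:
  assumes "short_exact C i p" "Cod C i \<in> Proj C" "stab_iso C (Dom C i) A"
  shows "stab_iso C (Cod C p) (Omega_inv C A)"
  using cosyzygy_iso[OF assms(1) cosyzygy_seq(1)[of A] assms(2)] cosyzygy_seq[of A] stab_iso_Ob assms(3) by simp

lemma Omega_iso:
  assumes "short_exact C i p" "Cod C i \<in> Proj C" "stab_iso C (Cod C p) A"
  shows "stab_iso C (Dom C i) (Omega C A)"
proof -
  have "A \<in> Ob C" using stab_iso_Ob assms(3) by blast
  then obtain j q where "short_exact C j q" "Cod C q = A" "Cod C j \<in> Proj C" "Dom C j = Omega C A"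
    by (rule syzygy_seq)
  then show ?thesis using syzygy_iso[OF assms(1) _ assms(2)] assms(3) by metis
qed

lemma Omega_Ob: "A \<in> Ob C \<Longrightarrow> Omega_inv C A \<in> Ob C" "A \<in> Ob C \<Longrightarrow> Omega C A \<in> Ob C"
  using cosyzygy_seq short_exactD Cod_in Dom_in syzygy_seq by metis+

lemma Omega_inv_cong: "stab_iso C A B \<Longrightarrow> stab_iso C (Omega_inv C A) (Omega_inv C B)"
  using Omega_inv_iso[OF cosyzygy_seq(1,3), of A B] cosyzygy_seq(2,4)[of A] stab_iso_Ob by simp

lemma Omega_Omega_inv: "A \<in> Ob C \<Longrightarrow> stab_iso C (Omega C (Omega_inv C A)) A"
  using Omega_iso[OF cosyzygy_seq(1,3), of A "Omega_inv C A"] cosyzygy_seq(2,4)[of A] stab_iso_refl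
    Omega_Ob stab_iso_sym by metis

lemma Omega_inv_Omega: "A \<in> Ob C \<Longrightarrow> stab_iso C (Omega_inv C (Omega C A)) A"
  by (rule syzygy_seq[of A]) (use Omega_inv_iso stab_iso_refl stab_iso_sym Omega_Ob in metis)+

lemma Omega_cong: "stab_iso C A B \<Longrightarrow> stab_iso C (Omega C A) (Omega C B)"
  by (rule syzygy_seq[of A]) (use Omega_iso stab_iso_Ob in metis)+

text \<open>Objectwise \<Omega> undoes \<Omega>^-1 up to stable isomorphism, and closure of
  \<open>X\<close> under stable isomorphism absorbs the difference.\<close>

lemma desusp_susp:
  assumes X: "stab_closed X" shows "desusp (susp X) = X"
proof (intro equalityI subsetI)
  fix B assume "B \<in> desusp (susp X)"
  then obtain A' where "A' \<in> susp X" and "stab_iso C (Omega C A') B" using ess_image_iff[of B "Omega C" "susp X"] by blast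
  then obtain A where A: "A \<in> X" "stab_iso C (Omega_inv C A) A'" "stab_iso C (Omega C A') B"
    unfolding ess_image_iff by blast
  have "stab_iso C (Omega C (Omega_inv C A)) B" using Omega_cong[OF A(2)] A(3) stab_iso_trans by blast
  then have "stab_iso C A B"
    using stab_iso_trans[OF stab_iso_sym[OF Omega_Omega_inv[of A]]] stab_closedD(2)[OF X A(1)] by blast
  then show "B \<in> X" using X A(1) stab_closedD by blast
next
  fix B assume B: "B \<in> X"
  then have BO: "B \<in> Ob C" using X stab_closedD by blast
  have "Omega_inv C B \<in> susp X" using B stab_iso_refl Omega_Ob(1)[OF BO] unfolding ess_image_iff by blast
  then show "B \<in> desusp (susp X)" using Omega_Omega_inv[OF BO] ess_image_iff by blast
qed

lemma susp_desusp:
  assumes X: "stab_closed X" shows "susp (desusp X) = X"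
proof (intro equalityI subsetI)
  fix B assume "B \<in> susp (desusp X)"
  then obtain A' where "A' \<in> desusp X" and "stab_iso C (Omega_inv C A') B" using ess_image_iff[of B "Omega_inv C" "desusp X"] by blast
  then obtain A where A: "A \<in> X" "stab_iso C (Omega C A) A'" "stab_iso C (Omega_inv C A') B"
    unfolding ess_image_iff by blast
  have "stab_iso C (Omega_inv C (Omega C A)) B" using Omega_inv_cong[OF A(2)] A(3) stab_iso_trans by blast
  then have "stab_iso C A B"
    using stab_iso_trans[OF stab_iso_sym[OF Omega_inv_Omega[of A]]] stab_closedD(2)[OF X A(1)] by blast
  then show "B \<in> X" using X A(1) stab_closedD by blast
next
  fix B assume B: "B \<in> X"
  then have BO: "B \<in> Ob C" using X stab_closedD by blast
  have "Omega C B \<in> desusp X" using B stab_iso_refl Omega_Ob(2)[OF BO] unfolding ess_image_iff by blast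
  then show "B \<in> susp (desusp X)" using Omega_inv_Omega[OF BO] ess_image_iff by blast
qed

lemma susp_mono: "X \<subseteq> Y \<Longrightarrow> susp X \<subseteq> susp Y"
  unfolding ess_image_iff subset_iff by blast

lemma cosyzygy_closed_iff:
  assumes X: "stab_closed X"
  shows "cosyzygy_closed C X \<longleftrightarrow> susp X \<subseteq> X"
proof
  assume c: "cosyzygy_closed C X"
  show "susp X \<subseteq> X"
  proof
    fix B assume "B \<in> susp X"
    then obtain A where A: "A \<in> X" "stab_iso C (Omega_inv C A) B" unfolding ess_image_iff by blast
    have "Omega_inv C A \<in> X" using c cosyzygy_seq[OF stab_closedD(2)[OF X A(1)]] A(1)
      unfolding cosyzygy_closed_def by metis
    then show "B \<in> X" using A X stab_closedD by blast
  qed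
next
  assume c: "susp X \<subseteq> X"
  show "cosyzygy_closed C X" unfolding cosyzygy_closed_def
  proof (intro allI impI; elim conjE)
    fix i p assume ip: "short_exact C i p" "Cod C i \<in> Proj C" "Dom C i \<in> X"
    have "stab_iso C (Cod C p) (Omega_inv C (Dom C i))"
      using Omega_inv_iso[OF ip(1,2)] stab_iso_refl stab_closedD(2)[OF X ip(3)] by blast
    from stab_iso_sym[OF this] show "Cod C p \<in> X" using c ip(3) unfolding subset_iff ess_image_iff by blast
  qed
qed

lemma syzygy_closed_iff:
  assumes X: "stab_closed X"
  shows "syzygy_closed C X \<longleftrightarrow> desusp X \<subseteq> X"
proof
  assume c: "syzygy_closed C X"
  show "desusp X \<subseteq> X"
  proof
    fix B assume "B \<in> desusp X"
    then obtain A where A: "A \<in> X" "stab_iso C (Omega C A) B" unfolding ess_image_iff by blast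
    have "A \<in> Ob C" using stab_closedD(2)[OF X A(1)] .
    then have "Omega C A \<in> X"
      by (rule syzygy_seq) (use c A(1) in \<open>auto simp: syzygy_closed_def\<close>)
    then show "B \<in> X" using A X stab_closedD by blast
  qed
next
  assume c: "desusp X \<subseteq> X"
  show "syzygy_closed C X" unfolding syzygy_closed_def
  proof (intro allI impI; elim conjE)
    fix i p assume ip: "short_exact C i p" "Cod C i \<in> Proj C" "Cod C p \<in> X"
    have "stab_iso C (Dom C i) (Omega C (Cod C p))"
      using Omega_iso[OF ip(1,2)] stab_iso_refl stab_closedD(2)[OF X ip(3)] by blast
    from stab_iso_sym[OF this] show "Dom C i \<in> X" using c ip(3) unfolding subset_iff ess_image_iff by blast
  qed
qed

section \<open>Triangles\<close>

text \<open>The mapping cone sequence $0 \to A \to I \oplus B \to E \to 0$ of a standard triangle.\<close>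

lemma cone_ses:
  assumes f: "f \<in> Hom C A B" and \<iota>: "short_exact C \<iota> \<pi>" "Dom C \<iota> = A" "Cod C \<iota> \<in> Proj C"
    and gh: "short_exact C g h" "Dom C g = B" "Cod C h = Cod C \<pi>"
    and t: "t \<in> Hom C (Cod C \<iota>) (Cod C g)" "t \<cdot> \<iota> = g \<cdot> f" "h \<cdot> t = \<pi>"
  obtains i p where "short_exact C i p" "Dom C i = A" "stab_iso C B (Cod C i)" "Cod C p = Cod C g"
proof -
  note [simp] = f[unfolded Hom_iff] short_exactD[OF \<iota>(1)] \<iota>(2) short_exactD[OF gh(1)] gh(2,3) t(1)[unfolded Hom_iff]
  have [simp]: "A \<in> Ob C" "B \<in> Ob C" using Hom_Ob[OF f] by auto
  note me = short_exact_mono_epi[OF \<iota>(1)] short_exact_mono_epi[OF gh(1)]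
  obtain S i1 i2 p1 p2 where
    h: "i1 \<in> Hom C (Cod C \<iota>) S" "i2 \<in> Hom C B S" "p1 \<in> Hom C S (Cod C \<iota>)" "p2 \<in> Hom C S B"
    and e: "p1 \<cdot> i1 = Id C (Cod C \<iota>)" "p2 \<cdot> i2 = Id C B" "p1 \<cdot> i2 = Zero C B (Cod C \<iota>)"
      "p2 \<cdot> i1 = Zero C (Cod C \<iota>) B" and sum: "i1 \<cdot> p1 \<boxplus> i2 \<cdot> p2 = Id C S"
    by (rule biproductE[of "Cod C \<iota>" B]) auto
  note [simp] = h[unfolded Hom_iff] e comp_reassoc[OF e(1)] comp_reassoc[OF e(2)]
    comp_reassoc[OF e(3)] comp_reassoc[OF e(4)]
  have [simp]: "S \<in> Ob C" using Dom_in[of p1] by simp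
  define i where "i = i1 \<cdot> \<iota> \<boxminus> i2 \<cdot> f"
  define p where "p = t \<cdot> p1 \<boxplus> g \<cdot> p2"
  have ih: "i \<in> Hom C A S" and ph: "p \<in> Hom C S (Cod C g)" by (simp_all add: i_def p_def Hom_iff)
  note [simp] = ih[unfolded Hom_iff] ph[unfolded Hom_iff]
  have p1i: "p1 \<cdot> i = \<iota>" and p2i: "p2 \<cdot> i = neg C f" and pi1: "p \<cdot> i1 = t" and pi2: "p \<cdot> i2 = g"
    by (simp_all add: i_def p_def)
  have pi: "p \<cdot> i = Zero C A (Cod C g)"
    by (simp add: p_def p1i p2i t(2))
  have mono_i: "is_mono C i"
  proof (rule monoI)
    fix x assume [simp]: "x \<in> Arr C" "Cod C x = Dom C i" and "i \<cdot> x = Zero C (Dom C x) (Cod C i)"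
    then have "\<iota> \<cdot> x = \<iota> \<cdot> Zero C (Dom C x) A" using comp_reassoc[OF p1i, of x] by simp
    from mono_cancel[OF me(1) this] show "x = Zero C (Dom C x) (Dom C i)" by simp
  qed simp
  have "is_epi C p"
  proof (rule epiI)
    fix x assume x [simp]: "x \<in> Arr C" "Dom C x = Cod C p" and xp: "x \<cdot> p = Zero C (Dom C p) (Cod C x)"
    have xt: "x \<cdot> t = Zero C (Cod C \<iota>) (Cod C x)" and xg: "x \<cdot> g = Zero C B (Cod C x)"
      using comp_assoc[of i1 p x] comp_assoc[of i2 p x] by (simp_all add: pi1 pi2 xp)
    obtain y where y: "y \<in> Hom C (Cod C h) (Cod C x)" "y \<cdot> h = x" using ses_colift[OF gh(1), of x] xg by auto
    note [simp] = y(1)[unfolded Hom_iff]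
    have "y \<cdot> \<pi> = x \<cdot> t" unfolding t(3)[symmetric] y(2)[symmetric] by simp
    then have "y \<cdot> \<pi> = Zero C (Cod C \<pi>) (Cod C x) \<cdot> \<pi>" unfolding xt by simp
    then have y0: "y = Zero C (Cod C \<pi>) (Cod C x)"
      using epi_cancel[OF me(2), of y "Zero C (Cod C \<pi>) (Cod C x)"] by simp
    have "y \<cdot> h = Zero C (Cod C g) (Cod C x)" unfolding y0 by simp
    then show "x = Zero C (Cod C p) (Cod C x)" unfolding y(2) by simp
  qed simp
  \<comment> \<open>Applying \<open>h\<close> to \<open>p x = 0\<close> shows that
    \<open>\<pi>\<close> kills \<open>p1 x\<close>, so \<open>p1 x = \<iota> y\<close>; as
    \<open>g\<close> is monic, the other component must be \<open>- f y\<close>, whence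
    \<open>x = i y\<close>.\<close>
  moreover have "is_kernel C i p"
  proof (rule kernelI[OF mono_i])
    fix x assume x [simp]: "x \<in> Arr C" "Cod C x = Cod C i" and px: "p \<cdot> x = Zero C (Dom C x) (Cod C p)"
    have hp: "h \<cdot> p = \<pi> \<cdot> p1"
      using comp_reassoc[OF t(3), of p1] comp_reassoc[OF short_exactD(4)[OF gh(1)], of p2] by (simp add: p_def)
    have "\<pi> \<cdot> (p1 \<cdot> x) = h \<cdot> (p \<cdot> x)" using comp_reassoc[OF hp, of x] by simp
    then have "\<pi> \<cdot> (p1 \<cdot> x) = Zero C (Dom C x) (Cod C \<pi>)" unfolding px by simp
    then obtain y where y: "y \<in> Hom C (Dom C x) A" "\<iota> \<cdot> y = p1 \<cdot> x"
      using ses_lift[OF \<iota>(1), of "p1 \<cdot> x"] by auto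
    note [simp] = y(1)[unfolded Hom_iff]
    have "t \<cdot> (p1 \<cdot> x) = g \<cdot> (f \<cdot> y)" using comp_reassoc[OF t(2), of y] y(2) by simp
    then have "p \<cdot> x = g \<cdot> (f \<cdot> y \<boxplus> p2 \<cdot> x)" by (simp add: p_def)
    then have "g \<cdot> (f \<cdot> y \<boxplus> p2 \<cdot> x) = g \<cdot> Zero C (Dom C x) B" unfolding px by simp
    then have "f \<cdot> y \<boxplus> p2 \<cdot> x = Zero C (Dom C x) B"
      using mono_cancel[OF me(3), of "f \<cdot> y \<boxplus> p2 \<cdot> x" "Zero C (Dom C x) B"] by simp
    then have fy: "neg C (f \<cdot> y) = p2 \<cdot> x"
      using neg_unique[of "f \<cdot> y" "p2 \<cdot> x"] by simp
    have "i \<cdot> y = i1 \<cdot> (\<iota> \<cdot> y) \<boxplus> i2 \<cdot> neg C (f \<cdot> y)" by (simp add: i_def)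
    also have "\<dots> = (i1 \<cdot> p1 \<boxplus> i2 \<cdot> p2) \<cdot> x" unfolding y(2) fy by simp
    also have "\<dots> = x" unfolding sum by simp
    finally show "\<exists>y\<in>Hom C (Dom C x) (Dom C i). i \<cdot> y = x"
      by (intro bexI[of _ y]) (simp_all add: Hom_iff)
  qed (simp_all add: pi)
  ultimately have "short_exact C i p" by (rule epi_kernel_ses)
  moreover have "stab_iso C B S"
  proof -
    have "null C (i1 \<cdot> p1)" by (rule nullI[OF \<iota>(3) h(3) h(1)])
    then have "stab C (i2 \<cdot> p2 \<boxplus> i1 \<cdot> p1) (i2 \<cdot> p2)" by (intro stab_add_null) simp_all
    then have "stab C (i2 \<cdot> p2) (Id C S)"
      using stab_sym sum add_comm[of "i2 \<cdot> p2" "i1 \<cdot> p1"] by simp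
    then show ?thesis unfolding stab_iso_def
      by (intro bexI[of _ i2] bexI[of _ p2]) (simp_all add: Hom_iff)
  qed
  ultimately show thesis using that[of i p] by simp
qed

text \<open>A distinguished triangle is isomorphic to a standard one, whose cone sequence is exact
  in \<open>C\<close>. Only the three objects are retained, which is all that the truncation
  arguments use.\<close>

lemma stable_triangle_ses:
  assumes "(u, v, w) \<in> stable_triangles C"
  obtains i p where "short_exact C i p" "stab_iso C (Dom (stable_cat C) u) (Dom C i)"
    "stab_iso C (Cod (stable_cat C) u) (Cod C i)" "stab_iso C (Cod (stable_cat C) v) (Cod C p)"
proof -
  let ?T = "stable_cat C"
  obtain u' v' w' a b c where uvw: "(u', v', w') \<in> standard_triangles C"
    and a: "a \<in> Hom ?T (Dom ?T u) (Dom ?T u')" "is_iso ?T a"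
    and b: "b \<in> Hom ?T (Cod ?T u) (Cod ?T u')" "is_iso ?T b"
    and c: "c \<in> Hom ?T (Cod ?T v) (Cod ?T v')" "is_iso ?T c"
    using assms unfolding stable_triangles_def Let_def by blast
  obtain f g h t where *: "u' = stable_class C f" "v' = stable_class C g" "f \<in> Arr C" "short_exact C g h"
    "Dom C g = Cod C f" "Cod C h = Omega_inv C (Dom C f)"
    "t \<in> Hom C (Cod C (inj_emb C (Dom C f))) (Cod C g)"
    "t \<cdot> inj_emb C (Dom C f) = g \<cdot> f" "h \<cdot> t = cosyz_proj C (Dom C f)"
    using uvw unfolding standard_triangles_def by blast
  have "Dom C f \<in> Ob C" using *(3) by simp
  note s = cosyzygy_seq[OF this]
  obtain i p where ip: "short_exact C i p" "Dom C i = Dom C f" "stab_iso C (Cod C f) (Cod C i)" "Cod C p = Cod C g"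
    by (rule cone_ses[OF Arr_Hom[OF *(3)] s(1-3) *(4,5) _ *(7,8,9)]) (use *(6) s(4) in simp)
  have "g \<in> Arr C" using *(4) by auto
  have iso: "stab_iso C (Dom ?T u) (Dom ?T u')" "stab_iso C (Cod ?T u) (Cod ?T u')" "stab_iso C (Cod ?T v) (Cod ?T v')"
    using a b c unfolding stable_isomorphic[symmetric] isomorphic_def by blast+
  have "Dom ?T u' = Dom C f" "Cod ?T u' = Cod C f" "Cod ?T v' = Cod C g"
    unfolding *(1,2) using *(3) \<open>g \<in> Arr C\<close> by simp_all
  note iso = iso[unfolded this]
  show thesis
    by (rule that[OF ip(1)]) (use iso ip(2,4) stab_iso_trans[OF iso(2) ip(3)] in simp_all)
qed

text \<open>Needed to compare a standard triangle with itself by identities. The functor takes an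
  arbitrary \<open>h\<close> over an arbitrary representative \<open>f\<close> of the identity;
  \<open>h - 1\<close> is induced by the null map \<open>f - 1\<close> and is therefore
  null.\<close>

lemma Omega_inv_arr_Id:
  assumes A: "A \<in> Ob C"
  shows "Omega_inv_arr C (stable_class C (Id C A)) = stable_class C (Id C (Omega_inv C A))"
proof -
  note s = cosyzygy_seq[OF A]
  note [simp] = A short_exactD[OF s(1)] s(2,4) Omega_Ob(1)[OF A]
  let ?P = "\<lambda>h. \<exists>f \<in> stable_class C (Id C A). \<exists>g.
     let A = Dom C f; B = Cod C f in
       g \<in> Hom C (Cod C (inj_emb C A)) (Cod C (inj_emb C B)) \<and>
       h \<in> Hom C (Omega_inv C A) (Omega_inv C B) \<and>
       g \<cdot> inj_emb C A = inj_emb C B \<cdot> f \<and>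
       h \<cdot> cosyz_proj C A = cosyz_proj C B \<cdot> g"
  have "?P (Id C (Omega_inv C A))"
    by (rule bexI[of _ "Id C A"], rule exI[of _ "Id C (Cod C (inj_emb C A))"])
      (simp_all add: Let_def mem_stable_class Hom_iff)
  note P = someI[of ?P, OF this]
  define h where "h = (SOME h. ?P h)"
  have "?P h" unfolding h_def by (rule P)
  then obtain f g where f: "stab C f (Id C A)" and g: "g \<in> Hom C (Cod C (inj_emb C (Dom C f))) (Cod C (inj_emb C (Cod C f)))"
    and h: "h \<in> Hom C (Omega_inv C (Dom C f)) (Omega_inv C (Cod C f))"
    and e: "g \<cdot> inj_emb C (Dom C f) = inj_emb C (Cod C f) \<cdot> f"
      "h \<cdot> cosyz_proj C (Dom C f) = cosyz_proj C (Cod C f) \<cdot> g"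
    unfolding Let_def using mem_stable_class[of "Id C A"] by auto
  have [simp]: "f \<in> Arr C" "Dom C f = A" "Cod C f = A" using stabD[OF f] by auto
  note [simp] = g[simplified, unfolded Hom_iff] h[simplified, unfolded Hom_iff] e[simplified]
  have "null C (h \<boxminus> Id C (Omega_inv C A))"
    by (rule ses_map_null[OF s(1) s(1) s(3), of "f \<boxminus> Id C A" "g \<boxminus> Id C (Cod C (inj_emb C A))"])
      (use stabD(5)[OF f] in \<open>simp_all add: Hom_iff\<close>)
  then have "stab C h (Id C (Omega_inv C A))" by (simp add: stab_def)
  then show ?thesis unfolding Omega_inv_arr_def h_def[symmetric] by (simp add: stable_class_eq_iff)
qed

text \<open>In the standard triangle on \<open>f\<close>, the pushout map \<open>t\<close> from an
  injective onto the third object is epic, and its kernel is \<open>Dom C k\<close> embedded through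
  \<open>Cod C k\<close>. So the third object is a cosyzygy of the kernel of
  \<open>f\<close>.\<close>

lemma ses_stable_triangle:
  assumes kf: "short_exact C k f"
  obtains u v w where "(u, v, w) \<in> stable_triangles C" "Dom (stable_cat C) u = Cod C k"
    "Cod (stable_cat C) u = Cod C f" "Dom (stable_cat C) v = Cod C f"
    "stab_iso C (Omega_inv C (Dom C k)) (Cod (stable_cat C) v)"
proof -
  let ?T = "stable_cat C"
  note [simp] = short_exactD[OF kf]
  define A where "A = Cod C k"
  note [simp] = A_def[symmetric]
  have A [simp]: "A \<in> Ob C" using Cod_in[of k] by simp
  note s = cosyzygy_seq[OF A]
  note [simp] = short_exactD[OF s(1)] s(2,4) Omega_Ob(1)[OF A]
  have f: "f \<in> Hom C (Dom C (inj_emb C A)) (Cod C f)" by (simp add: Hom_iff)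
  obtain g h t where gh: "short_exact C g h" "Dom C g = Cod C f" "Cod C h = Cod C (cosyz_proj C A)"
    and t: "t \<in> Hom C (Cod C (inj_emb C A)) (Cod C g)" "t \<cdot> inj_emb C A = g \<cdot> f" "h \<cdot> t = cosyz_proj C A"
    by (rule pushout[OF s(1) f]) blast
  note [simp] = short_exactD[OF gh(1)] gh(2) t(1)[unfolded Hom_iff]
  have [simp]: "Cod C h = Omega_inv C A" using gh(3) by simp
  note me = short_exact_mono_epi[OF kf] short_exact_mono_epi[OF s(1)] short_exact_mono_epi[OF gh(1)]
  define k' where "k' = inj_emb C A \<cdot> k"
  have k'h: "k' \<in> Hom C (Dom C k) (Cod C (inj_emb C A))" by (simp add: k'_def Hom_iff)
  note [simp] = k'h[unfolded Hom_iff]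
  have "is_epi C t"
  proof (rule epiI)
    fix x assume x [simp]: "x \<in> Arr C" "Dom C x = Cod C t" and xt: "x \<cdot> t = Zero C (Dom C t) (Cod C x)"
    have "(x \<cdot> g) \<cdot> f = (x \<cdot> t) \<cdot> inj_emb C A" by (simp add: t(2))
    then have "(x \<cdot> g) \<cdot> f = Zero C (Cod C f) (Cod C x) \<cdot> f" unfolding xt by simp
    then have "x \<cdot> g = Zero C (Cod C f) (Cod C x)"
      using epi_cancel[OF me(2), of "x \<cdot> g" "Zero C (Cod C f) (Cod C x)"] by simp
    then obtain y where y: "y \<in> Hom C (Cod C h) (Cod C x)" "y \<cdot> h = x" using ses_colift[OF gh(1), of x] by auto
    note [simp] = y(1)[unfolded Hom_iff]
    have "y \<cdot> cosyz_proj C A = x \<cdot> t" unfolding t(3)[symmetric] y(2)[symmetric] by simp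
    then have "y \<cdot> cosyz_proj C A = Zero C (Omega_inv C A) (Cod C x) \<cdot> cosyz_proj C A" unfolding xt by simp
    then have y0: "y = Zero C (Omega_inv C A) (Cod C x)"
      using epi_cancel[OF me(4), of y "Zero C (Omega_inv C A) (Cod C x)"] by simp
    have "y \<cdot> h = Zero C (Cod C g) (Cod C x)" unfolding y0 by simp
    then show "x = Zero C (Cod C t) (Cod C x)" unfolding y(2) by simp
  qed simp
  moreover have "is_kernel C k' t"
  proof (rule kernelI)
    show "is_mono C k'"
    proof (rule monoI)
      fix x assume x [simp]: "x \<in> Arr C" "Cod C x = Dom C k'" and kx: "k' \<cdot> x = Zero C (Dom C x) (Cod C k')"
      have "inj_emb C A \<cdot> (k \<cdot> x) = inj_emb C A \<cdot> Zero C (Dom C x) A" using kx by (simp add: k'_def)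
      then have "k \<cdot> x = k \<cdot> Zero C (Dom C x) (Dom C k)"
        using mono_cancel[OF me(3), of "k \<cdot> x" "Zero C (Dom C x) A"] by simp
      then show "x = Zero C (Dom C x) (Dom C k')"
        using mono_cancel[OF me(1), of x "Zero C (Dom C x) (Dom C k)"] by simp
    qed simp
    show "t \<cdot> k' = Zero C (Dom C k') (Cod C t)"
      using comp_reassoc[OF t(2), of k] by (simp add: k'_def)
    fix x assume x [simp]: "x \<in> Arr C" "Cod C x = Cod C k'" and tx: "t \<cdot> x = Zero C (Dom C x) (Cod C t)"
    have "cosyz_proj C A \<cdot> x = Zero C (Dom C x) (Omega_inv C A)" using comp_reassoc[OF t(3), of x] tx by simp
    then obtain y where y: "y \<in> Hom C (Dom C x) A" "inj_emb C A \<cdot> y = x"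
      using ses_lift[OF s(1), of x] by auto
    note [simp] = y(1)[unfolded Hom_iff]
    have "g \<cdot> (f \<cdot> y) = t \<cdot> x" using comp_reassoc[OF t(2), of y] y(2) by simp
    then have "g \<cdot> (f \<cdot> y) = g \<cdot> Zero C (Dom C x) (Cod C f)" unfolding tx by simp
    then have "f \<cdot> y = Zero C (Dom C x) (Cod C f)"
      using mono_cancel[OF me(5), of "f \<cdot> y" "Zero C (Dom C x) (Cod C f)"] by simp
    then obtain z where z: "z \<in> Hom C (Dom C x) (Dom C k)" "k \<cdot> z = y" using ses_lift[OF kf, of y] by auto
    note [simp] = z(1)[unfolded Hom_iff]
    have "k' \<cdot> z = x" by (simp add: k'_def z(2) y(2))
    then show "\<exists>y\<in>Hom C (Dom C x) (Dom C k'). k' \<cdot> y = x" by (intro bexI[of _ z]) (simp_all add: Hom_iff)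
  qed simp_all
  ultimately have k't: "short_exact C k' t" by (rule epi_kernel_ses)
  have iso: "stab_iso C (Cod C t) (Omega_inv C (Dom C k))"
    by (rule Omega_inv_iso[OF k't]) (use s(3) in \<open>simp_all add: stab_iso_refl\<close>)
  have std: "(stable_class C f, stable_class C g, stable_class C h) \<in> standard_triangles C"
    unfolding standard_triangles_def
    using gh t by (intro CollectI exI[of _ f] exI[of _ g] exI[of _ h] exI[of _ t]) simp
  have iso_Id: "is_iso ?T (stable_class C (Id C B))" if "B \<in> Ob C" for B
    unfolding is_iso_def using that by (auto simp: stable_Hom Hom_iff intro!: bexI[of _ "stable_class C (Id C B)"])
  have Id_Hom: "stable_class C (Id C B) \<in> Hom ?T B B" if "B \<in> Ob C" for B
    using that by (auto simp: stable_Hom Hom_iff)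
  have "(stable_class C f, stable_class C g, stable_class C h) \<in> stable_triangles C"
    unfolding stable_triangles_def Let_def
  proof (intro CollectI case_prodI conjI exI)
    show "stable_class C h \<in> Hom ?T (Cod ?T (stable_class C g)) (Omega_inv C (Dom ?T (stable_class C f)))"
      by (simp add: stable_Hom Hom_iff)
    show "(stable_class C f, stable_class C g, stable_class C h) \<in> standard_triangles C" by (rule std)
    show "is_iso ?T (stable_class C (Id C A))" "is_iso ?T (stable_class C (Id C (Cod C f)))"
      "is_iso ?T (stable_class C (Id C (Cod C g)))" by (simp_all add: iso_Id)
  qed (simp_all add: Id_Hom Omega_inv_arr_Id)
  from that[OF this] show thesis using stab_iso_sym[OF iso] by simp
qed

end

section \<open>t-structures\<close>

context frobenius_abelian_category
begin

lemma stable_Hom_zero_iff: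
  assumes "A \<in> Ob C" "B \<in> Ob C"
  shows "Hom (stable_cat C) A B = {Zero (stable_cat C) A B} \<longleftrightarrow> (\<forall>f \<in> Hom C A B. null C f)"
proof -
  have Z: "Zero C A B \<in> Hom C A B" using assms by (simp add: Hom_iff)
  have *: "stable_class C f = stable_class C (Zero C A B) \<longleftrightarrow> null C f" if "f \<in> Hom C A B" for f
    using that assms null_iff_stab[of f] by (simp add: Hom_iff stable_class_eq_iff)
  have "Hom (stable_cat C) A B = {Zero (stable_cat C) A B} \<longleftrightarrow>
    (\<forall>f \<in> Hom C A B. stable_class C f = stable_class C (Zero C A B))"
    unfolding stable_Hom using Z by auto
  also have "\<dots> \<longleftrightarrow> (\<forall>f \<in> Hom C A B. null C f)" using * by blast
  finally show ?thesis .
qed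

lemma null_Hom_iso:
  assumes n: "\<forall>f \<in> Hom C A B. null C f" and i: "stab_iso C B B'" and f: "f \<in> Hom C A B'"
  shows "null C f"
proof -
  obtain u v where uv: "u \<in> Hom C B B'" "v \<in> Hom C B' B" "stab C (u \<cdot> v) (Id C B')"
    using i unfolding stab_iso_def by blast
  note [simp] = uv(1,2)[unfolded Hom_iff] f[unfolded Hom_iff]
  have "null C (v \<cdot> f)" using n by (simp add: Hom_iff)
  then have "null C (u \<cdot> (v \<cdot> f))" by (rule null_comp(1)) simp_all
  moreover have "stab C ((u \<cdot> v) \<cdot> f) (Id C B' \<cdot> f)" by (rule stab_comp(2)[OF uv(3)]) simp_all
  ultimately show ?thesis using null_cong[OF stab_sym] by force
qed

lemma null_Hom_iso_left:
  assumes "\<forall>f \<in> Hom C A B. null C f" "stab_iso C A A'" "f \<in> Hom C A' B"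
  shows "null C f"
  using frobenius_abelian_category.null_Hom_iso[OF frobenius_op, of B A A' f] assms stab_iso_op by simp

text \<open>If \<open>p\<close> vanishes in the stable category, the triangle of a short exact sequence splits; the
  second hypothesis kills the summand $\Omega(\mathrm{Cod}\,p)$ of $\mathrm{Dom}\,i$.\<close>

lemma ses_null_epi_iso:
  assumes ses: "short_exact C i p" and p: "null C p"
    and jr: "short_exact C j r" "Dom C j = Dom C i" "Cod C j \<in> Proj C"
    and n: "\<forall>f \<in> Hom C (Cod C r) (Cod C p). null C f"
  shows "stab_iso C (Dom C i) (Cod C i)"
proof -
  note [simp] = short_exactD[OF ses] short_exactD[OF jr(1)] jr(2)
  \<comment> \<open>Lifting the null map \<open>p\<close> along \<open>p\<close> gives a null
    \<open>m\<close> with \<open>p (1 - m) = 0\<close>; factoring \<open>1 - m\<close> through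
    \<open>i\<close> yields a stable section \<open>h\<close> of \<open>i\<close>.\<close>
  obtain m where m: "m \<in> Hom C (Cod C i) (Cod C i)" "null C m" "p \<cdot> m = p"
    using null_lift[OF p ses] by auto
  note [simp] = m(1)[unfolded Hom_iff]
  have "p \<cdot> Id C (Cod C i) = p \<cdot> m" using m(3) by simp
  then obtain h where h: "h \<in> Hom C (Cod C i) (Dom C i)" "i \<cdot> h = Id C (Cod C i) \<boxminus> m"
    using ses_lift_diff[OF ses, of "Id C (Cod C i)" m] by auto
  note [simp] = h(1)[unfolded Hom_iff]
  have ih: "stab C (i \<cdot> h) (Id C (Cod C i))" unfolding h(2)
    by (rule stab_add_null) (use null_neg[OF m(2)] in simp_all)
  \<comment> \<open>For the other composite only \<open>i y\<close> is visibly null. Extended over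
    the injective \<open>Cod C j\<close>, it can be pulled back through \<open>i\<close> up to an
    obstruction \<open>w\<close> from the cosyzygy to \<open>Cod C p\<close>, which is null by
    hypothesis and can be subtracted.\<close>
  define y where "y = Id C (Dom C i) \<boxminus> h \<cdot> i"
  have [simp]: "y \<in> Arr C" "Dom C y = Dom C i" "Cod C y = Dom C i" by (simp_all add: y_def)
  have "i \<cdot> y = m \<cdot> i" using comp_reassoc[OF h(2), of i] by (simp add: y_def)
  then have "null C (i \<cdot> y)" using null_comp(2)[OF m(2), of i] by simp
  then obtain l where l: "l \<in> Hom C (Cod C j) (Cod C i)" "l \<cdot> j = i \<cdot> y"
    using null_extend[OF _ jr(1), of "i \<cdot> y"] by auto
  note [simp] = l(1)[unfolded Hom_iff]
  have "(p \<cdot> l) \<cdot> j = Zero C (Dom C j) (Cod C p)"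
    using comp_reassoc[OF short_exactD(4)[OF ses], of y] l(2) by simp
  then obtain w where w: "w \<in> Hom C (Cod C r) (Cod C p)" "w \<cdot> r = p \<cdot> l"
    using ses_colift[OF jr(1), of "p \<cdot> l"] by auto
  note [simp] = w(1)[unfolded Hom_iff]
  have "null C w" using n w(1) by blast
  then obtain w' where w': "w' \<in> Hom C (Cod C r) (Cod C i)" "p \<cdot> w' = w"
    using null_lift[OF _ ses, of w] by auto
  note [simp] = w'(1)[unfolded Hom_iff]
  have "p \<cdot> l = p \<cdot> (w' \<cdot> r)" using comp_reassoc[OF w'(2), of r] w(2) by simp
  then obtain l' where l': "l' \<in> Hom C (Cod C j) (Dom C i)" "i \<cdot> l' = l \<boxminus> w' \<cdot> r"
    using ses_lift_diff[OF ses, of l "w' \<cdot> r"] by auto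
  note [simp] = l'(1)[unfolded Hom_iff]
  have "i \<cdot> (l' \<cdot> j) = i \<cdot> y" using comp_reassoc[OF l'(2), of j] l(2) by simp
  then have "l' \<cdot> j = y" using mono_cancel[of i "l' \<cdot> j" y] short_exact_mono_epi[OF ses] by simp
  then have "null C y" using nullI[OF jr(3) _ l'(1), of j "Dom C i"] by (simp add: Hom_iff)
  then have "stab C (h \<cdot> i) (Id C (Dom C i))"
    unfolding y_def by (intro stab_sym[of "Id C (Dom C i)"]) (simp add: stab_def)
  then show ?thesis using ih unfolding stab_iso_def
    by (intro bexI[of _ i] bexI[of _ h]) (simp_all add: Hom_iff)
qed

lemma ses_null_mono_iso:
  assumes ses: "short_exact C i p" and i: "null C i"
    and jr: "short_exact C j r" "Cod C r = Cod C p" "Cod C j \<in> Proj C"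
    and n: "\<forall>f \<in> Hom C (Dom C i) (Dom C j). null C f"
  shows "stab_iso C (Cod C i) (Cod C p)"
proof -
  interpret op: frobenius_abelian_category "op C" by (rule frobenius_op)
  have "stab_iso (op C) (Cod C p) (Dom C p)"
    using op.ses_null_epi_iso[OF short_exact_op[OF ses] _ short_exact_op[OF jr(1)]] i jr n
      short_exactD(3)[OF jr(1)] Proj_eq_Inj by simp
  then show ?thesis unfolding stab_iso_def using short_exactD(3)[OF ses] by auto
qed

section \<open>Passage between cotorsion pairs and t-structures\<close>

lemma Omega_inv_null_iff:
  assumes "A \<in> Ob C" "B \<in> Ob C"
  shows "(\<forall>f \<in> Hom C A (Omega_inv C B). null C f) \<longleftrightarrow> ext_orth C A B"
  using ext_orth_null_right[OF cosyzygy_seq(1,3)[OF assms(2)] assms(1)] cosyzygy_seq(2,4)[OF assms(2)] by simp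

text \<open>A special precover sequence \<open>B -> A -> D\<close> rotates into the truncation
  triangle from \<open>A\<close> to \<open>D\<close> to the suspension of \<open>B\<close>. The two
  inclusions are the shift closures of \<open>Z\<close> and \<open>W\<close>, transported by the
  mutually inverse shifts.\<close>

lemma special_pair_t_structure:
  assumes ZW: "special_pair C Z W" and c: "cosyzygy_closed C Z"
  shows "t_structure (stable_tri_cat C) Z (susp (susp W))"
proof -
  note o = special_pair_orth[OF ZW]
  have Z: "stab_closed Z" using left_orth_stab_closed[OF o(2,3)] .
  have W: "stab_closed W" unfolding o(1) by (rule right_orth_stab_closed)
  have V: "desusp (susp (susp W)) = susp W" by (rule desusp_susp[OF ess_image_stab_closed])
  have ZZ: "susp Z \<subseteq> Z" using c cosyzygy_closed_iff[OF Z] by simp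
  have WW: "desusp W \<subseteq> W" using c special_pair_closed_iff[OF ZW] syzygy_closed_iff[OF W] by simp
  show ?thesis unfolding t_structure_def tri_simps V
  proof (intro conjI ballI)
    show "subcategory (stable_tri_cat C) Z" "subcategory (stable_tri_cat C) (susp (susp W))"
      unfolding tri_subcategory using Z ess_image_stab_closed by auto
  next
    fix D D' assume D: "D \<in> Z" and D': "D' \<in> susp W"
    obtain B where B: "B \<in> W" "stab_iso C (Omega_inv C B) D'" using D' unfolding ess_image_iff by blast
    have "ext_orth C D B" using D B(1) o(2) unfolding left_orth_def by blast
    then have "\<forall>f \<in> Hom C D (Omega_inv C B). null C f"
      using Omega_inv_null_iff[of D B] stab_closedD(2)[OF Z D] stab_closedD(2)[OF W B(1)] by simp
    then have "\<forall>f \<in> Hom C D D'. null C f" using null_Hom_iso B(2) by blast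
    then show "Hom (stable_tri_cat C) D D' = {Zero (stable_cat C) D D'}"
      using stable_Hom_zero_iff[of D D'] stab_closedD(2)[OF Z D] stab_iso_Ob(2)[OF B(2)]
      unfolding tri_Hom by blast
  next
    have "Z = desusp (susp Z)" using desusp_susp[OF Z] by simp
    also have "\<dots> \<subseteq> desusp Z" using ZZ unfolding ess_image_def by blast
    finally show "Z \<subseteq> desusp Z" .
  next
    have "W = susp (desusp W)" using susp_desusp[OF W] by simp
    also have "\<dots> \<subseteq> susp W" using WW by (rule susp_mono)
    finally show "susp W \<subseteq> susp (susp W)" by (rule susp_mono)
  next
    fix D assume "D \<in> Ob C"
    then obtain i p where ip: "short_exact C i p" "Dom C i \<in> W" "Cod C i \<in> Z" "Cod C p = D"
      using ZW unfolding special_pair_def by blast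
    obtain u v w where *: "(u, v, w) \<in> stable_triangles C" "Dom (stable_cat C) u = Cod C i"
      "Cod (stable_cat C) u = Cod C p" "Dom (stable_cat C) v = Cod C p"
      "stab_iso C (Omega_inv C (Dom C i)) (Cod (stable_cat C) v)"
      by (rule ses_stable_triangle[OF ip(1)])
    then have "Cod (stable_cat C) v \<in> susp W" using ip(2) unfolding ess_image_iff by blast
    then show "\<exists>u v w. (u, v, w) \<in> stable_triangles C \<and> Dom (stable_cat C) u \<in> Z \<and>
      Cod (stable_cat C) u = D \<and> Dom (stable_cat C) v = D \<and> Cod (stable_cat C) v \<in> susp W"
      using * ip(3,4) by metis
  qed
qed

text \<open>A map from an object of \<open>U\<close> to \<open>A\<close> becomes null in the third
  term of the truncation sequence, so stably it factors through the first term. Making the map from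
  that term epic absorbs the null error.\<close>

lemma precovering_of_triangles:
  assumes U: "coresolving C U"
    and tri: "\<And>D. D \<in> Ob C \<Longrightarrow> \<exists>i p. short_exact C i p \<and> Dom C i \<in> U \<and> stab_iso C (Cod C i) D \<and>
      (\<forall>X \<in> U. \<forall>f \<in> Hom C X (Cod C p). null C f)"
  shows "precovering C U"
  unfolding precovering_def
proof
  fix A assume A: "A \<in> Ob C"
  obtain i p where ip: "short_exact C i p" and iU: "Dom C i \<in> U" and iso: "stab_iso C (Cod C i) A"
    and n: "\<And>X f. X \<in> U \<Longrightarrow> f \<in> Hom C X (Cod C p) \<Longrightarrow> null C f"
    using tri[OF A] by blast
  obtain u v where uv: "u \<in> Hom C (Cod C i) A" "v \<in> Hom C A (Cod C i)" "stab C (u \<cdot> v) (Id C A)"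
    using iso unfolding stab_iso_def by blast
  note [simp] = short_exactD[OF ip] uv(1,2)[unfolded Hom_iff] A
  have f: "u \<cdot> i \<in> Hom C (Dom C i) A" by (simp add: Hom_iff)
  obtain S P j g where S: "is_biproduct C (Dom C i) P S" "P \<in> Proj C" "j \<in> Hom C (Dom C i) S"
    "g \<in> Hom C S A" "is_epi C g" "g \<cdot> j = u \<cdot> i"
    by (rule epification[OF f]) blast
  note [simp] = S(3,4)[unfolded Hom_iff]
  obtain k where k: "short_exact C k g" using epi_ses S(5) by blast
  have [simp]: "Cod C k = S" using short_exactD(3)[OF k] by simp
  have "\<exists>h \<in> Hom C X S. g \<cdot> h = x" if X: "X \<in> U" and x: "x \<in> Hom C X A" for X x
  proof -
    note [simp] = x[unfolded Hom_iff]
    have "null C (p \<cdot> (v \<cdot> x))" by (rule n[OF X]) (simp add: Hom_iff)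
    then obtain m where m: "m \<in> Hom C X (Cod C i)" "null C m" "p \<cdot> m = p \<cdot> (v \<cdot> x)"
      using null_lift[OF _ ip, of "p \<cdot> (v \<cdot> x)"] by auto
    note [simp] = m(1)[unfolded Hom_iff]
    obtain y where y: "y \<in> Hom C X (Dom C i)" "i \<cdot> y = v \<cdot> x \<boxminus> m"
      using ses_lift_diff[OF ip, of "v \<cdot> x" m] m(3) by auto
    note [simp] = y(1)[unfolded Hom_iff]
    have "stab C (v \<cdot> x \<boxminus> m) (v \<cdot> x)" by (rule stab_add_null) (use null_neg[OF m(2)] in simp_all)
    then have "stab C (u \<cdot> (i \<cdot> y)) (u \<cdot> (v \<cdot> x))"
      unfolding y(2) by (rule stab_comp(1)) simp_all
    moreover have "stab C ((u \<cdot> v) \<cdot> x) (Id C A \<cdot> x)" by (rule stab_comp(2)[OF uv(3)]) simp_all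
    ultimately have "stab C (u \<cdot> (i \<cdot> y)) x" using stab_trans by simp
    moreover have gjy: "g \<cdot> (j \<cdot> y) = u \<cdot> (i \<cdot> y)" using comp_reassoc[OF S(6), of y] by simp
    ultimately have "null C (x \<boxminus> g \<cdot> (j \<cdot> y))" using stabD(5)[OF stab_sym] by simp
    then obtain l where l: "l \<in> Hom C X S" "g \<cdot> l = x \<boxminus> g \<cdot> (j \<cdot> y)"
      using null_lift[OF _ k, of "x \<boxminus> g \<cdot> (j \<cdot> y)"] by auto
    note [simp] = l(1)[unfolded Hom_iff]
    have "g \<cdot> (j \<cdot> y \<boxplus> l) = g \<cdot> (j \<cdot> y) \<boxplus> (x \<boxminus> g \<cdot> (j \<cdot> y))" by (simp add: l(2))
    also have "\<dots> = x" by (rule add_minus_cancel(1)) simp_all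
    finally show ?thesis by (intro bexI[of _ "j \<cdot> y \<boxplus> l"]) (simp_all add: Hom_iff)
  qed
  moreover have "S \<in> U" using coresolving_biproduct_Proj[OF U S(1) iU S(2)] .
  ultimately have "is_precover C U A g" unfolding is_precover_def by simp
  then show "\<exists>f. is_precover C U A f" by blast
qed

text \<open>The axioms give \<open>U\<close> only suspension closure; the coresolving property and
  summand closure are gained by recognising \<open>U\<close> as an Ext-orthogonal class. For that,
  \<open>U\<close> and \<open>V1\<close> must first be shown to be full stable orthogonals of each
  other.\<close>

lemma t_structure_special_pair:
  assumes split: "split_stably C" and ts: "t_structure (stable_tri_cat C) U V"
  shows "\<exists>W. special_pair C U W \<and> cosyzygy_closed C U \<and> V = susp (susp W)"
proof -
  define V1 where "V1 = desusp V"
  have U: "stab_closed U" and V: "stab_closed V" and UU: "U \<subseteq> desusp U"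
    using ts unfolding t_structure_def tri_subcategory tri_simps by auto
  have V1: "stab_closed V1" unfolding V1_def by (rule ess_image_stab_closed)
  have null: "\<forall>f \<in> Hom C X E. null C f" if XE: "X \<in> U" "E \<in> V1" for X E
  proof -
    have "Hom (stable_cat C) X E = {Zero (stable_cat C) X E}"
      using ts XE unfolding t_structure_def V1_def by simp
    then show ?thesis using stable_Hom_zero_iff stab_closedD(2) U V1 XE by blast
  qed
  have tri: "\<exists>i p. short_exact C i p \<and> Dom C i \<in> U \<and> stab_iso C (Cod C i) D \<and> Cod C p \<in> V1"
    if D: "D \<in> Ob C" for D
  proof -
    obtain u v w where uvw: "(u, v, w) \<in> stable_triangles C" "Dom (stable_cat C) u \<in> U"
      "Cod (stable_cat C) u = D" "Cod (stable_cat C) v \<in> V1"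
      using ts D unfolding t_structure_def V1_def by auto
    obtain i p where "short_exact C i p" "stab_iso C (Dom (stable_cat C) u) (Dom C i)"
      "stab_iso C (Cod (stable_cat C) u) (Cod C i)" "stab_iso C (Cod (stable_cat C) v) (Cod C p)"
      by (rule stable_triangle_ses[OF uvw(1)])
    then show ?thesis using uvw stab_closedD(1)[OF U] stab_closedD(1)[OF V1] stab_iso_sym[of C D "Cod C i"] by metis
  qed
  have "susp U \<subseteq> susp (desusp U)" using UU by (rule susp_mono)
  then have sU: "susp U \<subseteq> U" using susp_desusp[OF U] by simp
  then have c: "cosyzygy_closed C U" using cosyzygy_closed_iff[OF U] by simp
  \<comment> \<open>The second map of the truncation sequence of such an \<open>X\<close> is null,
    so the sequence splits stably and \<open>X\<close> is its own truncation. Suspension closure of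
    \<open>U\<close> supplies the vanishing that excludes an extra summand.\<close>
  have U_iff: "X \<in> U" if X: "X \<in> Ob C" and n: "\<And>E. E \<in> V1 \<Longrightarrow> \<forall>f \<in> Hom C X E. null C f" for X
  proof -
    obtain i p where ip: "short_exact C i p" "Dom C i \<in> U" "stab_iso C (Cod C i) X" "Cod C p \<in> V1"
      using tri[OF X] by blast
    note [simp] = short_exactD[OF ip(1)]
    have "null C p" using null_Hom_iso_left[OF n[OF ip(4)] stab_iso_sym[OF ip(3)], of p] by (simp add: Hom_iff)
    moreover have d: "Dom C i \<in> Ob C" by simp
    moreover have "Omega_inv C (Dom C i) \<in> U"
      using sU ip(2) stab_iso_refl[OF Omega_Ob(1)[OF d]] unfolding subset_iff ess_image_iff by blast
    ultimately have "stab_iso C (Dom C i) (Cod C i)"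
      using ses_null_epi_iso[OF ip(1) _ cosyzygy_seq(1-3)[OF d]] null[OF _ ip(4)] cosyzygy_seq(4)[OF d] by simp
    then show "X \<in> U" using stab_iso_trans[OF _ ip(3)] ip(2) stab_closedD(1)[OF U] by blast
  qed
  have V_iff: "E \<in> V1" if E: "E \<in> Ob C" and n: "\<And>X. X \<in> U \<Longrightarrow> \<forall>f \<in> Hom C X E. null C f" for E
  proof -
    obtain i p where ip: "short_exact C i p" "Dom C i \<in> U" "stab_iso C (Cod C i) E" "Cod C p \<in> V1"
      using tri[OF E] by blast
    note [simp] = short_exactD[OF ip(1)]
    have ni: "null C i" using null_Hom_iso[OF n[OF ip(2)] stab_iso_sym[OF ip(3)], of i] by (simp add: Hom_iff)
    have d: "Dom C i \<in> Ob C" and e: "Cod C p \<in> Ob C" by simp_all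
    have "Omega_inv C (Dom C i) \<in> U"
      using sU ip(2) stab_iso_refl[OF Omega_Ob(1)[OF d]] unfolding subset_iff ess_image_iff by blast
    then have nO: "\<forall>f \<in> Hom C (Omega_inv C (Dom C i)) (Cod C p). null C f" using null ip(4) by blast
    obtain j r where jr: "short_exact C j r" "Cod C r = Cod C p" "Cod C j \<in> Proj C"
      using enough_proj_ses[OF e] .
    note [simp] = short_exactD[OF jr(1)]
    \<comment> \<open>The dual splitting criterion needs vanishing of maps from
      \<open>Dom C i\<close> to a syzygy of \<open>Cod C p\<close>; two dimension shifts through
      Ext^1 move the suspension on the source to a syzygy on the target.\<close>
    have "ext_orth C (Omega_inv C (Dom C i)) (Dom C j)"
      using ext_orth_null_right[OF jr(1,3) Omega_Ob(1)[OF d]] nO jr(2) by simp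
    then have "\<forall>f \<in> Hom C (Dom C i) (Dom C j). null C f"
      using ext_orth_null_left[OF cosyzygy_seq(1,3)[OF d], of "Dom C j"] cosyzygy_seq(2,4)[OF d] by simp
    then have "stab_iso C (Cod C i) (Cod C p)" using ses_null_mono_iso[OF ip(1) ni jr] by blast
    then have "stab_iso C (Cod C p) E" using stab_iso_trans[OF stab_iso_sym ip(3)] by blast
    then show "E \<in> V1" using ip(4) stab_closedD(1)[OF V1] by blast
  qed
  \<comment> \<open>The desuspension of \<open>V1\<close>, chosen so that stable orthogonality to
    \<open>V1\<close> becomes Ext-orthogonality to \<open>Y\<close>.\<close>
  define Y where "Y = {B \<in> Ob C. Omega_inv C B \<in> V1}"
  have YO: "Y \<subseteq> Ob C" by (auto simp: Y_def)
  have UY: "U = left_orth C Y"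
  proof (intro equalityI subsetI)
    fix X assume X: "X \<in> U"
    then show "X \<in> left_orth C Y"
      using null[OF X] Omega_inv_null_iff[of X] stab_closedD(2)[OF U X] unfolding Y_def left_orth_def by blast
  next
    fix X assume X: "X \<in> left_orth C Y"
    show "X \<in> U"
    proof (rule U_iff)
      show XO: "X \<in> Ob C" using X by (simp add: left_orth_def)
      fix E assume E: "E \<in> V1"
      note EO = stab_closedD(2)[OF V1 E]
      have "Omega_inv C (Omega C E) \<in> V1"
        using stab_closedD(1)[OF V1 E stab_iso_sym[OF Omega_inv_Omega[OF EO]]] .
      then have "ext_orth C X (Omega C E)" using X Omega_Ob(2)[OF EO] unfolding left_orth_def Y_def by blast
      then have "\<forall>f \<in> Hom C X (Omega_inv C (Omega C E)). null C f"
        using Omega_inv_null_iff[OF XO Omega_Ob(2)[OF EO]] by blast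
      then show "\<forall>f \<in> Hom C X E. null C f" using null_Hom_iso[OF _ Omega_inv_Omega[OF EO]] by blast
    qed
  qed
  have cor: "coresolving C U" "summand_closed C U"
    using left_orth_coresolving[OF UY YO c] left_orth_summand[OF UY YO] .
  have "precovering C U"
    by (rule precovering_of_triangles[OF cor(1)]) (use tri null in metis)
  then have sp: "special_pair C U (right_orth C U)"
    using special_pair_of_coresolving[OF split _ cor] by blast
  have "V1 = susp (right_orth C U)"
  proof (intro equalityI subsetI)
    fix E assume E: "E \<in> V1"
    note EO = stab_closedD(2)[OF V1 E]
    have "ext_orth C X (Omega C E)" if X: "X \<in> U" for X
    proof -
      have "\<forall>f \<in> Hom C X (Omega_inv C (Omega C E)). null C f"
        using null_Hom_iso[OF null[OF X E] stab_iso_sym[OF Omega_inv_Omega[OF EO]]] by blast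
      then show ?thesis using Omega_inv_null_iff[OF stab_closedD(2)[OF U X] Omega_Ob(2)[OF EO]] by blast
    qed
    then have "Omega C E \<in> right_orth C U" using Omega_Ob(2)[OF EO] by (simp add: right_orth_def)
    then show "E \<in> susp (right_orth C U)" using Omega_inv_Omega[OF EO] unfolding ess_image_iff by blast
  next
    fix E assume "E \<in> susp (right_orth C U)"
    then obtain B where B: "B \<in> right_orth C U" "stab_iso C (Omega_inv C B) E" unfolding ess_image_iff by blast
    have BO: "B \<in> Ob C" using B(1) by (simp add: right_orth_def)
    have "Omega_inv C B \<in> V1"
    proof (rule V_iff)
      fix X assume X: "X \<in> U"
      then have "ext_orth C X B" using B(1) unfolding right_orth_def by blast
      then show "\<forall>f \<in> Hom C X (Omega_inv C B). null C f"
        using Omega_inv_null_iff[OF stab_closedD(2)[OF U X] BO] by blast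
    qed (rule Omega_Ob(1)[OF BO])
    then show "E \<in> V1" using B(2) stab_closedD(1)[OF V1] by blast
  qed
  then have "V = susp (susp (right_orth C U))" using susp_desusp[OF V] unfolding V1_def by simp
  then show ?thesis using sp c by blast
qed

section \<open>The correspondences\<close>

lemma coresolving_iff_special_pair:
  assumes split: "split_stably C"
  shows "precovering C X \<and> coresolving C X \<and> summand_closed C X \<longleftrightarrow>
    (\<exists>Y. special_pair C X Y \<and> cosyzygy_closed C X)"
  using special_pair_of_coresolving[OF split] coresolving_cosyzygy special_pair_coresolving by blast

lemma resolving_iff_special_pair:
  assumes split: "split_stably C"
  shows "preenveloping C X \<and> resolving C X \<and> summand_closed C X \<longleftrightarrow>
    (\<exists>Z. special_pair C Z X \<and> syzygy_closed C X)"
  using frobenius_abelian_category.coresolving_iff_special_pair[OF frobenius_op split_stably_op[OF split], of X]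
  by (simp add: op_resolving[OF category_axioms])

lemma special_pair_desusp_iff: "special_pair C Z W \<Longrightarrow> syzygy_closed C W \<longleftrightarrow> desusp W \<subseteq> W"
  using syzygy_closed_iff right_orth_stab_closed special_pair_orth(1) by metis

lemma special_pair_susp_iff: "special_pair C Z W \<Longrightarrow> cosyzygy_closed C Z \<longleftrightarrow> susp Z \<subseteq> Z"
  using cosyzygy_closed_iff left_orth_stab_closed special_pair_orth(2,3) by metis

end

theorem corollary5p8:
  fixes C :: "('o, 'm) add_cat"
  assumes "frobenius_abelian_category C"
    and "split_idempotents (stable_cat C)"
  defines "S \<equiv> stable_tri_cat C"
  shows
    "(\<forall>X. subcategory C X \<longrightarrow>
        ((preenveloping C X \<and> resolving C X \<and> summand_closed C X) \<longleftrightarrow>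
         (\<exists>Z. complete_cotorsion_pair C Z X \<and> ess_image S (Omega C) X \<subseteq> X))) \<and>
     (\<forall>X. subcategory C X \<longrightarrow>
        ((precovering C X \<and> coresolving C X \<and> summand_closed C X) \<longleftrightarrow>
         (\<exists>Y. complete_cotorsion_pair C X Y \<and> ess_image S (Omega_inv C) X \<subseteq> X))) \<and>
     (\<forall>Z W. complete_cotorsion_pair C Z W \<longrightarrow>
        (ess_image S (Omega_inv C) Z \<subseteq> Z \<longleftrightarrow> ess_image S (Omega C) W \<subseteq> W)) \<and>
     bij_betw fst
       {(Z, W). complete_cotorsion_pair C Z W \<and> ess_image S (Omega_inv C) Z \<subseteq> Z}
       {X. subcategory C X \<and> precovering C X \<and> coresolving C X \<and> summand_closed C X} \<and>
     bij_betw snd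
       {(Z, W). complete_cotorsion_pair C Z W \<and> ess_image S (Omega_inv C) Z \<subseteq> Z}
       {X. subcategory C X \<and> preenveloping C X \<and> resolving C X \<and> summand_closed C X} \<and>
     bij_betw (\<lambda>(Z, W). (Z, ess_image S (Susp S) (ess_image S (Susp S) W)))
       {(Z, W). complete_cotorsion_pair C Z W \<and> ess_image S (Omega_inv C) Z \<subseteq> Z}
       {(U, V'). t_structure S U V'}"
proof -
  interpret frobenius_abelian_category C by fact
  have split: "split_stably C" using assms(2) by (rule split_stablyI)
  let ?pairs = "{(Z, W). complete_cotorsion_pair C Z W \<and> susp Z \<subseteq> Z}"
  have pairs: "?pairs = {(Z, W). special_pair C Z W \<and> cosyzygy_closed C Z}"
    unfolding complete_cotorsion_pair_iff using special_pair_susp_iff by blast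
  have 1: "preenveloping C X \<and> resolving C X \<and> summand_closed C X \<longleftrightarrow>
         (\<exists>Z. complete_cotorsion_pair C Z X \<and> desusp X \<subseteq> X)" for X
    unfolding complete_cotorsion_pair_iff resolving_iff_special_pair[OF split]
    using special_pair_desusp_iff by blast
  have 2: "precovering C X \<and> coresolving C X \<and> summand_closed C X \<longleftrightarrow>
         (\<exists>Y. complete_cotorsion_pair C X Y \<and> susp X \<subseteq> X)" for X
    unfolding complete_cotorsion_pair_iff coresolving_iff_special_pair[OF split]
    using special_pair_susp_iff by blast
  have 3: "susp Z \<subseteq> Z \<longleftrightarrow> desusp W \<subseteq> W" if "complete_cotorsion_pair C Z W" for Z W
    using that special_pair_closed_iff special_pair_susp_iff special_pair_desusp_iff
    unfolding complete_cotorsion_pair_iff by blast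
  have sub: "subcategory C X" if "coresolving C X \<or> resolving C X" for X
    using that unfolding coresolving_def resolving_def additive_subcategory_def by blast
  \<comment> \<open>Each component of a cotorsion pair is the orthogonal of the other, so a map on
    pairs is injective once it determines one component.\<close>
  have inj: "inj_on f ?pairs" if "\<And>Z W Z' W'. f (Z, W) = f (Z', W') \<Longrightarrow> Z = Z' \<or> W = W'" for f :: "_ \<Rightarrow> 'z"
  proof (rule inj_onI, clarify)
    fix Z W Z' W' assume *: "complete_cotorsion_pair C Z W" "complete_cotorsion_pair C Z' W'"
      "f (Z, W) = f (Z', W')"
    show "Z = Z' \<and> W = W'"
      using that[OF *(3)] special_pair_orth(1,2)[OF *(1)[unfolded complete_cotorsion_pair_iff]]
        special_pair_orth(1,2)[OF *(2)[unfolded complete_cotorsion_pair_iff]] by metis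
  qed
  have "bij_betw fst ?pairs {X. subcategory C X \<and> precovering C X \<and> coresolving C X \<and> summand_closed C X}"
    unfolding bij_betw_def
  proof
    show "inj_on fst ?pairs" by (rule inj) simp
    show "fst ` ?pairs = {X. subcategory C X \<and> precovering C X \<and> coresolving C X \<and> summand_closed C X}"
      (is "_ = ?R")
    proof (intro equalityI subsetI)
      fix X assume "X \<in> fst ` ?pairs"
      then show "X \<in> ?R" using 2[of X] sub[of X] by force
    next
      fix X assume "X \<in> ?R"
      then obtain Y where "(X, Y) \<in> ?pairs" using 2[of X] by blast
      then show "X \<in> fst ` ?pairs" by force
    qed
  qed
  moreover have "bij_betw snd ?pairs {X. subcategory C X \<and> preenveloping C X \<and> resolving C X \<and> summand_closed C X}"
    unfolding bij_betw_def
  proof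
    show "inj_on snd ?pairs" by (rule inj) simp
    show "snd ` ?pairs = {X. subcategory C X \<and> preenveloping C X \<and> resolving C X \<and> summand_closed C X}"
      (is "_ = ?R")
    proof (intro equalityI subsetI)
      fix X assume "X \<in> snd ` ?pairs"
      then show "X \<in> ?R" using 1[of X] 3 sub[of X] by force
    next
      fix X assume "X \<in> ?R"
      then obtain Z where "(Z, X) \<in> ?pairs" using 1[of X] 3 by blast
      then show "X \<in> snd ` ?pairs" by force
    qed
  qed
  moreover have "bij_betw (\<lambda>(Z, W). (Z, susp (susp W))) ?pairs {(U, V'). t_structure (stable_tri_cat C) U V'}"
    unfolding bij_betw_def
  proof
    show "inj_on (\<lambda>(Z, W). (Z, susp (susp W))) ?pairs" by (rule inj) simp
    show "(\<lambda>(Z, W). (Z, susp (susp W))) ` ?pairs = {(U, V'). t_structure (stable_tri_cat C) U V'}"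
      unfolding pairs using special_pair_t_structure t_structure_special_pair[OF split] by fastforce
  qed
  ultimately show ?thesis unfolding S_def tri_simps using 1 2 3 by blast
qed

end
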